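(* Let $(\mu^{(0)},(\mu^{(1)},r^{(1)}),\dots,(\mu^{(n)},r^{(n)}))$ be a rigged configuration for $A^{(1)}_n$ with $\mu^{(0)}=(\mu^{(0)}_1,\dots,\mu^{(0)}_L)$ and let $p=p_1\otimes\cdots\otimes p_L$ be its image under the KKR map. Then for all $1\le i\le n+1$ and $1\le k\le L$, $$\tau_{k,i}=\rho_{k,i}(p)=\mathcal E_i(p_1\otimes\cdots\otimes p_k).$$
   Context: Fix $n\ge1$. For $l\ge1$ let $B_l=\{x=(x_1,\dots,x_{n+1})\in\mathbb Z_{\ge0}^{n+1}: \sum_i x_i=l\}$ (an element is also viewed as a one-row tableau with $x_i$ letters $i$) and $u_l=(l,0,\dots,0)\in B_l$. Indices of $x$ are read modulo $n+1$. For $x\in B_l,y\in B_m$ and $i\in\mathbb Z$ put $Q_i(x\otimes y)=\min_{1\le k\le n+1}\big(\sum_{j=1}^{k-1}x_{i+j}+\sum_{j=k+1}^{n+1}y_{i+j}\big)$ (so $Q_{n+1}=Q_0$). The combinatorial $R$ is the map $B_l\otimes B_m\to B_m\otimes B_l$, $x\otimes y\mapsto\tilde y\otimes\tilde x$, $\tilde x_i=x_i+Q_i-Q_{i-1}$, $\tilde y_i=y_i+Q_{i-1}-Q_i$ ($Q_j=Q_j(x\otimes y)$); write $x\otimes y\simeq\tilde y\otimes\tilde x$, and extend $\simeq$ to tensor products by applying $R$ to adjacent factors. Box-ball: for a state $p=p_1\otimes\cdots\otimes p_L\in B_{\lambda_1}\otimes\cdots\otimes B_{\lambda_L}$ and $l\ge1$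 let $v_0=u_l$ and recursively $v_{j-1}\otimes p_j\simeq p'_j\otimes v_j$; $T_l(p)=p'_1\otimes\cdots\otimes p'_L$; for $l$ sufficiently large this is independent of $l$ and is denoted $T_\infty(p)$. With $T_\infty^t(p)=p^t_1\otimes\cdots\otimes p^t_L$, $p^t_j=(x^t_{j,1},\dots,x^t_{j,n+1})$, set $\rho_{k,d}(p)=\sum_{j=1}^k(x^0_{j,2}+\cdots+x^0_{j,d})+\sum_{t\ge1}\sum_{j=1}^k(x^t_{j,2}+\cdots+x^t_{j,n+1})$ (finite) for $1\le d\le n+1$. Energy: for $q=q_1\otimes\cdots\otimes q_k$, $\mathcal E^\vee_i(q)=\sum_{1\le j<m\le k}Q_i(q_j\otimes q^{(j+1)}_m)$ with $q_{j+1}\otimes\cdots\otimes q_m\simeq q^{(j+1)}_m\otimes(\cdots)$ ($q^{(m)}_m=q_m$), and $\mathcal E_i(q)=\mathcal E^\vee_i(u_N\otimes q)$ for any $N\ge\max_j\lambda_j$. Multiset notation: $|\lambda|=\sum\lambda_i$, $\lambda_{[N]}=(\lambda_1,\dots,\lambda_N)$, $\min(\lambda,\mu)=\sum_{i,j}\min(\lambda_i,\mu_j)$, $\subseteq$ multiset inclusion. Rigged configuration: $(\mu^{(0)},(\mu^{(1)},r^{(1)}),\dots,(\mu^{(n)},r^{(n)}))$, $\mu^{(0)}$ a sequence of positive integers, each $(\mu^{(a)},r^{(a)})$ ($1\le a\le n$) a finite multiset of pairs (length $\mu^{(a)}_i\ge1$, rigging $r^{(a)}_i$) with $0\le r^{(a)}_i\le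 p^{(a)}_{\mu^{(a)}_i}$, vacancy numbers $p^{(a)}_j=E^{(a-1)}_j-2E^{(a)}_j+E^{(a+1)}_j$, $E^{(a)}_j=\sum_k\min(j,\mu^{(a)}_k)$, $E^{(n+1)}_j=0$. Tau functions: for $\lambda\subseteq\mu^{(0)}$, $1\le d\le n+1$, $\tau_d(\lambda)=\max\{\min(\lambda,\nu^{(1)})+\sum_{a=1}^{n-1}\min(\nu^{(a)},\nu^{(a+1)})-\sum_{a=1}^n\min(\nu^{(a)},\nu^{(a)})-\sum_{a=1}^n|s^{(a)}|-|\nu^{(d)}|\}$ over independent choices of sub-multisets of pairs $\{(\nu^{(a)}_i,s^{(a)}_i)\}\subseteq\{(\mu^{(a)}_i,r^{(a)}_i)\}$, $|\nu^{(n+1)}|=0$; $\tau_{k,d}=\tau_d(\mu^{(0)}_{[k]})$. KKR map: sends the rigged configuration to $p_1\otimes\cdots\otimes p_L\in B_{\mu^{(0)}_1}\otimes\cdots\otimes B_{\mu^{(0)}_L}$: rows $\mu^{(0)}_L,\dots,\mu^{(0)}_1$ are processed in this order, each until empty, by elementary steps each outputting a letter; $p_k=(x_1,\dots,x_{n+1})$ with $x_j$ the number of steps outputting $j$ while processing row $k$. Elementary step: let $\ell_0$ be the current length of the processed row; for $i=1,\dots,n$ in turn, among rows of $\mu^{(i)}$ of length $\ge\ell_{i-1}$ that are singular (rigging equals current vacancy number of its length) choose one of minimal length $\ell_i$, stopping if none exists; if $j-1$ rows were chosen, output $j$. Remove the last box of the processed row and of each chosen row (discard empty rows), recompute vacancy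 numbers from the new configuration (including the shortened $\mu^{(0)}$), assign to each shortened row of $\mu^{(1)},\dots,\mu^{(n)}$ the new vacancy number of its new length as rigging, keep all other riggings. *)

theory Defs
  imports Main "HOL-Library.Multiset"
begin

text \<open>An element x of B_l is a list of length n+1 of naturals; the letter count
  x_i (1 <= i <= n+1) is the list entry at position i-1.  Indices are read modulo n+1.\<close>

definition comp :: "nat \<Rightarrow> nat list \<Rightarrow> int \<Rightarrow> nat" where
  "comp n x i = x ! nat ((i - 1) mod int (n + 1))"

definition uvec :: "nat \<Rightarrow> nat \<Rightarrow> nat list" where
  "uvec n l = l # replicate n 0"

definition Qf :: "nat \<Rightarrow> nat list \<Rightarrow> nat list \<Rightarrow> int \<Rightarrow> nat" where
  "Qf n x y i = Min ((\<lambda>k. (\<Sum>j\<in>{1..<k}. comp n x (i + int j))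
                          + (\<Sum>j\<in>{k<..n+1}. comp n y (i + int j))) ` {1..n+1})"

definition Rmap :: "nat \<Rightarrow> nat list \<Rightarrow> nat list \<Rightarrow> nat list \<times> nat list" where
  "Rmap n x y =
     (map (\<lambda>i. nat (int (comp n y i) + int (Qf n x y (i - 1)) - int (Qf n x y i))) [1..int n + 1],
      map (\<lambda>i. nat (int (comp n x i) + int (Qf n x y i) - int (Qf n x y (i - 1)))) [1..int n + 1])"

fun Tl_aux :: "nat \<Rightarrow> nat list \<Rightarrow> nat list list \<Rightarrow> nat list list" where
  "Tl_aux n v [] = []"
| "Tl_aux n v (q # qs) = (case Rmap n v q of (q', v') \<Rightarrow> q' # Tl_aux n v' qs)"

definition Tl :: "nat \<Rightarrow> nat \<Rightarrow> nat list list \<Rightarrow> nat list list" where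
  "Tl n l p = Tl_aux n (uvec n l) p"

definition Tinf :: "nat \<Rightarrow> nat list list \<Rightarrow> nat list list" where
  "Tinf n p = (THE q. \<forall>\<^sub>F l in sequentially. Tl n l p = q)"

definition rho_t :: "nat \<Rightarrow> nat \<Rightarrow> nat list list \<Rightarrow> nat \<Rightarrow> nat" where
  "rho_t n k p t = (\<Sum>j<k. \<Sum>c\<in>{1..n}. ((Tinf n ^^ t) p ! j) ! c)"

definition rho :: "nat \<Rightarrow> nat \<Rightarrow> nat \<Rightarrow> nat list list \<Rightarrow> nat" where
  "rho n k d p = (\<Sum>j<k. \<Sum>c\<in>{1..<d}. (p ! j) ! c)
               + (\<Sum>t \<in> {t. 1 \<le> t \<and> rho_t n k p t \<noteq> 0}. rho_t n k p t)"

text \<open>carry n [q_{j+1},...,q_{m-1}] q_m = q_m^{(j+1)}: move q_m to the left by R.\<close>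
definition carry :: "nat \<Rightarrow> nat list list \<Rightarrow> nat list \<Rightarrow> nat list" where
  "carry n ys z = foldr (\<lambda>y z. fst (Rmap n y z)) ys z"

definition Evee :: "nat \<Rightarrow> int \<Rightarrow> nat list list \<Rightarrow> nat" where
  "Evee n i qs = (\<Sum>m<length qs. \<Sum>j<m.
       Qf n (qs ! j) (carry n (take (m - j - 1) (drop (j + 1) qs)) (qs ! m)) i)"

definition Energy :: "nat \<Rightarrow> int \<Rightarrow> nat list list \<Rightarrow> nat" where
  "Energy n i qs = Evee n i (uvec n (Max (set (map sum_list qs))) # qs)"

text \<open>mu0 is the list mu^(0); M a (1 <= a <= n) is the multiset of pairs (length, rigging).\<close>
type_synonym rc = "nat \<Rightarrow> (nat \<times> int) multiset"

definition Ecf :: "nat \<Rightarrow> nat list \<Rightarrow> rc \<Rightarrow> nat \<Rightarrow> nat \<Rightarrow> int" where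
  "Ecf n mu0 M a j = (if a = 0 then int (\<Sum>k<length mu0. min j (mu0 ! k))
                      else if a \<le> n then int (\<Sum>x\<in>#M a. min j (fst x)) else 0)"

definition vac :: "nat \<Rightarrow> nat list \<Rightarrow> rc \<Rightarrow> nat \<Rightarrow> nat \<Rightarrow> int" where
  "vac n mu0 M a j = Ecf n mu0 M (a - 1) j - 2 * Ecf n mu0 M a j + Ecf n mu0 M (a + 1) j"

definition is_RC :: "nat \<Rightarrow> nat list \<Rightarrow> rc \<Rightarrow> bool" where
  "is_RC n mu0 M \<longleftrightarrow> (\<forall>l\<in>set mu0. 0 < l)
     \<and> (\<forall>a\<in>{1..n}. \<forall>x\<in>#M a. 1 \<le> fst x \<and> 0 \<le> snd x \<and> snd x \<le> vac n mu0 M a (fst x))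
     \<and> (\<forall>a. a \<notin> {1..n} \<longrightarrow> M a = {#})"

text \<open>Selection of singular rows in one elementary step: returns list of (i, chosen row).
  First argument is fuel (number of remaining levels).\<close>
fun choose_rows :: "nat \<Rightarrow> nat \<Rightarrow> nat list \<Rightarrow> rc \<Rightarrow> nat \<Rightarrow> nat \<Rightarrow> (nat \<times> (nat \<times> int)) list" where
  "choose_rows 0 n mu0 M i lp = []"
| "choose_rows (Suc f) n mu0 M i lp =
     (let S = {x \<in> set_mset (M i). lp \<le> fst x \<and> snd x = vac n mu0 M i (fst x)} in
      if S = {} then [] else
        (let l = Min (fst ` S) in (i, (l, vac n mu0 M i l)) # choose_rows f n mu0 M (i + 1) l))"

definition removed :: "rc \<Rightarrow> (nat \<times> (nat \<times> int)) list \<Rightarrow> rc" where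
  "removed M ch = (\<lambda>i. case map_of ch i of None \<Rightarrow> M i | Some x \<Rightarrow> M i - {#x#})"

definition shortened :: "(nat \<times> (nat \<times> int)) list \<Rightarrow> rc" where
  "shortened ch = (\<lambda>i. case map_of ch i of None \<Rightarrow> {#}
                        | Some x \<Rightarrow> if 1 < fst x then {#(fst x - 1, 0)#} else {#})"

definition kstep :: "nat \<Rightarrow> nat list \<Rightarrow> rc \<Rightarrow> nat \<times> nat list \<times> rc" where
  "kstep n mu0 M =
     (let l0 = last mu0;
          ch = choose_rows n n mu0 M 1 l0;
          mu0' = butlast mu0 @ (if l0 - 1 = 0 then [] else [l0 - 1]);
          Msh = (\<lambda>i. removed M ch i + shortened ch i);
          M' = (\<lambda>i. removed M ch i
                    + image_mset (\<lambda>x. (fst x, vac n mu0' Msh i (fst x))) (shortened ch i))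
      in (length ch + 1, mu0', M'))"

fun ksteps :: "nat \<Rightarrow> nat \<Rightarrow> nat list \<Rightarrow> rc \<Rightarrow> nat list \<times> nat list \<times> rc" where
  "ksteps 0 n mu0 M = ([], mu0, M)"
| "ksteps (Suc f) n mu0 M =
     (case kstep n mu0 M of (c, mu0', M') \<Rightarrow>
        (case ksteps f n mu0' M' of (cs, mu0'', M'') \<Rightarrow> (c # cs, mu0'', M'')))"

definition letter_counts :: "nat \<Rightarrow> nat list \<Rightarrow> nat list" where
  "letter_counts n cs = map (\<lambda>j. count (mset cs) j) [1..<n + 2]"

fun kkr_aux :: "nat \<Rightarrow> nat \<Rightarrow> nat list \<Rightarrow> rc \<Rightarrow> nat list list" where
  "kkr_aux 0 n mu0 M = []"
| "kkr_aux (Suc f) n mu0 M =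
     (case ksteps (last mu0) n mu0 M of (cs, mu0', M') \<Rightarrow>
        kkr_aux f n mu0' M' @ [letter_counts n cs])"

definition KKR :: "nat \<Rightarrow> nat list \<Rightarrow> rc \<Rightarrow> nat list list" where
  "KKR n mu0 M = kkr_aux (length mu0) n mu0 M"

definition mmin :: "nat multiset \<Rightarrow> nat multiset \<Rightarrow> int" where
  "mmin A B = int (\<Sum>x\<in>#A. \<Sum>y\<in>#B. min x y)"

definition tau_val :: "nat \<Rightarrow> nat multiset \<Rightarrow> rc \<Rightarrow> nat \<Rightarrow> int" where
  "tau_val n lam N d =
     mmin lam (image_mset fst (N 1))
     + (\<Sum>a\<in>{1..<n}. mmin (image_mset fst (N a)) (image_mset fst (N (a + 1))))
     - (\<Sum>a\<in>{1..n}. mmin (image_mset fst (N a)) (image_mset fst (N a)))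
     - (\<Sum>a\<in>{1..n}. \<Sum>x\<in>#N a. snd x)
     - (if d = n + 1 then 0 else int (\<Sum>x\<in>#N d. fst x))"

definition tau :: "nat \<Rightarrow> rc \<Rightarrow> nat \<Rightarrow> nat multiset \<Rightarrow> int" where
  "tau n M d lam = Max {tau_val n lam N d | N.
       (\<forall>a\<in>{1..n}. N a \<subseteq># M a) \<and> (\<forall>a. a \<notin> {1..n} \<longrightarrow> N a = {#})}"

definition tau_kd :: "nat \<Rightarrow> nat list \<Rightarrow> rc \<Rightarrow> nat \<Rightarrow> nat \<Rightarrow> int" where
  "tau_kd n mu0 M k d = tau n M d (mset (take k mu0))"

end

theory Submission
  imports Defs
begin

text \<open>Let \<open>h a l\<close> be the number of chosen rows of length at least \<open>l\<close> in level \<open>a\<close> (level 0 being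
  \<open>\<lambda>\<close>).  Completing squares, \<open>2 \<tau>\<^sub>d(\<lambda>)\<close> is a constant minus the minimal cost of a flow in a planar
  grid: \<open>h\<close>, suitably shifted according to \<open>d\<close>, is the height function of the flow, the columns have
  quadratic cost and the rows are arcs with cost their rigging.  Taking the maximum and minimum of two
  height functions, and swapping two flows along a path, gives the three-term relation
  \<open>\<tau>\<^sub>d(\<lambda>b) + \<tau>\<^sub>d\<^sub>-\<^sub>1(\<lambda>a) = max (\<tau>\<^sub>d\<^sub>-\<^sub>1(\<lambda>b) + \<tau>\<^sub>d(\<lambda>a)) (\<tau>\<^sub>d(\<lambda>ab) + \<tau>\<^sub>d\<^sub>-\<^sub>1(\<lambda>) - a)\<close> for \<open>a < b\<close>,
  where \<open>\<tau>\<^sub>0(\<lambda>) = \<tau>\<^sub>n\<^sub>+\<^sub>1(\<lambda>) - |\<lambda>|\<close>.  It follows that the second differences of \<open>\<tau>\<close> in \<open>d\<close> and in the rows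
  of \<open>\<mu>\<^sup>(\<^sup>0\<^sup>)\<close> transform under the combinatorial R by exchanging rows, with
  \<open>Q\<^sub>d = \<tau>\<^sub>d(\<lambda>ab) + \<tau>\<^sub>d(\<lambda>) - \<tau>\<^sub>d(\<lambda>a) - \<tau>\<^sub>d(\<lambda>b)\<close>; hence the energy telescopes, and adding \<open>\<mu>\<^sup>(\<^sup>1\<^sup>)\<close> to the first
  riggings realises \<open>T\<^sub>\<infinity>\<close>, so that \<open>\<rho>\<close> telescopes as well.  Finally, one step of the KKR map leaves
  \<open>\<tau>\<^sub>d(\<lambda>)\<close> unchanged for every \<open>\<lambda>\<close> contained in the remaining rows (an exchange argument carried out level by
  level), and for the full \<open>\<mu>\<^sup>(\<^sup>0\<^sup>)\<close> the maximum is attained by choosing all rows; so the letters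
  produced are the second differences of \<open>\<tau>\<close>.\<close>

section \<open>Convexity and conformal path decomposition\<close>

text \<open>Column by column, twice the quantity maximised by \<open>tau\<close> is, up to sign and
  a constant, a sum of convex functions of differences of neighbouring heights. Two of the three
  inequalities behind the three-term relation are therefore submodularity, once plain and once with
  one height function raised by 1. The third goes against submodularity and depends on planarity:
  the difference of two height functions is an integral flow, and a path split off from it at a
  given source can end only in two kinds of places, which account for the two terms of the maximum.
  Iterating the relation over a full period of \<open>d\<close> produces the minimum in
  \<open>Q\<close>. The evolution keeps raising riggings while \<open>mu0\<close> stays fixed, so
  the riggings outgrow the vacancy numbers. Hence there are three levels of generality:
  \<open>wf_cfg\<close> (positive lengths) for the combinatorial R, \<open>pos_cfg\<close> (also
  nonnegative riggings) for the box-ball and energy formulas, and \<open>is_RC\<close> for the KKR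
  map. The formulas for rho and the energy concern the sequence of second differences
  \<open>tau_path\<close>; rigged configurations proper enter only in showing that the KKR map
  outputs this sequence.\<close>

definition between :: "int \<Rightarrow> int \<Rightarrow> int \<Rightarrow> bool" where
  "between r p q \<longleftrightarrow> min p q \<le> r \<and> r \<le> max p q"

text \<open>Restricted to \<open>[0, u]\<close> because \<open>rig_cost\<close> becomes constant
  beyond the number of available rows, where convexity may fail.\<close>

definition convex_upto :: "(int \<Rightarrow> int) \<Rightarrow> int \<Rightarrow> bool" where
  "convex_upto f u \<longleftrightarrow> (\<forall>p q r s. 0 \<le> p \<and> p \<le> r \<and> r \<le> q \<and> q \<le> u \<and> r + s = p + q
                 \<longrightarrow> f r + f s \<le> f p + f q)"

lemma convexI:
  assumes "\<And>k. 0 \<le> k \<Longrightarrow> k + 2 \<le> u \<Longrightarrow> 2 * f (k + 1) \<le> f k + f (k + 2)"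
  shows "convex_upto f u"
proof -
  have mono: "f (i + 1) - f i \<le> f (i + 1 + int m) - f (i + int m)" if "0 \<le> i" "i + int m + 1 \<le> u" for i m
    using that
  proof (induction m)
    case (Suc m)
    have "2 * f (i + int m + 1) \<le> f (i + int m) + f (i + int m + 2)"
      using assms[of "i + int m"] Suc.prems by simp
    then show ?case using Suc by (simp add: algebra_simps)
  qed simp
  have main: "f (p + int t) + f (q - int t) \<le> f p + f q" if "0 \<le> p" "p + 2 * int t \<le> q" "q \<le> u" for p q t
    using that
  proof (induction t)
    case (Suc t)
    have "f (p + int t + 1) - f (p + int t)
        \<le> f (p + int t + 1 + int (nat (q - p - 2 * int t - 1))) - f (p + int t + int (nat (q - p - 2 * int t - 1)))"
      using Suc.prems by (intro mono) auto
    then have "f (p + int t + 1) - f (p + int t) \<le> f (q - int t) - f (q - int t - 1)"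
      using Suc.prems by (simp add: algebra_simps)
    then show ?case using Suc by (simp add: algebra_simps)
  qed simp
  show ?thesis unfolding convex_upto_def
  proof (intro allI impI, elim conjE)
    fix p q r s :: int
    assume a: "0 \<le> p" "p \<le> r" "r \<le> q" "q \<le> u" "r + s = p + q"
    show "f r + f s \<le> f p + f q"
    proof (cases "2 * r \<le> p + q")
      case True
      have "f (p + int (nat (r - p))) + f (q - int (nat (r - p))) \<le> f p + f q"
        using a True by (intro main) auto
      moreover have "q - (r - p) = s" using a by simp
      ultimately show ?thesis using a by simp
    next
      case False
      have "f (p + int (nat (q - r))) + f (q - int (nat (q - r))) \<le> f p + f q"
        using a False by (intro main) auto
      moreover have "p + (q - r) = s" using a by simp
      ultimately show ?thesis using a by simp
    qed
  qed
qed

lemma convex_upto_between: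
  assumes "convex_upto f u" "0 \<le> p" "p \<le> u" "0 \<le> q" "q \<le> u" "between r p q" "r + s = p + q"
  shows "f r + f s \<le> f p + f q"
proof (cases "p \<le> q")
  case True
  then show ?thesis using assms unfolding convex_upto_def between_def by (auto simp: min_def max_def)
next
  case False
  then have "f r + f s \<le> f q + f p" using assms unfolding convex_upto_def between_def
    by (auto simp: min_def max_def)
  then show ?thesis by simp
qed

lemma square_between:
  fixes p q r s :: int
  assumes "between r p q" "r + s = p + q"
  shows "r ^ 2 + s ^ 2 \<le> p ^ 2 + q ^ 2"
proof -
  have s: "s = p + q - r" using assms by simp
  have "(r - p) * (q - r) \<ge> 0"
    using assms(1) unfolding between_def by (cases "p \<le> q") (auto intro: mult_nonneg_nonneg mult_nonpos_nonpos)
  then show ?thesis unfolding s by (simp add: power2_eq_square algebra_simps)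
qed

lemma between_max: "between (max x1 y1 - max x2 y2) (x1 - x2) (y1 - y2)"
  unfolding between_def by (simp add: max_def min_def)

definition feasible :: "nat \<Rightarrow> nat \<Rightarrow> (nat \<Rightarrow> nat \<Rightarrow> int) \<Rightarrow> (nat \<Rightarrow> nat \<Rightarrow> int) \<Rightarrow> bool" where
  "feasible n K u x \<longleftrightarrow> (\<forall>a\<in>{1..n}. \<forall>l\<in>{1..K}. 0 \<le> x a l - x a (l + 1) \<and> x a l - x a (l + 1) \<le> u a l)"

text \<open>Represents twice the negated value of \<open>tau\<close> up to a constant, which keeps
  the squares integral. A horizontal difference is the flow between two levels, a vertical one the
  number of rows of length exactly \<open>l\<close> chosen in level \<open>a\<close>.\<close>

definition cost :: "nat \<Rightarrow> nat \<Rightarrow> (nat \<Rightarrow> nat \<Rightarrow> int \<Rightarrow> int) \<Rightarrow> (nat \<Rightarrow> nat \<Rightarrow> int) \<Rightarrow> int" where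
  "cost n K \<phi> x = (\<Sum>l\<in>{1..K}. \<Sum>a\<in>{0..n}. (x a l - x (a + 1) l) ^ 2)
                + 2 * (\<Sum>a\<in>{1..n}. \<Sum>l\<in>{1..K}. \<phi> a l (x a l - x a (l + 1)))"

text \<open>Every term of \<open>cost\<close> is a convex function of one height difference. If each
  difference of \<open>X\<close> lies between those of \<open>x\<close> and \<open>y\<close>, and
  \<open>Y\<close> is the complement, then no term can grow.\<close>

lemma exchange:
  assumes cv: "\<And>a l. a \<in> {1..n} \<Longrightarrow> l \<in> {1..K} \<Longrightarrow> convex_upto (\<phi> a l) (u a l)"
    and x: "feasible n K u x" and y: "feasible n K u y"
    and XY: "\<And>a l. X a l + Y a l = x a l + y a l"
    and h: "\<And>a l. a \<in> {0..n} \<Longrightarrow> l \<in> {1..K} \<Longrightarrow>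
              between (X a l - X (a + 1) l) (x a l - x (a + 1) l) (y a l - y (a + 1) l)"
    and v: "\<And>a l. a \<in> {1..n} \<Longrightarrow> l \<in> {1..K} \<Longrightarrow>
              between (X a l - X a (l + 1)) (x a l - x a (l + 1)) (y a l - y a (l + 1))"
  shows "feasible n K u X" "feasible n K u Y" "cost n K \<phi> X + cost n K \<phi> Y \<le> cost n K \<phi> x + cost n K \<phi> y"
proof -
  have Y: "Y a l = x a l + y a l - X a l" for a l using XY[of a l] by simp
  show "feasible n K u X" unfolding feasible_def
  proof (intro ballI)
    fix a l assume "a \<in> {1..n}" "l \<in> {1..K}"
    then show "0 \<le> X a l - X a (l + 1) \<and> X a l - X a (l + 1) \<le> u a l"
      using x y v[of a l] unfolding feasible_def between_def by (smt (verit))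
  qed
  show "feasible n K u Y" unfolding feasible_def
  proof (intro ballI)
    fix a l assume "a \<in> {1..n}" "l \<in> {1..K}"
    then show "0 \<le> Y a l - Y a (l + 1) \<and> Y a l - Y a (l + 1) \<le> u a l"
      using x y v[of a l] unfolding feasible_def between_def Y by (smt (verit))
  qed
  have 1: "(\<Sum>l\<in>{1..K}. \<Sum>a\<in>{0..n}. (X a l - X (a + 1) l) ^ 2 + (Y a l - Y (a + 1) l) ^ 2)
        \<le> (\<Sum>l\<in>{1..K}. \<Sum>a\<in>{0..n}. (x a l - x (a + 1) l) ^ 2 + (y a l - y (a + 1) l) ^ 2)"
    by (intro sum_mono square_between h) (auto simp: Y)
  have 2: "(\<Sum>a\<in>{1..n}. \<Sum>l\<in>{1..K}. \<phi> a l (X a l - X a (l + 1)) + \<phi> a l (Y a l - Y a (l + 1)))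
       \<le> (\<Sum>a\<in>{1..n}. \<Sum>l\<in>{1..K}. \<phi> a l (x a l - x a (l + 1)) + \<phi> a l (y a l - y a (l + 1)))"
    using x y by (intro sum_mono convex_upto_between[OF cv _ _ _ _ v]) (auto simp: Y feasible_def)
  show "cost n K \<phi> X + cost n K \<phi> Y \<le> cost n K \<phi> x + cost n K \<phi> y"
    using 1 2 unfolding cost_def by (simp add: sum.distrib)
qed

section \<open>Unit flows inside an integral flow on a planar grid\<close>

definition excess :: "'e set \<Rightarrow> ('e \<Rightarrow> 'v) \<Rightarrow> ('e \<Rightarrow> 'v) \<Rightarrow> ('e \<Rightarrow> int) \<Rightarrow> 'v \<Rightarrow> int" where
  "excess E src tgt w v = (\<Sum>e\<in>E. w e * (of_bool (tgt e = v) - of_bool (src e = v)))"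

lemma excess_upd:
  assumes "finite E" "e \<in> E"
  shows "excess E src tgt (w(e := w e + k)) v
       = excess E src tgt w v + k * (of_bool (tgt e = v) - of_bool (src e = v))"
proof -
  have "excess E src tgt (w(e := w e + k)) v
      = (\<Sum>e'\<in>E. w e' * (of_bool (tgt e' = v) - of_bool (src e' = v))
           + (if e' = e then k * (of_bool (tgt e = v) - of_bool (src e = v)) else 0))"
    unfolding excess_def by (intro sum.cong) (auto simp: algebra_simps)
  then show ?thesis using assms unfolding excess_def by (simp add: sum.distrib)
qed

text \<open>Walk from \<open>s\<close> in the direction of the flow, removing one unit of
  \<open>w\<close> at each step. The total flow decreases, and the walk ends at the first node of
  positive excess. As the units come out of what is left of \<open>w\<close>, the walk stays between
  0 and \<open>w\<close> even where it repeats an edge.\<close>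

lemma conformal_path:
  assumes "finite E" "excess E src tgt w s < 0"
  shows "\<exists>t f. excess E src tgt w t > 0 \<and> (\<forall>e\<in>E. between (f e) 0 (w e))
           \<and> (\<forall>v. excess E src tgt f v = of_bool (v = t) - of_bool (v = s))"
  using assms(2)
proof (induction "nat (\<Sum>e\<in>E. \<bar>w e\<bar>)" arbitrary: w s rule: less_induct)
  case less
  let ?x = "excess E src tgt"
  obtain e where e: "e \<in> E" "w e * (of_bool (tgt e = s) - of_bool (src e = s)) < 0"
  proof -
    have "\<not> (\<forall>e\<in>E. w e * (of_bool (tgt e = s) - of_bool (src e = s)) \<ge> 0)"
      using less.prems sum_nonneg[of E "\<lambda>e. w e * (of_bool (tgt e = s) - of_bool (src e = s))"]
      unfolding excess_def by force
    then show ?thesis using that by force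
  qed
  define \<sigma> where "\<sigma> = sgn (w e)"
  define v where "v = (if w e > 0 then tgt e else src e)"
  define w' where "w' = w(e := w e + (- \<sigma>))"
  have vs: "v \<noteq> s" and sv: "\<sigma> * (of_bool (tgt e = v') - of_bool (src e = v')) = of_bool (v' = v) - of_bool (v' = s)" for v'
    using e(2) unfolding v_def \<sigma>_def
    by (cases "tgt e = s"; cases "src e = s"; cases "w e > 0"; force simp: sgn_if)+
  have xw': "?x w' v' = ?x w v' - of_bool (v' = v) + of_bool (v' = s)" for v'
    unfolding w'_def excess_upd[OF assms(1) e(1)] using sv[of v'] by simp
  have we: "w e \<noteq> 0" using e(2) by auto
  show ?case
  proof (cases "?x w v > 0")
    case True
    define f where "f = (\<lambda>_. 0)(e := 0 + \<sigma>)"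
    have "?x f v' = of_bool (v' = v) - of_bool (v' = s)" for v'
      unfolding f_def using excess_upd[OF assms(1) e(1), of src tgt "\<lambda>_. 0" \<sigma> v'] sv[of v']
      by (simp add: excess_def)
    moreover have "\<forall>e\<in>E. between (f e) 0 (w e)"
      using we by (auto simp: f_def between_def \<sigma>_def sgn_if)
    ultimately show ?thesis using True by blast
  next
    case False
    have lt: "\<bar>w' e\<bar> < \<bar>w e\<bar>" using we by (auto simp: w'_def \<sigma>_def sgn_if)
    have "(\<Sum>e\<in>E. \<bar>w' e\<bar>) < (\<Sum>e\<in>E. \<bar>w e\<bar>)"
      using assms(1) e(1) lt by (intro sum_strict_mono_ex1) (auto simp: w'_def)
    moreover have "(\<Sum>e\<in>E. \<bar>w' e\<bar>) \<ge> 0" by (simp add: sum_nonneg)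
    ultimately have "nat (\<Sum>e\<in>E. \<bar>w' e\<bar>) < nat (\<Sum>e\<in>E. \<bar>w e\<bar>)" by linarith
    moreover have "?x w' v < 0" using False vs by (simp add: xw')
    ultimately obtain t f where f: "?x w' t > 0" "\<forall>e\<in>E. between (f e) 0 (w' e)"
      "\<And>v'. ?x f v' = of_bool (v' = t) - of_bool (v' = v)"
      using less.hyps by blast
    have tau_hgt_val: "t \<noteq> v" using f(1) \<open>?x w' v < 0\<close> by auto
    \<comment> \<open>Removing the first unit raises the excess at \<open>s\<close> by exactly 1, so
      it is still not positive.\<close>
    have ts: "t \<noteq> s" using f(1) less.prems vs xw'[of s] by auto
    define f' where "f' = f(e := f e + \<sigma>)"
    have "?x f' v' = of_bool (v' = t) - of_bool (v' = s)" for v'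
      unfolding f'_def excess_upd[OF assms(1) e(1)] sv f(3) by simp
    moreover have "\<forall>e\<in>E. between (f' e) 0 (w e)"
      using f(2) we e(1) by (auto simp: f'_def w'_def between_def \<sigma>_def sgn_if split: if_splits)
    moreover have "?x w t > 0" using f(1) tau_hgt_val ts xw'[of t] by simp
    ultimately show ?thesis by blast
  qed
qed

text \<open>\<open>Inl (a, l)\<close> separates the faces \<open>(a, l)\<close> and
  \<open>(a, l + 1)\<close> and carries the rows of length \<open>l\<close> in level
  \<open>a\<close>; \<open>Inr (a, l)\<close> separates the faces \<open>(a, l)\<close> and
  \<open>(a + 1, l)\<close> and carries the quadratic cost. The nodes with second coordinate 0 form
  the bottom, where flow may leave.\<close>

type_synonym edge = "(nat \<times> nat) + (nat \<times> nat)"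

definition esrc :: "edge \<Rightarrow> nat \<times> nat" where
  "esrc e = (case e of Inl (a, l) \<Rightarrow> (a - 1, l) | Inr (a, l) \<Rightarrow> (a, l))"

definition etgt :: "edge \<Rightarrow> nat \<times> nat" where
  "etgt e = (case e of Inl (a, l) \<Rightarrow> (a, l) | Inr (a, l) \<Rightarrow> (a, l - 1))"

definition edges :: "nat \<Rightarrow> nat \<Rightarrow> edge set" where
  "edges n K = Inl ` ({1..n} \<times> {1..K}) \<union> Inr ` ({0..n} \<times> {1..K})"

lemma finite_edges [simp]: "finite (edges n K)" by (simp add: edges_def)

lemma sum_point:
  fixes f :: "nat \<times> nat \<Rightarrow> int"
  assumes "finite S"
  shows "(\<Sum>p\<in>S. f p * of_bool (p = q)) = (if q \<in> S then f q else 0)"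
  using assms by (simp add: of_bool_def if_distrib sum.delta cong: if_cong)

lemma excess_edges:
  assumes "l \<ge> 1"
  shows "excess (edges n K) esrc etgt w (a, l)
     = (if a \<in> {1..n} \<and> l \<le> K then w (Inl (a, l)) else 0)
     + (if a \<le> n \<and> l < K then w (Inr (a, l + 1)) else 0)
     - (if a < n \<and> l \<le> K then w (Inl (a + 1, l)) else 0)
     - (if a \<le> n \<and> l \<le> K then w (Inr (a, l)) else 0)"
proof -
  have s: "(\<Sum>e\<in>edges n K. g e) = (\<Sum>p\<in>{1..n} \<times> {1..K}. g (Inl p)) + (\<Sum>p\<in>{0..n} \<times> {1..K}. g (Inr p))"
    for g :: "edge \<Rightarrow> int"
    unfolding edges_def by (subst sum.union_disjoint) (auto simp: sum.reindex)
  have "excess (edges n K) esrc etgt w (a, l)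
     = (\<Sum>p\<in>{1..n} \<times> {1..K}. w (Inl p) * of_bool (p = (a, l)) - w (Inl p) * of_bool (p = (a + 1, l)))
     + (\<Sum>p\<in>{0..n} \<times> {1..K}. w (Inr p) * of_bool (p = (a, l + 1)) - w (Inr p) * of_bool (p = (a, l)))"
    unfolding excess_def s
    by (intro arg_cong2[where f="(+)"] sum.cong) (auto simp: esrc_def etgt_def algebra_simps)
  then show ?thesis using assms by (auto simp: sum_subtractf sum_point)
qed

text \<open>Nodes of the planar network are the pairs \<open>(a, l)\<close>, its faces carry the height function \<open>z\<close>;
  the flow through an edge is the difference of the heights on its two sides.  A unit of flow
  entering at \<open>(0, a)\<close> is followed until it leaves, either at \<open>(0, b)\<close> or at the bottom.\<close>

lemma grid_cut:
  fixes z :: "nat \<Rightarrow> nat \<Rightarrow> int"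
  assumes ab: "1 \<le> a" "a < b" "b < K" and d: "1 \<le> d" "d \<le> n + 1"
    and z0: "\<And>l. l \<in> {1..K+1} \<Longrightarrow> z 0 l = of_bool (a < l \<and> l \<le> b)"
    and zn: "\<And>l. l \<in> {1..K+1} \<Longrightarrow> z (n + 1) l = 1"
    and zt: "\<And>c. c \<in> {0..n+1} \<Longrightarrow> z c (K + 1) = of_bool (d \<le> c)"
  shows "\<exists>g. (\<forall>c. g c (K + 1) = 0) \<and> (\<forall>l. g (n + 1) l = 0)
     \<and> ((\<forall>l\<in>{1..K}. g 0 l = of_bool (a < l \<and> l \<le> b)) \<or> (\<forall>l\<in>{1..K}. g 0 l = - of_bool (l \<le> a)))
     \<and> (\<forall>c\<in>{0..n}. \<forall>l\<in>{1..K}. between (g c l - g (c + 1) l) 0 (z c l - z (c + 1) l))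
     \<and> (\<forall>c\<in>{1..n}. \<forall>l\<in>{1..K}. between (g c l - g c (l + 1)) 0 (z c l - z c (l + 1)))"
proof -
  define w where "w = (\<lambda>e::edge. case e of Inl (c, l) \<Rightarrow> z c (l + 1) - z c l
                                       | Inr (c, l) \<Rightarrow> z (c + 1) l - z c l)"
  let ?x = "excess (edges n K) esrc etgt"
  \<comment> \<open>Above the bottom there are two sources, \<open>(0, a)\<close> and
    \<open>(d - 1, K)\<close>, and the single sink \<open>(0, b)\<close>. The hypothesis
    \<open>b < K\<close> separates this sink from the second source when
    \<open>d = 1\<close>.\<close>
  have xw: "?x w (c, l) = of_bool (c = 0 \<and> l = b) - of_bool (c = 0 \<and> l = a)
               - of_bool (c = d - 1 \<and> l = K)" if "l \<ge> 1" for c l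
  proof (cases "c \<le> n \<and> l \<le> K")
    case True
    have 1: "z 0 l = of_bool (a < l \<and> l \<le> b)" "z 0 (l + 1) = of_bool (a < l + 1 \<and> l + 1 \<le> b)"
      using z0[of l] z0[of "l + 1"] that True by auto
    have 2: "z (n + 1) l = 1" "z (n + 1) (l + 1) = 1" using zn[of l] zn[of "l+1"] that True by auto
    have 3: "z c (K + 1) = of_bool (d \<le> c)" "z (c + 1) (K + 1) = of_bool (d \<le> c + 1)"
      using zt[of c] zt[of "c + 1"] True by auto
    show ?thesis unfolding excess_edges[OF that]
      using True ab d 1 2 3
      by (cases "c = 0"; cases "c = n"; cases "l = K") (auto simp: w_def of_bool_def split: if_splits)
  next
    case False
    then show ?thesis unfolding excess_edges[OF that] using ab d by auto
  qed
  have "?x w (0, a) < 0" using xw[of a 0] ab by auto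
  from conformal_path[OF finite_edges this] obtain t f
    where t: "?x w t > 0" and f: "\<And>e. e \<in> edges n K \<Longrightarrow> between (f e) 0 (w e)"
      and xf: "\<And>v. ?x f v = of_bool (v = t) - of_bool (v = (0, a))" by blast
  have tt: "t = (0, b) \<or> snd t = 0"
  proof (cases t)
    case (Pair c l)
    then show ?thesis using t xw[of l c] by (cases "l = 0") (auto simp: of_bool_def split: if_splits)
  qed
  \<comment> \<open>Heights of the path flow along the left border: a path to \<open>(0, b)\<close>
    separates the faces \<open>a < l \<le> b\<close> from the rest, a path to the bottom separates
    those with \<open>l \<le> a\<close>. Inside, \<open>g\<close> is obtained by summing from the
    top, where it vanishes.\<close>
  define G0 :: "nat \<Rightarrow> int" where
    "G0 l = (if t = (0, b) then of_bool (a < l \<and> l \<le> b) else - of_bool (l \<le> a))" for l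
  define g where "g c l = (if c = 0 then (if l \<le> K then G0 l else 0) else if c \<le> n then (\<Sum>l'\<in>{l..K}. - f (Inl (c, l'))) else 0)" for c l
  have gh: "g c l - g c (l + 1) = - f (Inl (c, l))" if "c \<in> {1..n}" "l \<in> {1..K}" for c l
    using that by (auto simp: g_def sum.atLeast_Suc_atMost)
  have G0: "G0 l - (if l < K then G0 (l + 1) else 0) = ?x f (0, l)" if "l \<in> {1..K}" for l
    using that tt ab unfolding xf G0_def by (auto simp: of_bool_def)
  have xf0: "?x f (c, l) = 0" if "c \<ge> 1" "l \<ge> 1" for c l
    using that tt unfolding xf by auto
  \<comment> \<open>\<open>g\<close> was defined from the \<open>Inl\<close> edges alone; that it
    also matches the \<open>Inr\<close> edges is flow conservation at \<open>(c, l)\<close>,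
    propagated downwards from \<open>l = K\<close>.\<close>
  have gv: "g c l - g (c + 1) l = - f (Inr (c, l))" if "c \<le> n" "l \<ge> 1" "l \<le> K" for c l
    using that(3,2)
  proof (induction l rule: inc_induct)
    case base
    show ?case
    proof (cases "c = 0")
      case True
      then show ?thesis using G0[of K] base ab that(1) excess_edges[of K n K f 0]
        by (auto simp: g_def)
    next
      case False
      then show ?thesis using xf0[of c K] base that(1) excess_edges[of K n K f c] by (auto simp: g_def)
    qed
  next
    case (step l)
    have IH: "g c (l + 1) - g (c + 1) (l + 1) = - f (Inr (c, l + 1))" using step by simp
    have s1: "c + 1 \<le> n \<Longrightarrow> g (c + 1) l - g (c + 1) (l + 1) = - f (Inl (c + 1, l))"
      using gh[of "c + 1" l] step by auto
    have s1': "c = n \<Longrightarrow> g (c + 1) l = 0" "c = n \<Longrightarrow> g (c + 1) (l + 1) = 0" by (auto simp: g_def)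
    show ?case
    proof (cases "c = 0")
      case True
      have "g 0 l - g 0 (l + 1) = ?x f (0, l)" using G0[of l] step by (simp add: g_def)
      then show ?thesis using True IH s1 s1' excess_edges[of l n K f 0] step that(1)
        by (cases "n = 0") auto
    next
      case False
      then show ?thesis using IH s1 s1' gh[of c l] xf0[of c l] excess_edges[of l n K f c] step that(1)
        by (cases "c = n") auto
    qed
  qed
  have nb: "between (- x) 0 y" if "between x 0 (- y)" for x y using that by (auto simp: between_def)
  show ?thesis
  proof (intro exI[of _ g] conjI ballI allI)
    fix c show "g c (K + 1) = 0" by (simp add: g_def)
  next
    fix l show "g (n + 1) l = 0" by (simp add: g_def)
  next
    show "(\<forall>l\<in>{1..K}. g 0 l = of_bool (a < l \<and> l \<le> b)) \<or> (\<forall>l\<in>{1..K}. g 0 l = - of_bool (l \<le> a))"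
      by (auto simp: g_def G0_def)
  next
    fix c l assume cl: "c \<in> {0..n}" "l \<in> {1..K}"
    have "between (f (Inr (c, l))) 0 (w (Inr (c, l)))" using cl by (intro f) (auto simp: edges_def)
    then show "between (g c l - g (c + 1) l) 0 (z c l - z (c + 1) l)"
      using gv[of c l] cl by (auto intro!: nb simp: w_def)
  next
    fix c l assume cl: "c \<in> {1..n}" "l \<in> {1..K}"
    have "between (f (Inl (c, l))) 0 (w (Inl (c, l)))" using cl by (intro f) (auto simp: edges_def)
    then show "between (g c l - g c (l + 1)) 0 (z c l - z c (l + 1))"
      unfolding gh[OF cl] by (auto intro!: nb simp: w_def)
  qed
qed

section \<open>Exchange of height functions\<close>

text \<open>The truncated difference \<open>a - d\<close> encodes \<open>d\<close>: subtracting it from the number of chosen rows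
  absorbs the linear term \<open>- |\<nu>\<^sup>(\<^sup>d\<^sup>)|\<close> of \<open>tau_val\<close> into the squares of \<open>cost\<close>.\<close>

definition boundary :: "nat \<Rightarrow> nat \<Rightarrow> nat \<Rightarrow> (nat \<Rightarrow> int) \<Rightarrow> (nat \<Rightarrow> nat \<Rightarrow> int) \<Rightarrow> bool" where
  "boundary n K d lam x \<longleftrightarrow> (\<forall>l\<in>{1..K+1}. x 0 l = lam l \<and> x (n + 1) l = - int (n + 1 - d))
     \<and> (\<forall>a\<in>{0..n+1}. x a (K + 1) = - int (a - d))"

definition ind :: "nat \<Rightarrow> nat \<Rightarrow> int" where
  "ind a l = of_bool (l \<le> a)"

context
  fixes n K :: nat and u :: "nat \<Rightarrow> nat \<Rightarrow> int" and \<phi> :: "nat \<Rightarrow> nat \<Rightarrow> int \<Rightarrow> int"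
  assumes cv: "\<And>a l. a \<in> {1..n} \<Longrightarrow> l \<in> {1..K} \<Longrightarrow> convex_upto (\<phi> a l) (u a l)"
begin

text \<open>\<open>x\<close> has the larger left border, and \<open>y\<close> the larger right and
  top borders since its index is \<open>d\<close> rather than \<open>d - 1\<close>. So the maximum
  combines the left border of \<open>x\<close> with the other borders of \<open>y\<close>, and the
  minimum does the opposite.\<close>

lemma cost_meet_join:
  assumes d: "1 \<le> d" "d \<le> n + 1" and ab: "a \<le> b"
    and x: "feasible n K u x" "boundary n K (d - 1) (\<lambda>l. lam l + ind b l) x"
    and y: "feasible n K u y" "boundary n K d (\<lambda>l. lam l + ind a l) y"
  shows "\<exists>X Y. feasible n K u X \<and> boundary n K d (\<lambda>l. lam l + ind b l) X
           \<and> feasible n K u Y \<and> boundary n K (d - 1) (\<lambda>l. lam l + ind a l) Y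
           \<and> cost n K \<phi> X + cost n K \<phi> Y \<le> cost n K \<phi> x + cost n K \<phi> y"
proof -
  define X where "X = (\<lambda>a l. max (x a l) (y a l))"
  define Y where "Y = (\<lambda>a l. min (x a l) (y a l))"
  note ex = exchange[OF cv x(1) y(1), where X = X and Y = Y]
  have "X a l + Y a l = x a l + y a l" for a l by (simp add: X_def Y_def)
  moreover have "between (X a l - X a' l') (x a l - x a' l') (y a l - y a' l')" for a l a' l'
    unfolding X_def by (rule between_max)
  moreover have "boundary n K d (\<lambda>l. lam l + ind b l) X"
    using x(2) y(2) ab d by (auto simp: boundary_def X_def ind_def of_bool_def max_def)
  moreover have "boundary n K (d - 1) (\<lambda>l. lam l + ind a l) Y"
    using x(2) y(2) ab d by (auto simp: boundary_def Y_def ind_def of_bool_def min_def)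
  ultimately show ?thesis using ex by blast
qed

text \<open>Raising \<open>y\<close> by 1 makes its right border agree with that of
  \<open>x\<close>. On the left the minimum of \<open>ind a + ind b\<close> and 1 is
  \<open>ind b\<close> because \<open>a \<le> b\<close>, and the maximum minus 1 is
  \<open>ind a\<close>.\<close>

lemma cost_shifted_meet_join:
  assumes d: "1 \<le> d" "d \<le> n + 1" and ab: "a \<le> b" "b \<le> K"
    and x: "feasible n K u x" "boundary n K d (\<lambda>l. lam l + ind a l + ind b l) x"
    and y: "feasible n K u y" "boundary n K (d - 1) lam y"
  shows "\<exists>X Y. feasible n K u X \<and> boundary n K d (\<lambda>l. lam l + ind b l) X
           \<and> feasible n K u Y \<and> boundary n K (d - 1) (\<lambda>l. lam l + ind a l) Y
           \<and> cost n K \<phi> X + cost n K \<phi> Y \<le> cost n K \<phi> x + cost n K \<phi> y"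
proof -
  define X where "X = (\<lambda>a l. min (x a l) (y a l + 1))"
  define Y where "Y = (\<lambda>a l. max (x a l) (y a l + 1) - 1)"
  note ex = exchange[OF cv x(1) y(1), where X = Y and Y = X]
  have "Y a l + X a l = x a l + y a l" for a l by (simp add: X_def Y_def)
  moreover have "between (Y a l - Y a' l') (x a l - x a' l') (y a l - y a' l')" for a l a' l'
    using between_max[of "x a l" "y a l + 1" "x a' l'" "y a' l' + 1"] unfolding Y_def by simp
  moreover have "boundary n K d (\<lambda>l. lam l + ind b l) X"
    using x(2) y(2) ab d by (auto simp: boundary_def X_def ind_def of_bool_def min_def)
  moreover have "boundary n K (d - 1) (\<lambda>l. lam l + ind a l) Y"
    using x(2) y(2) ab d by (auto simp: boundary_def Y_def ind_def of_bool_def max_def)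
  ultimately show ?thesis using ex by (metis add.commute)
qed

text \<open>The path found by \<open>grid_cut\<close> in the flow of \<open>x - y\<close> is moved
  from \<open>x\<close> to \<open>y\<close>. Its end point decides the alternative: at
  \<open>(0, b)\<close> the two left borders are interchanged, at the bottom the row
  \<open>a\<close> passes to \<open>X\<close>.\<close>

lemma cost_path_swap:
  assumes d: "1 \<le> d" "d \<le> n + 1" and ab: "1 \<le> a" "a < b" "b < K"
    and x: "feasible n K u x" "boundary n K d (\<lambda>l. lam l + ind b l) x"
    and y: "feasible n K u y" "boundary n K (d - 1) (\<lambda>l. lam l + ind a l) y"
  shows "\<exists>X Y. feasible n K u X \<and> feasible n K u Y
     \<and> (boundary n K d (\<lambda>l. lam l + ind a l) X \<and> boundary n K (d - 1) (\<lambda>l. lam l + ind b l) Y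
        \<or> boundary n K d (\<lambda>l. lam l + ind a l + ind b l) X \<and> boundary n K (d - 1) lam Y)
     \<and> cost n K \<phi> X + cost n K \<phi> Y \<le> cost n K \<phi> x + cost n K \<phi> y"
proof -
  define z where "z = (\<lambda>a l. x a l - y a l)"
  have "\<exists>g. (\<forall>c. g c (K + 1) = 0) \<and> (\<forall>l. g (n + 1) l = 0)
     \<and> ((\<forall>l\<in>{1..K}. g 0 l = of_bool (a < l \<and> l \<le> b)) \<or> (\<forall>l\<in>{1..K}. g 0 l = - of_bool (l \<le> a)))
     \<and> (\<forall>c\<in>{0..n}. \<forall>l\<in>{1..K}. between (g c l - g (c + 1) l) 0 (z c l - z (c + 1) l))
     \<and> (\<forall>c\<in>{1..n}. \<forall>l\<in>{1..K}. between (g c l - g c (l + 1)) 0 (z c l - z c (l + 1)))"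
  proof (rule grid_cut[OF ab d])
    show "z 0 l = of_bool (a < l \<and> l \<le> b)" if "l \<in> {1..K+1}" for l
      using x(2) y(2) ab that unfolding boundary_def z_def by (auto simp: ind_def)
    show "z (n + 1) l = 1" if "l \<in> {1..K+1}" for l
      using x(2) y(2) d that unfolding boundary_def z_def by auto
    show "z c (K + 1) = of_bool (d \<le> c)" if "c \<in> {0..n+1}" for c
      using x(2) y(2) d that unfolding boundary_def z_def by (auto simp: of_bool_def)
  qed
  then obtain g where g: "\<And>c. g c (K + 1) = 0" "\<And>l. g (n + 1) l = 0"
      "(\<forall>l\<in>{1..K}. g 0 l = of_bool (a < l \<and> l \<le> b)) \<or> (\<forall>l\<in>{1..K}. g 0 l = - of_bool (l \<le> a))"
    and gh: "\<And>c l. c \<in> {0..n} \<Longrightarrow> l \<in> {1..K} \<Longrightarrow> between (g c l - g (c + 1) l) 0 (z c l - z (c + 1) l)"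
    and gv: "\<And>c l. c \<in> {1..n} \<Longrightarrow> l \<in> {1..K} \<Longrightarrow> between (g c l - g c (l + 1)) 0 (z c l - z c (l + 1))"
    by blast
  define X where "X = (\<lambda>a l. x a l - g a l)"
  define Y where "Y = (\<lambda>a l. y a l + g a l)"
  have XY: "X a l + Y a l = x a l + y a l" for a l by (simp add: X_def Y_def)
  have h: "between (X c l - X (c + 1) l) (x c l - x (c + 1) l) (y c l - y (c + 1) l)"
    if "c \<in> {0..n}" "l \<in> {1..K}" for c l
    using gh[OF that] unfolding between_def X_def z_def by auto
  have v: "between (X c l - X c (l + 1)) (x c l - x c (l + 1)) (y c l - y c (l + 1))"
    if "c \<in> {1..n}" "l \<in> {1..K}" for c l
    using gv[OF that] unfolding between_def X_def z_def by auto
  have K1: "{1..K+1} = insert (K + 1) {1..K}" by auto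
  have "boundary n K d (\<lambda>l. lam l + ind a l) X \<and> boundary n K (d - 1) (\<lambda>l. lam l + ind b l) Y
        \<or> boundary n K d (\<lambda>l. lam l + ind a l + ind b l) X \<and> boundary n K (d - 1) lam Y"
    using g(3)
  proof
    assume "\<forall>l\<in>{1..K}. g 0 l = of_bool (a < l \<and> l \<le> b)"
    then have "boundary n K d (\<lambda>l. lam l + ind a l) X \<and> boundary n K (d - 1) (\<lambda>l. lam l + ind b l) Y"
      using x(2) y(2) ab d g(1,2) unfolding boundary_def X_def Y_def K1 by (auto simp: ind_def)
    then show ?thesis ..
  next
    assume "\<forall>l\<in>{1..K}. g 0 l = - of_bool (l \<le> a)"
    then have "boundary n K d (\<lambda>l. lam l + ind a l + ind b l) X \<and> boundary n K (d - 1) lam Y"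
      using x(2) y(2) ab d g(1,2) unfolding boundary_def X_def Y_def K1 by (auto simp: ind_def)
    then show ?thesis ..
  qed
  then show ?thesis using exchange[of n K \<phi> u x y X Y, OF cv x(1) y(1) XY h v] by blast
qed

end

section \<open>The tau function as a minimal cost\<close>

text \<open>Column lengths of the diagram with rows \<open>A\<close>, that is, its conjugate
  partition. In columns \<open>mmin\<close> becomes a scalar product, see
  \<open>mmin_ge\<close>.\<close>

definition ge :: "nat multiset \<Rightarrow> nat \<Rightarrow> int" where
  "ge A l = int (size {#x \<in># A. l \<le> x#})"

lemma ge_empty [simp]: "ge {#} l = 0" by (simp add: ge_def)

lemma ge_add: "ge (add_mset x A) l = ge A l + ind x l"
  by (simp add: ge_def ind_def)

lemma ge_plus: "ge (A + B) l = ge A l + ge B l"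
  by (simp add: ge_def)

lemma ge_nonneg [simp]: "0 \<le> ge A l" by (simp add: ge_def)

lemma ge_antimono: "l \<le> l' \<Longrightarrow> ge A l' \<le> ge A l"
  by (induction A) (auto simp: ge_add ind_def)

lemma ge_beyond: "\<forall>x\<in>#A. x < l \<Longrightarrow> ge A l = 0"
  by (induction A) (auto simp: ge_add ind_def)

lemma sum_ind: "x \<le> K \<Longrightarrow> (\<Sum>l\<in>{1..K}. ind x l) = int x"
proof -
  assume "x \<le> K"
  then have "{1..K} \<inter> {l. l \<le> x} = {1..x}" by auto
  then show ?thesis by (simp add: ind_def of_bool_def sum.If_cases)
qed

lemma sum_ind_ind: "x \<le> K \<Longrightarrow> (\<Sum>l\<in>{1..K}. ind x l * ind y l) = int (min x y)"
proof -
  assume "x \<le> K"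
  then have "(\<Sum>l\<in>{1..K}. ind (min x y) l) = int (min x y)" by (intro sum_ind) auto
  moreover have "ind x l * ind y l = ind (min x y) l" for l by (auto simp: ind_def)
  ultimately show ?thesis by simp
qed

lemma sum_ge: "\<forall>x\<in>#A. x \<le> K \<Longrightarrow> (\<Sum>l\<in>{1..K}. ge A l) = int (sum_mset A)"
  by (induction A) (auto simp: ge_add sum.distrib sum_ind simp del: One_nat_def)

lemma sum_ind_ge: "x \<le> K \<Longrightarrow> (\<Sum>l\<in>{1..K}. ind x l * ge B l) = int (\<Sum>y\<in>#B. min x y)"
  by (induction B) (auto simp: ge_add sum.distrib sum_ind_ind distrib_left simp del: One_nat_def)

lemma mmin_ge:
  assumes "\<forall>x\<in>#A. x \<le> K"
  shows "mmin A B = (\<Sum>l\<in>{1..K}. ge A l * ge B l)"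
  using assms
proof (induction A)
  case (add x A)
  have "mmin (add_mset x A) B = int (\<Sum>y\<in>#B. min x y) + mmin A B" by (simp add: mmin_def)
  then show ?case using add sum_ind_ge[of x K B]
    by (simp add: ge_add distrib_right sum.distrib del: One_nat_def)
qed (simp add: mmin_def)

lemma finite_subset_mset: "finite {B. B \<subseteq># A}"
proof (induction A)
  case (add a A)
  have "{B. B \<subseteq># add_mset a A} \<subseteq> {B. B \<subseteq># A} \<union> add_mset a ` {B. B \<subseteq># A}"
  proof
    fix B assume B: "B \<in> {B. B \<subseteq># add_mset a A}"
    show "B \<in> {B. B \<subseteq># A} \<union> add_mset a ` {B. B \<subseteq># A}"
    proof (cases "a \<in># B")
      case True
      then obtain C where "B = add_mset a C" by (metis insert_DiffM)
      then show ?thesis using B by auto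
    next
      case False
      then have "B \<subseteq># A" using B unfolding subseteq_mset_def mem_Collect_eq
        by (metis count_add_mset count_eq_zero_iff le0)
      then show ?thesis by simp
    qed
  qed
  then show ?case using add finite_subset by blast
qed simp

definition subcfg :: "nat \<Rightarrow> rc \<Rightarrow> rc \<Rightarrow> bool" where
  "subcfg n N M \<longleftrightarrow> (\<forall>a\<in>{1..n}. N a \<subseteq># M a) \<and> (\<forall>a. a \<notin> {1..n} \<longrightarrow> N a = {#})"

lemma finite_subcfg: "finite {N. subcfg n N M}"
proof -
  let ?B = "\<Union>a\<in>{1..n}. {X. X \<subseteq># M a}"
  have "finite {N. \<forall>a. (a \<in> {1..n} \<longrightarrow> N a \<in> ?B) \<and> (a \<notin> {1..n} \<longrightarrow> N a = {#})}"
    by (intro finite_set_of_finite_funs) (auto simp: finite_subset_mset)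
  then show ?thesis by (rule rev_finite_subset) (unfold subcfg_def, blast)
qed

lemma tau_alt: "tau n M d lam = Max ((\<lambda>N. tau_val n lam N d) ` {N. subcfg n N M})"
  unfolding tau_def subcfg_def by (intro arg_cong[where f=Max]) auto

lemma tau_ge: "subcfg n N M \<Longrightarrow> tau_val n lam N d \<le> tau n M d lam"
  unfolding tau_alt by (intro Max_ge) (auto simp: finite_subcfg)

lemma tau_attained: "\<exists>N. subcfg n N M \<and> tau n M d lam = tau_val n lam N d"
proof -
  have "(\<lambda>_. {#}) \<in> {N. subcfg n N M}" by (simp add: subcfg_def)
  then have "Max ((\<lambda>N. tau_val n lam N d) ` {N. subcfg n N M}) \<in> (\<lambda>N. tau_val n lam N d) ` {N. subcfg n N M}"
    by (intro Max_in) (auto simp: finite_subcfg)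
  then show ?thesis unfolding tau_alt by auto
qed

lemma tau_eqI:
  assumes "\<And>N. subcfg n N M \<Longrightarrow> tau_val n lam N d \<le> v" "\<exists>N. subcfg n N M \<and> v \<le> tau_val n lam N d"
  shows "tau n M d lam = v"
  using assms tau_ge[of n _ M lam d] tau_attained[of n M d lam] by (metis order.antisym order.trans)

text \<open>With \<open>lam\<close> as level 0, its coupling to level 1 has the same form as the
  coupling of consecutive levels.\<close>

definition lens :: "nat multiset \<Rightarrow> rc \<Rightarrow> nat \<Rightarrow> nat multiset" where
  "lens lam N a = (if a = 0 then lam else image_mset fst (N a))"

abbreviation hgt :: "nat multiset \<Rightarrow> rc \<Rightarrow> nat \<Rightarrow> nat \<Rightarrow> int" where
  "hgt lam N a l \<equiv> ge (lens lam N a) l"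

text \<open>Half the Cartan form of type A in \<open>h 1, ..., h n\<close>, together with the
  coupling \<open>- h 0 * h 1\<close> to the boundary value.\<close>

definition qform :: "nat \<Rightarrow> (nat \<Rightarrow> int) \<Rightarrow> int" where
  "qform n h = (\<Sum>a\<in>{1..n}. (h a) ^ 2) - (\<Sum>a<n. h a * h (a + 1))"

lemma qform_squares:
  assumes "h (n + 1) = 0"
  shows "(\<Sum>a\<in>{0..n}. (h a - h (a + 1)) ^ 2) = (h 0) ^ 2 + 2 * qform n h"
proof -
  have "(\<Sum>a\<in>{0..m}. (h a - h (a + 1)) ^ 2)
      = (h 0) ^ 2 + 2 * qform m h + (h (m + 1)) ^ 2 - 2 * h m * h (m + 1)" for m
    by (induction m) (auto simp: qform_def power2_eq_square algebra_simps)
  then show ?thesis using assms by simp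
qed

definition rig :: "nat \<Rightarrow> rc \<Rightarrow> int" where
  "rig n N = (\<Sum>a\<in>{1..n}. \<Sum>x\<in>#N a. snd x)"

definition tau_hgt_val :: "nat \<Rightarrow> nat \<Rightarrow> nat \<Rightarrow> nat multiset \<Rightarrow> rc \<Rightarrow> int" where
  "tau_hgt_val n K d lam N = - (\<Sum>l\<in>{1..K}. qform n (\<lambda>a. hgt lam N a l) + hgt lam N d l) - rig n N"

definition bounded :: "nat \<Rightarrow> nat \<Rightarrow> rc \<Rightarrow> bool" where
  "bounded n K M \<longleftrightarrow> (\<forall>a\<in>{1..n}. \<forall>x\<in>#M a. 1 \<le> fst x \<and> fst x \<le> K)"

lemma bounded_sub: "bounded n K M \<Longrightarrow> subcfg n N M \<Longrightarrow> bounded n K N"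
  unfolding bounded_def subcfg_def by (meson mset_subset_eqD)

lemma tau_val_tau_hgt_val:
  assumes n: "1 \<le> n" and d: "1 \<le> d" "d \<le> n + 1" and N: "bounded n K N" "N (n + 1) = {#}"
    and lam: "\<forall>x\<in>#lam. x \<le> K"
  shows "tau_val n lam N d = tau_hgt_val n K d lam N"
proof -
  have le: "\<forall>x\<in>#lens lam N a. x \<le> K" if "a \<le> n" for a
    using that N lam by (auto simp: lens_def bounded_def)
  have 1: "mmin lam (image_mset fst (N 1)) + (\<Sum>a\<in>{1..<n}. mmin (image_mset fst (N a)) (image_mset fst (N (a + 1))))
      = (\<Sum>a<n. mmin (lens lam N a) (lens lam N (a + 1)))"
  proof -
    obtain m where m: "n = Suc m" using n by (cases n) auto
    have "(\<Sum>a\<in>{1..<n}. mmin (image_mset fst (N a)) (image_mset fst (N (a + 1))))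
        = (\<Sum>a<m. mmin (lens lam N (Suc a)) (lens lam N (Suc a + 1)))"
      unfolding m using sum.shift_bounds_Suc_ivl[of "\<lambda>a. mmin (image_mset fst (N a)) (image_mset fst (N (a + 1)))" 0 m]
      by (simp add: lens_def lessThan_atLeast0)
    then show ?thesis unfolding m sum.lessThan_Suc_shift by (simp add: lens_def)
  qed
  have 2: "(\<Sum>a\<in>{1..n}. mmin (image_mset fst (N a)) (image_mset fst (N a))) = (\<Sum>a\<in>{1..n}. mmin (lens lam N a) (lens lam N a))"
    by (intro sum.cong) (auto simp: lens_def)
  have 3: "(if d = n + 1 then 0 else int (\<Sum>x\<in>#N d. fst x)) = (\<Sum>l\<in>{1..K}. hgt lam N d l)"
  proof (cases "d = n + 1")
    case True
    then show ?thesis using N by (simp add: lens_def)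
  next
    case False
    then show ?thesis using d le[of d] by (subst sum_ge) (auto simp: lens_def)
  qed
  have 4: "(\<Sum>a<n. mmin (lens lam N a) (lens lam N (a + 1))) = (\<Sum>a<n. \<Sum>l\<in>{1..K}. hgt lam N a l * hgt lam N (a + 1) l)"
    by (intro sum.cong refl mmin_ge le) auto
  have 5: "(\<Sum>a\<in>{1..n}. mmin (lens lam N a) (lens lam N a)) = (\<Sum>a\<in>{1..n}. \<Sum>l\<in>{1..K}. (hgt lam N a l) ^ 2)"
    unfolding power2_eq_square by (intro sum.cong refl mmin_ge le) auto
  show ?thesis
    unfolding tau_val_def 1 2 3 4 5 tau_hgt_val_def qform_def rig_def sum.distrib sum_subtractf
    by (simp add: sum.swap[of _ "{1..K}"] del: One_nat_def)
qed

text \<open>The continuation to \<open>d = 0\<close> is chosen such that \<open>tq_height_attained\<close> and \<open>tq_height_bound\<close>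
  hold for it as well.\<close>

definition tq :: "nat \<Rightarrow> rc \<Rightarrow> nat \<Rightarrow> nat multiset \<Rightarrow> int" where
  "tq n M d lam = (if d = 0 then tau n M (n + 1) lam - int (sum_mset lam) else tau n M d lam)"

lemma tau_hgt_val_zero:
  assumes "\<forall>x\<in>#lam. x \<le> K" "N (n + 1) = {#}"
  shows "tau_hgt_val n K 0 lam N = tau_hgt_val n K (n + 1) lam N - int (sum_mset lam)"
  using assms sum_ge[of lam K] unfolding tau_hgt_val_def by (simp add: sum.distrib lens_def)

lemma tq_ge:
  assumes "1 \<le> n" "d \<le> n + 1" "bounded n K M" "\<forall>x\<in>#lam. x \<le> K" "subcfg n N M"
  shows "tau_hgt_val n K d lam N \<le> tq n M d lam"
proof -
  have N: "bounded n K N" "N (n + 1) = {#}" using bounded_sub[OF assms(3,5)] assms(5) by (auto simp: subcfg_def)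
  show ?thesis
    using tau_val_tau_hgt_val[OF assms(1) _ _ N assms(4), of d] tau_val_tau_hgt_val[OF assms(1) _ _ N assms(4), of "n + 1"]
      tau_ge[OF assms(5), of lam d] tau_ge[OF assms(5), of lam "n + 1"] tau_hgt_val_zero[of lam K N n] N assms
    unfolding tq_def by (cases "d = 0") auto
qed

lemma tq_attained:
  assumes "1 \<le> n" "d \<le> n + 1" "bounded n K M" "\<forall>x\<in>#lam. x \<le> K"
  shows "\<exists>N. subcfg n N M \<and> tq n M d lam = tau_hgt_val n K d lam N"
proof -
  obtain N where s: "subcfg n N M"
    and e: "tau n M (if d = 0 then n + 1 else d) lam = tau_val n lam N (if d = 0 then n + 1 else d)"
    using tau_attained by blast
  have N: "bounded n K N" "N (n + 1) = {#}" using bounded_sub[OF assms(3) s] s by (auto simp: subcfg_def)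
  show ?thesis
    using s e tau_val_tau_hgt_val[OF assms(1) _ _ N assms(4), of d] tau_val_tau_hgt_val[OF assms(1) _ _ N assms(4), of "n + 1"]
      tau_hgt_val_zero[of lam K N n] N assms
    unfolding tq_def by (intro exI[of _ N]) (cases "d = 0"; simp)
qed


section \<open>Riggings as convex arc costs\<close>

definition rigs :: "rc \<Rightarrow> nat \<Rightarrow> nat \<Rightarrow> int list" where
  "rigs M a l = sorted_list_of_multiset (image_mset snd {#x \<in># M a. fst x = l#})"

text \<open>The column part of the value does not distinguish rows of equal length, so an optimal
  choice of \<open>k\<close> of them takes the smallest riggings. Sorting makes the increments
  nondecreasing, hence the cost convex in \<open>k\<close>.\<close>

definition rig_cost :: "rc \<Rightarrow> nat \<Rightarrow> nat \<Rightarrow> int \<Rightarrow> int" where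
  "rig_cost M a l k = sum_list (take (nat k) (rigs M a l))"

definition capacity :: "rc \<Rightarrow> nat \<Rightarrow> nat \<Rightarrow> int" where
  "capacity M a l = int (length (rigs M a l))"

lemma mset_rigs: "mset (rigs M a l) = image_mset snd {#x \<in># M a. fst x = l#}"
  by (simp add: rigs_def)

lemma capacity_size: "capacity M a l = int (size {#x \<in># M a. fst x = l#})"
  unfolding capacity_def size_mset[symmetric] mset_rigs by simp

lemma rig_cost_convex_upto: "convex_upto (rig_cost M a l) (capacity M a l)"
proof (rule convexI)
  fix k :: int assume k: "0 \<le> k" "k + 2 \<le> capacity M a l"
  let ?r = "rigs M a l"
  have l: "nat k + 2 \<le> length ?r" using k by (simp add: capacity_def)
  have 1: "nat (k + 1) = Suc (nat k)" "nat (k + 2) = Suc (Suc (nat k))" using k by auto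
  have "?r ! nat k \<le> ?r ! Suc (nat k)"
    using l by (intro sorted_nth_mono) (auto simp: rigs_def)
  then show "2 * rig_cost M a l (k + 1) \<le> rig_cost M a l k + rig_cost M a l (k + 2)"
    using l unfolding rig_cost_def 1 by (simp add: take_Suc_conv_app_nth)
qed

lemma sum_take_sorted_le:
  fixes xs :: "int list"
  assumes "sorted xs" "N \<subseteq># mset xs"
  shows "sum_list (take (size N) xs) \<le> sum_mset N"
  using assms
proof (induction xs arbitrary: N)
  case (Cons x xs)
  show ?case
  proof (cases "x \<in># N")
    case True
    then obtain N1 where N1: "N = add_mset x N1" by (metis insert_DiffM)
    then show ?thesis using Cons by auto
  next
    case False
    then have N: "N \<subseteq># mset xs" using Cons.prems(2) unfolding subseteq_mset_def
      by (metis count_add_mset count_eq_zero_iff le0 mset.simps(2))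
    then have sz: "size N \<le> length xs" by (metis size_mset size_mset_mono)
    have "sum_list (take (size N) (x # xs)) \<le> sum_list (take (size N) xs)"
    proof (cases "size N")
      case (Suc m)
      then have "x \<le> xs ! m" using Cons.prems(1) sz by simp
      then show ?thesis using Suc sz by (simp add: take_Suc_conv_app_nth)
    qed simp
    then show ?thesis using Cons.IH[OF _ N] Cons.prems(1) by simp
  qed
qed simp

lemma rig_cost_le:
  assumes "N \<subseteq># {#x \<in># M a. fst x = l#}"
  shows "rig_cost M a l (int (size N)) \<le> (\<Sum>x\<in>#N. snd x)"
  using sum_take_sorted_le[of "rigs M a l" "image_mset snd N"] image_mset_subseteq_mono[OF assms, of snd]
  by (simp add: rig_cost_def mset_rigs) (simp add: rigs_def)

lemma image_filter_ge_diff: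
  "ge (image_mset fst N) l - ge (image_mset fst N) (l + 1) = int (size {#x \<in># N. fst x = l#})"
  by (induction N) (auto simp: ge_add ind_def)

lemma sum_mset_by_length:
  fixes f :: "nat \<times> int \<Rightarrow> int"
  assumes "\<forall>x\<in>#N. 1 \<le> fst x \<and> fst x \<le> K"
  shows "(\<Sum>x\<in>#N. f x) = (\<Sum>l\<in>{1..K}. \<Sum>x\<in>#{#x \<in># N. fst x = l#}. f x)"
  using assms
proof (induction N)
  case (add y N)
  have "(\<Sum>l\<in>{1..K}. \<Sum>x\<in>#{#x \<in># add_mset y N. fst x = l#}. f x)
      = (\<Sum>l\<in>{1..K}. (if l = fst y then f y else 0) + (\<Sum>x\<in>#{#x \<in># N. fst x = l#}. f x))"
    by (intro sum.cong) auto
  then show ?case using add by (simp add: sum.distrib)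
qed simp

text \<open>The shift adds 1 to the difference at each \<open>a \<ge> d\<close>. The cross terms
  telescope to \<open>2 * h d\<close>, the linear term of \<open>tau_val\<close>, and the added
  squares sum to \<open>n + 1 - d\<close>.\<close>

lemma shifted_squares:
  assumes "h (n + 1) = 0" "d \<le> n + 1"
  shows "(\<Sum>a\<in>{0..n}. ((h a - int (a - d)) - (h (a + 1) - int (a + 1 - d))) ^ 2)
      = (h 0) ^ 2 + 2 * (qform n h + h d) + int (n + 1 - d)"
proof -
  have "(\<Sum>a\<in>{0..n}. ((h a - int (a - d)) - (h (a + 1) - int (a + 1 - d))) ^ 2)
     = (\<Sum>a\<in>{0..n}. (h a - h (a + 1)) ^ 2 + of_bool (d \<le> a) * (2 * (h a - h (a + 1)) + 1))"
    by (intro sum.cong) (auto simp: power2_eq_square algebra_simps Suc_diff_le)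
  also have "\<dots> = (h 0) ^ 2 + 2 * qform n h + (\<Sum>a\<in>{0..n}. of_bool (d \<le> a) * (2 * (h a - h (a + 1)) + 1))"
    using qform_squares[of h n] assms(1) by (simp add: sum.distrib)
  also have "(\<Sum>a\<in>{0..m}. of_bool (d \<le> a) * (2 * (h a - h (a + 1)) + 1))
      = (if d \<le> m + 1 then 2 * (h d - h (m + 1)) + int (m + 1 - d) else 0)" for m
    by (induction m) (auto simp: Suc_diff_le le_Suc_eq)
  finally show ?thesis using assms by simp
qed

definition theight :: "nat \<Rightarrow> nat multiset \<Rightarrow> rc \<Rightarrow> nat \<Rightarrow> nat \<Rightarrow> int" where
  "theight d lam N a l = hgt lam N a l - int (a - d)"

definition height_const :: "nat \<Rightarrow> nat \<Rightarrow> nat \<Rightarrow> nat multiset \<Rightarrow> int" where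
  "height_const n K d lam = (\<Sum>l\<in>{1..K}. (ge lam l) ^ 2) + int K * int (n + 1 - d)"

lemma tau_hgt_val_squares:
  assumes "N (n + 1) = {#}" "d \<le> n + 1"
  shows "2 * tau_hgt_val n K d lam N = height_const n K d lam
     - (\<Sum>l\<in>{1..K}. \<Sum>a\<in>{0..n}. (theight d lam N a l - theight d lam N (a + 1) l) ^ 2) - 2 * rig n N"
proof -
  have "(\<Sum>l\<in>{1..K}. \<Sum>a\<in>{0..n}. (theight d lam N a l - theight d lam N (a + 1) l) ^ 2)
      = (\<Sum>l\<in>{1..K}. (ge lam l) ^ 2 + 2 * (qform n (\<lambda>a. hgt lam N a l) + hgt lam N d l) + int (n + 1 - d))"
    unfolding theight_def using assms
    by (intro sum.cong refl) (subst shifted_squares, auto simp: lens_def)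
  then show ?thesis unfolding tau_hgt_val_def height_const_def by (simp add: sum.distrib sum_distrib_left del: One_nat_def)
qed

lemma ge_single_beyond: "bounded n K M \<Longrightarrow> subcfg n N M \<Longrightarrow> \<forall>x\<in>#lam. x \<le> K \<Longrightarrow> hgt lam N a (K + 1) = 0"
  using bounded_sub[of n K M N] by (intro ge_beyond) (cases "a \<in> {1..n}"; auto simp: lens_def bounded_def subcfg_def less_Suc_eq_le)

text \<open>Only an inequality is claimed because the optimal sub-configuration is not assumed to
  contain the smallest riggings of each length.\<close>

lemma tq_height_attained:
  assumes "1 \<le> n" "d \<le> n + 1" "bounded n K M" "\<forall>x\<in>#lam. x \<le> K"
  shows "\<exists>x. feasible n K (capacity M) x \<and> boundary n K d (ge lam) x \<and> 2 * tq n M d lam \<le> height_const n K d lam - cost n K (rig_cost M) x"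
proof -
  obtain N where N: "subcfg n N M" "tq n M d lam = tau_hgt_val n K d lam N" using tq_attained[OF assms] by blast
  let ?x = "theight d lam N"
  have d1: "?x a l - ?x a (l + 1) = int (size {#x \<in># N a. fst x = l#})" if "a \<in> {1..n}" for a l
    using that image_filter_ge_diff[of "N a" l] by (simp add: theight_def lens_def)
  have Nf: "{#x \<in># N a. fst x = l#} \<subseteq># {#x \<in># M a. fst x = l#}" if "a \<in> {1..n}" for a l
    using N(1) that by (auto simp: subcfg_def intro: multiset_filter_mono)
  have "feasible n K (capacity M) ?x"
    unfolding feasible_def capacity_size using size_mset_mono[OF Nf] d1 by auto
  moreover have "boundary n K d (ge lam) ?x"
    using N(1) ge_single_beyond[OF assms(3) N(1) assms(4)]
    by (auto simp: boundary_def theight_def lens_def subcfg_def)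
  moreover have "2 * tq n M d lam \<le> height_const n K d lam - cost n K (rig_cost M) ?x"
  proof -
    have "(\<Sum>a\<in>{1..n}. \<Sum>l\<in>{1..K}. rig_cost M a l (?x a l - ?x a (l + 1)))
       \<le> (\<Sum>a\<in>{1..n}. \<Sum>l\<in>{1..K}. \<Sum>x\<in>#{#x \<in># N a. fst x = l#}. snd x)"
      by (intro sum_mono) (simp only: d1, intro rig_cost_le Nf)
    also have "\<dots> = rig n N" unfolding rig_def
      using bounded_sub[OF assms(3) N(1)] by (intro sum.cong refl sum_mset_by_length[symmetric]) (auto simp: bounded_def)
    finally show ?thesis
      using tau_hgt_val_squares[of N n d K lam] N assms(2) unfolding cost_def by (simp add: subcfg_def)
  qed
  ultimately show ?thesis by blast
qed


lemma tq_height_bound: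
  assumes "1 \<le> n" "d \<le> n + 1" "bounded n K M" "\<forall>x\<in>#lam. x \<le> K"
    and x: "feasible n K (capacity M) x" "boundary n K d (ge lam) x"
  shows "height_const n K d lam - cost n K (rig_cost M) x \<le> 2 * tq n M d lam"
proof -
  define k where "k a l = nat (x a l - x a (l + 1))" for a l
  have k: "int (k a l) = x a l - x a (l + 1)" "k a l \<le> length (rigs M a l)" if "a \<in> {1..n}" "l \<in> {1..K}" for a l
    using x(1) that unfolding feasible_def k_def capacity_def by (auto simp: nat_le_iff)
  \<comment> \<open>The sub-configuration is rebuilt from its heights by taking, for each length,
    the prescribed number of rows with the smallest riggings.\<close>
  define P where "P a l = image_mset (Pair l) (mset (take (k a l) (rigs M a l)))" for a l
  define N where "N a = (if a \<in> {1..n} then \<Sum>l\<in>{1..K}. P a l else {#})" for a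
  have P_sub: "P a l \<subseteq># {#x \<in># M a. fst x = l#}" for a l
  proof -
    have "mset (take (k a l) (rigs M a l)) \<subseteq># mset (rigs M a l)"
      by (metis append_take_drop_id mset_append mset_subset_eq_add_left)
    then have "P a l \<subseteq># image_mset (Pair l) (image_mset snd {#x \<in># M a. fst x = l#})"
      unfolding P_def mset_rigs by (rule image_mset_subseteq_mono)
    also have "image_mset (Pair l) (image_mset snd {#x \<in># M a. fst x = l#}) = image_mset (\<lambda>x. x) {#x \<in># M a. fst x = l#}"
      unfolding multiset.map_comp by (intro image_mset_cong) auto
    finally show ?thesis by simp
  qed
  have fP: "{#x \<in># P a l'. fst x = l#} = (if l = l' then P a l else {#})" for a l l'
    by (auto simp: P_def filter_mset_image_mset)
  have fsum: "finite S \<Longrightarrow> {#x \<in># (\<Sum>l'\<in>S. P a l'). fst x = l#} = (if l \<in> S then P a l else {#})" for a l S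
    by (induction S rule: finite_induct) (auto simp: fP)
  have fN: "{#x \<in># N a. fst x = l#} = (if a \<in> {1..n} \<and> l \<in> {1..K} then P a l else {#})" for a l
    unfolding N_def by (cases "a \<in> {1..n}") (simp_all only: fsum finite_atLeastAtMost if_True if_False filter_empty_mset simp_thms)
  have sub: "subcfg n N M" unfolding subcfg_def
  proof (intro conjI ballI allI impI)
    fix a assume a: "a \<in> {1..n}"
    show "N a \<subseteq># M a"
    proof (rule mset_subset_eqI)
      fix y
      have "count (N a) y = count {#x \<in># N a. fst x = fst y#} y" by simp
      also have "\<dots> \<le> count {#x \<in># M a. fst x = fst y#} y"
        unfolding fN using mset_subset_eq_count[OF P_sub[of a "fst y"], of y] by simp
      finally show "count (N a) y \<le> count (M a) y" by simp
    qed
  qed (auto simp: N_def)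
  have top: "x a (K + 1) = - int (a - d)" if "a \<le> n + 1" for a using x(2) that by (auto simp: boundary_def)
  have th: "theight d lam N a l = x a l" if al: "a \<le> n + 1" "l \<le> K + 1" "l \<ge> 1" for a l
  proof -
    consider "a = 0" | "a = n + 1" | "a \<in> {1..n}" using al by force
    then show ?thesis
    proof cases
      case 3
      show ?thesis using al(2,3)
      proof (induction l rule: inc_induct)
        case base
        then show ?case using top[of a] 3 ge_single_beyond[OF assms(3) sub assms(4), of a] by (simp add: theight_def)
      next
        case (step l)
        have "theight d lam N a l - theight d lam N a (l + 1) = int (size {#x \<in># N a. fst x = l#})"
          using 3 image_filter_ge_diff[of "N a" l] by (simp add: theight_def lens_def)
        also have "\<dots> = x a l - x a (l + 1)"
          using k[of a l] 3 step unfolding fN by (auto simp: P_def)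
        finally show ?case using step by simp
      qed
    next
      case 1
      then show ?thesis using x(2) al by (auto simp: boundary_def theight_def lens_def)
    next
      case 2
      then show ?thesis using x(2) al sub by (auto simp: boundary_def theight_def lens_def subcfg_def)
    qed
  qed
  have "rig n N = (\<Sum>a\<in>{1..n}. \<Sum>l\<in>{1..K}. \<Sum>x\<in>#{#x \<in># N a. fst x = l#}. snd x)"
    unfolding rig_def using bounded_sub[OF assms(3) sub]
    by (intro sum.cong refl sum_mset_by_length) (auto simp: bounded_def)
  also have "\<dots> = (\<Sum>a\<in>{1..n}. \<Sum>l\<in>{1..K}. rig_cost M a l (x a l - x a (l + 1)))"
  proof (intro sum.cong refl)
    fix a l assume al: "a \<in> {1..n}" "l \<in> {1..K}"
    have "(\<Sum>x\<in>#{#x \<in># N a. fst x = l#}. snd x) = sum_list (take (k a l) (rigs M a l))"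
    proof -
      have "snd \<circ> Pair l = (\<lambda>r::int. r)" by auto
      then show ?thesis using al unfolding fN by (simp add: P_def multiset.map_comp sum_mset_sum_list)
    qed
    then show "(\<Sum>x\<in>#{#x \<in># N a. fst x = l#}. snd x) = rig_cost M a l (x a l - x a (l + 1))"
      by (simp add: rig_cost_def k_def)
  qed
  finally have "cost n K (rig_cost M) x
      = (\<Sum>l\<in>{1..K}. \<Sum>a\<in>{0..n}. (theight d lam N a l - theight d lam N (a + 1) l) ^ 2) + 2 * rig n N"
    unfolding cost_def by (simp add: th)
  then show ?thesis
    using tau_hgt_val_squares[of N n d K lam] sub assms(2) tq_ge[OF assms(1-4) sub] by (simp add: subcfg_def)
qed

section \<open>The three inequalities behind the three-term relation\<close>

lemma tq_meet_join_bounded: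
  assumes n: "1 \<le> n" and d: "1 \<le> d" "d \<le> n + 1" and M: "bounded n K M" "\<forall>x\<in>#lam. x \<le> K"
    and ab: "a \<le> b" "b \<le> K"
  shows "tq n M (d - 1) (add_mset b lam) + tq n M d (add_mset a lam)
       \<le> tq n M d (add_mset b lam) + tq n M (d - 1) (add_mset a lam)"
proof -
  have d': "d - 1 \<le> n + 1" using d by simp
  have la: "\<forall>x\<in>#add_mset a lam. x \<le> K" and lb: "\<forall>x\<in>#add_mset b lam. x \<le> K" using M ab by auto
  obtain x where x: "feasible n K (capacity M) x" "boundary n K (d - 1) (ge (add_mset b lam)) x"
    "2 * tq n M (d - 1) (add_mset b lam) \<le> height_const n K (d - 1) (add_mset b lam) - cost n K (rig_cost M) x"
    using tq_height_attained[OF n d' M(1) lb] by blast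
  obtain y where y: "feasible n K (capacity M) y" "boundary n K d (ge (add_mset a lam)) y"
    "2 * tq n M d (add_mset a lam) \<le> height_const n K d (add_mset a lam) - cost n K (rig_cost M) y"
    using tq_height_attained[OF n d(2) M(1) la] by blast
  have g: "ge (add_mset c lam) = (\<lambda>l. ge lam l + ind c l)" for c by (auto simp: ge_add)
  obtain X Y where XY: "feasible n K (capacity M) X" "boundary n K d (ge (add_mset b lam)) X"
    "feasible n K (capacity M) Y" "boundary n K (d - 1) (ge (add_mset a lam)) Y"
    "cost n K (rig_cost M) X + cost n K (rig_cost M) Y \<le> cost n K (rig_cost M) x + cost n K (rig_cost M) y"
    using cost_meet_join[OF rig_cost_convex_upto d ab(1) x(1) x(2)[unfolded g] y(1) y(2)[unfolded g]] unfolding g by blast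
  show ?thesis
    using x(3) y(3) XY(5) tq_height_bound[OF n d(2) M(1) lb XY(1,2)] tq_height_bound[OF n d' M(1) la XY(3,4)]
    by (simp add: height_const_def)
qed

text \<open>The term \<open>int a\<close> comes from the squares of the left borders in
  \<open>height_const\<close>: the cross term \<open>2 * ind a l * ind b l\<close> sums to
  \<open>2 * min a b = 2 * a\<close>, and everything is then halved.\<close>

lemma tq_shifted_meet_join_bounded:
  assumes n: "1 \<le> n" and d: "1 \<le> d" "d \<le> n + 1" and M: "bounded n K M" "\<forall>x\<in>#lam. x \<le> K"
    and ab: "a \<le> b" "b \<le> K"
  shows "tq n M d (add_mset a (add_mset b lam)) + tq n M (d - 1) lam
       \<le> tq n M d (add_mset b lam) + tq n M (d - 1) (add_mset a lam) + int a"
proof -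
  have d': "d - 1 \<le> n + 1" using d by simp
  have la: "\<forall>x\<in>#add_mset a lam. x \<le> K" and lb: "\<forall>x\<in>#add_mset b lam. x \<le> K"
    and lab: "\<forall>x\<in>#add_mset a (add_mset b lam). x \<le> K" using M ab by auto
  obtain x where x: "feasible n K (capacity M) x" "boundary n K d (ge (add_mset a (add_mset b lam))) x"
    "2 * tq n M d (add_mset a (add_mset b lam)) \<le> height_const n K d (add_mset a (add_mset b lam)) - cost n K (rig_cost M) x"
    using tq_height_attained[OF n d(2) M(1) lab] by blast
  obtain y where y: "feasible n K (capacity M) y" "boundary n K (d - 1) (ge lam) y"
    "2 * tq n M (d - 1) lam \<le> height_const n K (d - 1) lam - cost n K (rig_cost M) y"
    using tq_height_attained[OF n d' M] by blast
  have g: "ge (add_mset c lam) = (\<lambda>l. ge lam l + ind c l)" for c by (auto simp: ge_add)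
  have g2: "ge (add_mset a (add_mset b lam)) = (\<lambda>l. ge lam l + ind a l + ind b l)" by (auto simp: ge_add)
  obtain X Y where XY: "feasible n K (capacity M) X" "boundary n K d (ge (add_mset b lam)) X"
    "feasible n K (capacity M) Y" "boundary n K (d - 1) (ge (add_mset a lam)) Y"
    "cost n K (rig_cost M) X + cost n K (rig_cost M) Y \<le> cost n K (rig_cost M) x + cost n K (rig_cost M) y"
    using cost_shifted_meet_join[OF rig_cost_convex_upto d ab x(1) x(2)[unfolded g2] y(1,2)] unfolding g by blast
  have "(\<Sum>l\<in>{1..K}. (ge (add_mset a (add_mset b lam)) l) ^ 2 + (ge lam l) ^ 2)
      = (\<Sum>l\<in>{1..K}. (ge (add_mset b lam) l) ^ 2 + (ge (add_mset a lam) l) ^ 2 + 2 * (ind a l * ind b l))"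
    unfolding g g2 by (intro sum.cong) (auto simp: power2_eq_square algebra_simps)
  also have "\<dots> = (\<Sum>l\<in>{1..K}. (ge (add_mset b lam) l) ^ 2) + (\<Sum>l\<in>{1..K}. (ge (add_mset a lam) l) ^ 2) + 2 * int a"
    using sum_ind_ind[of a K b] ab by (simp add: sum.distrib sum_distrib_left[symmetric] del: One_nat_def)
  finally have "height_const n K d (add_mset a (add_mset b lam)) + height_const n K (d - 1) lam
      = height_const n K d (add_mset b lam) + height_const n K (d - 1) (add_mset a lam) + 2 * int a"
    unfolding height_const_def by (simp add: sum.distrib)
  then show ?thesis
    using x(3) y(3) XY(5) tq_height_bound[OF n d(2) M(1) lb XY(1,2)] tq_height_bound[OF n d' M(1) la XY(3,4)]
    by simp
qed

lemma tq_path_swap_bounded: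
  assumes n: "1 \<le> n" and d: "1 \<le> d" "d \<le> n + 1" and M: "bounded n K M" "\<forall>x\<in>#lam. x \<le> K"
    and ab: "1 \<le> a" "a < b" "b < K"
  shows "tq n M d (add_mset b lam) + tq n M (d - 1) (add_mset a lam)
       \<le> max (tq n M (d - 1) (add_mset b lam) + tq n M d (add_mset a lam))
             (tq n M d (add_mset a (add_mset b lam)) + tq n M (d - 1) lam - int a)"
proof -
  have d': "d - 1 \<le> n + 1" using d by simp
  have la: "\<forall>x\<in>#add_mset a lam. x \<le> K" and lb: "\<forall>x\<in>#add_mset b lam. x \<le> K"
    and lab: "\<forall>x\<in>#add_mset a (add_mset b lam). x \<le> K" using M ab by auto
  obtain x where x: "feasible n K (capacity M) x" "boundary n K d (ge (add_mset b lam)) x"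
    "2 * tq n M d (add_mset b lam) \<le> height_const n K d (add_mset b lam) - cost n K (rig_cost M) x"
    using tq_height_attained[OF n d(2) M(1) lb] by blast
  obtain y where y: "feasible n K (capacity M) y" "boundary n K (d - 1) (ge (add_mset a lam)) y"
    "2 * tq n M (d - 1) (add_mset a lam) \<le> height_const n K (d - 1) (add_mset a lam) - cost n K (rig_cost M) y"
    using tq_height_attained[OF n d' M(1) la] by blast
  have g: "ge (add_mset c lam) = (\<lambda>l. ge lam l + ind c l)" for c by (auto simp: ge_add)
  have g2: "ge (add_mset a (add_mset b lam)) = (\<lambda>l. ge lam l + ind a l + ind b l)" by (auto simp: ge_add)
  obtain X Y where XY: "feasible n K (capacity M) X" "feasible n K (capacity M) Y"
    "boundary n K d (ge (add_mset a lam)) X \<and> boundary n K (d - 1) (ge (add_mset b lam)) Y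
     \<or> boundary n K d (ge (add_mset a (add_mset b lam))) X \<and> boundary n K (d - 1) (ge lam) Y"
    "cost n K (rig_cost M) X + cost n K (rig_cost M) Y \<le> cost n K (rig_cost M) x + cost n K (rig_cost M) y"
    using cost_path_swap[OF rig_cost_convex_upto d ab x(1) x(2)[unfolded g] y(1) y(2)[unfolded g]] unfolding g g2 by blast
  have "(\<Sum>l\<in>{1..K}. (ge (add_mset a (add_mset b lam)) l) ^ 2 + (ge lam l) ^ 2)
      = (\<Sum>l\<in>{1..K}. (ge (add_mset b lam) l) ^ 2 + (ge (add_mset a lam) l) ^ 2 + 2 * (ind a l * ind b l))"
    unfolding g g2 by (intro sum.cong) (auto simp: power2_eq_square algebra_simps)
  also have "\<dots> = (\<Sum>l\<in>{1..K}. (ge (add_mset b lam) l) ^ 2) + (\<Sum>l\<in>{1..K}. (ge (add_mset a lam) l) ^ 2) + 2 * int a"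
    using sum_ind_ind[of a K b] ab by (simp add: sum.distrib sum_distrib_left[symmetric] del: One_nat_def)
  finally have c: "height_const n K d (add_mset a (add_mset b lam)) + height_const n K (d - 1) lam
      = height_const n K d (add_mset b lam) + height_const n K (d - 1) (add_mset a lam) + 2 * int a"
    unfolding height_const_def by (simp add: sum.distrib)
  have c': "height_const n K d (add_mset a lam) + height_const n K (d - 1) (add_mset b lam)
      = height_const n K d (add_mset b lam) + height_const n K (d - 1) (add_mset a lam)" by (simp add: height_const_def)
  show ?thesis using XY(3)
  proof (elim disjE conjE)
    assume b: "boundary n K d (ge (add_mset a lam)) X" "boundary n K (d - 1) (ge (add_mset b lam)) Y"
    show ?thesis
      using x(3) y(3) XY(4) c' tq_height_bound[OF n d(2) M(1) la XY(1) b(1)] tq_height_bound[OF n d' M(1) lb XY(2) b(2)]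
      unfolding le_max_iff_disj by linarith
  next
    assume b: "boundary n K d (ge (add_mset a (add_mset b lam))) X" "boundary n K (d - 1) (ge lam) Y"
    show ?thesis
      using x(3) y(3) XY(4) c tq_height_bound[OF n d(2) M(1) lab XY(1) b(1)] tq_height_bound[OF n d' M XY(2) b(2)]
      unfolding le_max_iff_disj by linarith
  qed
qed

section \<open>The ultradiscrete Hirota equation and the combinatorial R\<close>

definition wf_cfg :: "nat \<Rightarrow> rc \<Rightarrow> bool" where
  "wf_cfg n M \<longleftrightarrow> 1 \<le> n \<and> (\<forall>a\<in>{1..n}. \<forall>x\<in>#M a. 1 \<le> fst x)"

text \<open>The bound \<open>K\<close> is auxiliary and disappears from the statements below; it is
  taken strictly above \<open>c\<close> for the sake of the path argument.\<close>

lemma ex_bound: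
  assumes "wf_cfg n M"
  shows "\<exists>K. bounded n K M \<and> (\<forall>x\<in>#lam. x \<le> K) \<and> c < K"
proof -
  define S where "S = (\<Union>a\<in>{1..n}. fst ` set_mset (M a)) \<union> set_mset lam \<union> {c}"
  have fin: "finite S" by (simp add: S_def)
  have b: "x \<le> Max S" if "x \<in> S" for x using fin that by simp
  have "bounded n (Max S + 1) M"
    unfolding bounded_def
  proof (intro ballI conjI)
    fix a x assume a: "a \<in> {1..n}" "x \<in># M a"
    show "1 \<le> fst x" using assms a by (simp add: wf_cfg_def)
    have "fst x \<in> S" using a unfolding S_def by blast
    then show "fst x \<le> Max S + 1" using b by (simp add: le_SucI)
  qed
  moreover have "x \<le> Max S + 1" if "x \<in># lam" for x
  proof -
    have "x \<in> S" using that by (simp add: S_def)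
    then show ?thesis using b by (simp add: le_SucI)
  qed
  moreover have "c < Max S + 1"
  proof -
    have "c \<in> S" by (simp add: S_def)
    then show ?thesis using b by (simp add: less_Suc_eq_le)
  qed
  ultimately show ?thesis by blast
qed

lemma tau_val_zero_row: "tau_val n (add_mset 0 lam) N d = tau_val n lam N d"
proof -
  have z: "(\<Sum>y\<in>#B. min (0::nat) y) = (0::nat)" for B by (induction B) auto
  have "mmin (add_mset 0 lam) B = mmin lam B" for B
    unfolding mmin_def image_mset_add_mset sum_mset.add_mset z by simp
  then show ?thesis by (simp add: tau_val_def)
qed

lemma tq_zero_row: "tq n M d (add_mset 0 lam) = tq n M d lam"
  by (simp add: tq_def tau_alt tau_val_zero_row)

lemma tq_quasi_periodic: "tq n M (n + 1) lam = tq n M 0 lam + int (sum_mset lam)"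
  by (simp add: tq_def)

context
  fixes n :: nat and M :: rc
  assumes wf: "wf_cfg n M"
begin

lemma tq_meet_join:
  assumes "1 \<le> d" "d \<le> n + 1" "a \<le> b"
  shows "tq n M (d - 1) (add_mset b lam) + tq n M d (add_mset a lam)
       \<le> tq n M d (add_mset b lam) + tq n M (d - 1) (add_mset a lam)"
  using ex_bound[OF wf, of lam b] tq_meet_join_bounded[of n d _ M lam a b] assms wf unfolding wf_cfg_def
  by (metis less_imp_le)

lemma tq_shifted_meet_join:
  assumes "1 \<le> d" "d \<le> n + 1" "a \<le> b"
  shows "tq n M d (add_mset a (add_mset b lam)) + tq n M (d - 1) lam
       \<le> tq n M d (add_mset b lam) + tq n M (d - 1) (add_mset a lam) + int a"
  using ex_bound[OF wf, of lam b] tq_shifted_meet_join_bounded[of n d _ M lam a b] assms wf unfolding wf_cfg_def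
  by (metis less_imp_le)

lemma tq_path_swap:
  assumes "1 \<le> d" "d \<le> n + 1" "1 \<le> a" "a < b"
  shows "tq n M d (add_mset b lam) + tq n M (d - 1) (add_mset a lam)
       \<le> max (tq n M (d - 1) (add_mset b lam) + tq n M d (add_mset a lam))
             (tq n M d (add_mset a (add_mset b lam)) + tq n M (d - 1) lam - int a)"
  using ex_bound[OF wf, of lam b] tq_path_swap_bounded[of n d _ M lam a b] assms wf unfolding wf_cfg_def
  by metis

lemma tq_three_term:
  assumes "1 \<le> d" "d \<le> n + 1" "1 \<le> a" "a < b"
  shows "tq n M d (add_mset b lam) + tq n M (d - 1) (add_mset a lam)
       = max (tq n M (d - 1) (add_mset b lam) + tq n M d (add_mset a lam))
             (tq n M d (add_mset a (add_mset b lam)) + tq n M (d - 1) lam - int a)"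
  using tq_meet_join[of d a b lam] tq_shifted_meet_join[of d a b lam] tq_path_swap[of d a b lam] assms by linarith

end

section \<open>Tensor factors as second differences of tau\<close>

definition tau_letter :: "nat \<Rightarrow> rc \<Rightarrow> nat multiset \<Rightarrow> nat \<Rightarrow> nat \<Rightarrow> int" where
  "tau_letter n M lam a d = tq n M d (add_mset a lam) - tq n M d lam
                  - tq n M (d - 1) (add_mset a lam) + tq n M (d - 1) lam"

text \<open>The factor belonging to a row \<open>a\<close> placed after the rows \<open>lam\<close>.
  It depends on the preceding rows only as a multiset, which is what makes exchanging rows
  meaningful.\<close>

definition tau_factor :: "nat \<Rightarrow> rc \<Rightarrow> nat multiset \<Rightarrow> nat \<Rightarrow> nat list" where
  "tau_factor n M lam a = map (\<lambda>d. nat (tau_letter n M lam a d)) [1..<n+2]"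

text \<open>The submodular inequality in which the shorter of the two rows is the empty row
  0.\<close>

lemma tau_letter_nonneg:
  assumes "wf_cfg n M" "1 \<le> d" "d \<le> n + 1"
  shows "0 \<le> tau_letter n M lam a d"
  using tq_meet_join[OF assms(1,2,3), of 0 a lam] unfolding tau_letter_def by (simp add: tq_zero_row)

lemma tau_factor_nth:
  assumes "wf_cfg n M" "j \<le> n"
  shows "int (tau_factor n M lam a ! j) = tau_letter n M lam a (j + 1)"
  using tau_letter_nonneg[OF assms(1), of "j + 1" lam a] assms(2) unfolding tau_factor_def
  by (subst nth_map) (auto simp del: upt_Suc)

lemma tau_factor_length [simp]: "length (tau_factor n M lam a) = n + 1"
  by (simp add: tau_factor_def)

text \<open>The second branch is the quasi-periodic continuation in \<open>d\<close>; indices up to \<open>2 * n + 2\<close> occur in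
  \<open>Qf\<close> because letters are read modulo \<open>n + 1\<close>.\<close>

definition tau_incr :: "nat \<Rightarrow> rc \<Rightarrow> nat multiset \<Rightarrow> nat \<Rightarrow> nat \<Rightarrow> int" where
  "tau_incr n M lam a e = (if e \<le> n + 1 then tq n M e (add_mset a lam) - tq n M e lam
     else tq n M (e - (n + 1)) (add_mset a lam) - tq n M (e - (n + 1)) lam + int a)"

lemma tau_incr_periodic:
  assumes "e \<le> n + 1" shows "tau_incr n M lam a (e + (n + 1)) = tau_incr n M lam a e + int a"
proof (cases "e = 0")
  case True
  then show ?thesis using tq_quasi_periodic[of n M lam] tq_quasi_periodic[of n M "add_mset a lam"]
    by (simp add: tau_incr_def)
next
  case False then show ?thesis using assms by (simp add: tau_incr_def)
qed

text \<open>Letters are first differences of \<open>tau_incr\<close>, also beyond one period, so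
  both partial sums in \<open>Qf\<close> telescope.\<close>

lemma comp_tau_factor:
  assumes "wf_cfg n M" "1 \<le> e" "e \<le> 2 * n + 2"
  shows "int (comp n (tau_factor n M lam a) (int e)) = tau_incr n M lam a e - tau_incr n M lam a (e - 1)"
proof (cases "e \<le> n + 1")
  case True
  have "(int e - 1) mod int (n + 1) = int (e - 1)" using True assms by (subst mod_pos_pos_trivial) auto
  then have "comp n (tau_factor n M lam a) (int e) = tau_factor n M lam a ! (e - 1)"
    unfolding comp_def by (simp only: nat_int)
  moreover have "e - Suc 0 \<le> Suc n" using True by simp
  ultimately show ?thesis using True assms tau_factor_nth[OF assms(1), of "e - 1"]
    by (simp add: tau_letter_def tau_incr_def)
next
  case False
  define e' where "e' = e - (n + 1)"
  have e': "1 \<le> e'" "e' \<le> n + 1" "e = e' + (n + 1)" "e - 1 = (e' - 1) + (n + 1)" using False assms by (auto simp: e'_def)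
  have "(int e - 1) mod int (n + 1) = (int (e' - 1) + int (n + 1)) mod int (n + 1)"
    using e' by (intro arg_cong2[where f="(mod)"]) auto
  also have "\<dots> = int (e' - 1)" using e' by (simp only: mod_add_self2) (simp add: mod_pos_pos_trivial)
  finally have "comp n (tau_factor n M lam a) (int e) = tau_factor n M lam a ! (e' - 1)"
    unfolding comp_def by (simp only: nat_int)
  then have "int (comp n (tau_factor n M lam a) (int e)) = tau_letter n M lam a e'"
    using e'(1,2) tau_factor_nth[OF assms(1), of "e' - 1"] by simp
  also have "\<dots> = tau_incr n M lam a e' - tau_incr n M lam a (e' - 1)"
    using e'(1,2) diff_le_self[of e' 1, THEN le_trans, of "n + 1"] by (simp add: tau_letter_def tau_incr_def)
  also have "\<dots> = tau_incr n M lam a e - tau_incr n M lam a (e - 1)"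
    unfolding e'(3,4) using e' tau_incr_periodic[of e' n M lam a] tau_incr_periodic[of "e' - 1" n M lam a] by simp
  finally show ?thesis .
qed

lemma sum_comp_low:
  assumes "wf_cfg n M" "d \<le> n + 1" "1 \<le> k" "k \<le> n + 1"
  shows "int (\<Sum>j\<in>{1..<k}. comp n (tau_factor n M lam a) (int d + int j)) = tau_incr n M lam a (d + k - 1) - tau_incr n M lam a d"
  using assms(3,4)
proof (induction k rule: dec_induct)
  case base then show ?case by simp
next
  case (step k)
  have "int (comp n (tau_factor n M lam a) (int (d + k))) = tau_incr n M lam a (d + k) - tau_incr n M lam a (d + k - 1)"
    using step assms by (intro comp_tau_factor) auto
  then show ?case using step by (simp add: sum.atLeastLessThan_Suc)
qed

lemma sum_comp_high:
  assumes "wf_cfg n M" "d \<le> n + 1" "k \<le> n + 1"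
  shows "int (\<Sum>j\<in>{k<..n+1}. comp n (tau_factor n M lam a) (int d + int j)) = tau_incr n M lam a (d + n + 1) - tau_incr n M lam a (d + k)"
  using assms(3)
proof (induction k rule: inc_induct)
  case base then show ?case by simp
next
  case (step k)
  have "{k<..n+1} = insert (k + 1) {k+1<..n+1}" using step by auto
  moreover have "int (comp n (tau_factor n M lam a) (int (d + (k + 1)))) = tau_incr n M lam a (d + (k + 1)) - tau_incr n M lam a (d + (k + 1) - 1)"
    using step assms by (intro comp_tau_factor) auto
  ultimately show ?case using step by (simp add: algebra_simps)
qed

text \<open>\<open>f (d + m)\<close> is the maximum of \<open>f d\<close> and all the
  \<open>c e\<close>; the strict increase of \<open>f\<close> over the period excludes
  \<open>f d\<close>.\<close>

lemma running_max:
  fixes f c :: "nat \<Rightarrow> int"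
  assumes "\<And>e. e \<in> {d+1..d+m} \<Longrightarrow> f e = max (f (e - 1)) (c e)" "f d < f (d + m)"
  shows "(\<forall>e\<in>{d+1..d+m}. c e \<le> f (d + m)) \<and> (\<exists>e\<in>{d+1..d+m}. c e = f (d + m))"
proof -
  have "(\<forall>e\<in>{d+1..d+k}. c e \<le> f (d + k)) \<and> (f (d + k) = f d \<or> (\<exists>e\<in>{d+1..d+k}. c e = f (d + k)))"
    if "k \<le> m" for k
    using that
  proof (induction k)
    case (Suc k)
    have *: "f (d + Suc k) = max (f (d + k)) (c (d + Suc k))" using assms(1)[of "d + Suc k"] Suc.prems by simp
    have s: "{d+1..d+Suc k} = insert (d + Suc k) {d+1..d+k}" by auto
    show ?case using Suc * unfolding s by (auto simp: max_def split: if_splits)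
  qed simp
  from this[of m] show ?thesis using assms(2) by auto
qed

lemma running_max_down:
  fixes f c :: "nat \<Rightarrow> int"
  assumes "\<And>e. e \<in> {d+1..d+m} \<Longrightarrow> f (e - 1) = max (f e) (c e)" "f (d + m) < f d"
  shows "(\<forall>e\<in>{d+1..d+m}. c e \<le> f d) \<and> (\<exists>e\<in>{d+1..d+m}. c e = f d)"
proof -
  have "(\<forall>e\<in>{d+m-k+1..d+m}. c e \<le> f (d + m - k)) \<and> (f (d + m - k) = f (d + m) \<or> (\<exists>e\<in>{d+m-k+1..d+m}. c e = f (d + m - k)))"
    if "k \<le> m" for k
    using that
  proof (induction k)
    case (Suc k)
    have eq: "d + m - k - 1 = d + m - Suc k" "d + m - k = d + m - Suc k + 1" using Suc.prems by auto
    have *: "f (d + m - Suc k) = max (f (d + m - k)) (c (d + m - k))"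
      using assms(1)[of "d + m - k"] Suc.prems eq(1) by auto
    have s: "{d+m-Suc k+1..d+m} = insert (d + m - k) {d+m-k+1..d+m}" using Suc.prems by auto
    show ?case using Suc * unfolding s by (auto simp: max_def split: if_splits)
  qed simp
  from this[of m] show ?thesis using assms(2) by auto
qed

text \<open>The maximum of this quantity over a full period of \<open>e\<close> determines \<open>Qf\<close>, see \<open>Qf_tau_factor\<close>.\<close>

definition tau_gap :: "nat \<Rightarrow> rc \<Rightarrow> nat multiset \<Rightarrow> nat \<Rightarrow> nat \<Rightarrow> nat \<Rightarrow> int" where
  "tau_gap n M lam a b e = tau_incr n M (add_mset a lam) b e - tau_incr n M lam a (e - 1)"

lemma tau_gap_periodic:
  assumes "1 \<le> e" "e \<le> n + 1"
  shows "tau_gap n M lam a b (e + (n + 1)) = tau_gap n M lam a b e + int b - int a"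
proof -
  have "e + (n + 1) - 1 = (e - 1) + (n + 1)" using assms by simp
  then show ?thesis using assms tau_incr_periodic[of e n M "add_mset a lam" b] tau_incr_periodic[of "e - 1" n M lam a]
    unfolding tau_gap_def by simp
qed

text \<open>The three-term relation read as a recursion in \<open>e\<close>, upwards and downwards.
  The first form serves when the shorter row comes first, the second when the longer one
  does.\<close>

lemma tau_incr_diff_max:
  assumes wf: "wf_cfg n M" and ab: "1 \<le> a" "a < b" and e: "1 \<le> e" "e \<le> 2 * n + 2"
  shows "tau_incr n M lam b e - tau_incr n M lam a e
       = max (tau_incr n M lam b (e - 1) - tau_incr n M lam a (e - 1)) (tau_gap n M lam a b e - int a)"
    and "tau_incr n M lam a (e - 1) - tau_incr n M lam b (e - 1)
       = max (tau_incr n M lam a e - tau_incr n M lam b e) (tau_gap n M lam b a e - int a)"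
proof -
  have sm: "tau_gap n M lam b a e' = tq n M e' (add_mset a (add_mset b lam)) - tq n M e' (add_mset b lam) - tau_incr n M lam b (e' - 1)"
    "tau_gap n M lam a b e' = tq n M e' (add_mset a (add_mset b lam)) - tq n M e' (add_mset a lam) - tau_incr n M lam a (e' - 1)"
    if "e' \<le> n + 1" for e'
    using that by (auto simp: tau_gap_def tau_incr_def add_mset_commute)
  have base: "tau_incr n M lam b e' - tau_incr n M lam a e'
       = max (tau_incr n M lam b (e' - 1) - tau_incr n M lam a (e' - 1)) (tau_gap n M lam a b e' - int a)" if "1 \<le> e'" "e' \<le> n + 1" for e'
    using tq_three_term[OF wf that ab, of lam] sm(2)[OF that(2)] that
    by (simp add: tau_incr_def max_def split: if_splits)
  show 1: "tau_incr n M lam b e - tau_incr n M lam a e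
       = max (tau_incr n M lam b (e - 1) - tau_incr n M lam a (e - 1)) (tau_gap n M lam a b e - int a)"
  proof (cases "e \<le> n + 1")
    case False
    define e' where "e' = e - (n + 1)"
    have e': "1 \<le> e'" "e' \<le> n + 1" "e = e' + (n + 1)" "e - 1 = (e' - 1) + (n + 1)" using False e by (auto simp: e'_def)
    show ?thesis unfolding e'(4) unfolding e'(3)
      using base[OF e'(1,2)] e' tau_incr_periodic[of e' n M lam] tau_incr_periodic[of "e' - 1" n M lam] tau_gap_periodic[OF e'(1,2), of M lam a b]
      by (simp add: max_def split: if_splits)
  qed (use base e in auto)
  \<comment> \<open>Interchanging the two rows changes the gap by the sum of two consecutive values
    of the difference, which turns the upward recursion into the downward one.\<close>
  have "tau_gap n M lam b a e - tau_gap n M lam a b e =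
      (tau_incr n M lam a e - tau_incr n M lam b e) + (tau_incr n M lam a (e - 1) - tau_incr n M lam b (e - 1))"
  proof -
    have "tau_incr n M (add_mset b lam) a e - tau_incr n M (add_mset a lam) b e = tau_incr n M lam a e - tau_incr n M lam b e"
      unfolding tau_incr_def by (simp add: add_mset_commute)
    then show ?thesis unfolding tau_gap_def by linarith
  qed
  then show "tau_incr n M lam a (e - 1) - tau_incr n M lam b (e - 1)
       = max (tau_incr n M lam a e - tau_incr n M lam b e) (tau_gap n M lam b a e - int a)"
    using 1 by linarith
qed


section \<open>Homogeneity and rows of equal length\<close>

definition scale :: "nat \<Rightarrow> rc \<Rightarrow> rc" where
  "scale t M = (\<lambda>a. image_mset (\<lambda>x. (t * fst x, int t * snd x)) (M a))"

lemma mmin_add: "mmin (add_mset x A) B = int (\<Sum>y\<in>#B. min x y) + mmin A B"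
  by (simp add: mmin_def)

lemma mmin_scale: "mmin (image_mset ((*) t) A) (image_mset ((*) t) B) = int t * mmin A B"
proof (induction A)
  case (add x A)
  have "(\<Sum>y\<in>#image_mset ((*) t) B. min (t * x) y) = t * (\<Sum>y\<in>#B. min x y)"
    by (induction B) (auto simp: nat_mult_min_right distrib_left)
  then show ?case unfolding image_mset_add_mset mmin_add add.IH by (simp only: of_nat_mult distrib_left)
qed (simp add: mmin_def)

lemma tau_val_scale:
  "tau_val n (image_mset ((*) t) lam) (scale t N) d = int t * tau_val n lam N d"
proof -
  have f: "image_mset fst (scale t N a) = image_mset ((*) t) (image_mset fst (N a))" for a
    by (simp add: scale_def multiset.map_comp o_def)
  have s: "(\<Sum>x\<in>#scale t N a. snd x) = int t * (\<Sum>x\<in>#N a. snd x)" for a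
    by (simp add: scale_def multiset.map_comp o_def sum_mset_distrib_left)
  have g: "sum_mset (image_mset ((*) t) A) = t * sum_mset A" for A :: "nat multiset"
    by (induction A) (auto simp: distrib_left)
  show ?thesis unfolding tau_val_def f mmin_scale s g
    by (simp add: sum_distrib_left right_diff_distrib distrib_left)
qed

lemma subset_image_msetE:
  assumes "N \<subseteq># image_mset f M" obtains N' where "N' \<subseteq># M" "N = image_mset f N'"
proof -
  obtain R where "image_mset f M = N + R" using assms by (metis subset_mset.add_diff_inverse)
  then obtain B C where "M = B + C" "N = image_mset f B" by (metis image_mset_eq_plusD)
  then show ?thesis by (intro that[of B]) auto
qed

text \<open>Sub-configurations of the image are images of sub-configurations, and a monotone
  \<open>F\<close> commutes with the maximum. Scaling and the two identities for
  \<open>shift 1\<close> are instances.\<close>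

lemma tau_map_rows:
  assumes val: "\<And>N. subcfg n N M \<Longrightarrow> tau_val n lam' (\<lambda>a. image_mset (G a) (N a)) d' = F (tau_val n lam N d)"
    and F: "mono F"
  shows "tau n (\<lambda>a. image_mset (G a) (M a)) d' lam' = F (tau n M d lam)"
proof (rule tau_eqI)
  fix N assume N: "subcfg n N (\<lambda>a. image_mset (G a) (M a))"
  have "\<forall>a. \<exists>N'. (a \<in> {1..n} \<longrightarrow> N' \<subseteq># M a) \<and> (a \<notin> {1..n} \<longrightarrow> N' = {#})
            \<and> N a = image_mset (G a) N'"
  proof
    fix a
    show "\<exists>N'. (a \<in> {1..n} \<longrightarrow> N' \<subseteq># M a) \<and> (a \<notin> {1..n} \<longrightarrow> N' = {#})
            \<and> N a = image_mset (G a) N'"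
    proof (cases "a \<in> {1..n}")
      case True
      then have "N a \<subseteq># image_mset (G a) (M a)" using N unfolding subcfg_def by blast
      then show ?thesis using True by (elim subset_image_msetE) blast
    next
      case False
      then have "N a = {#}" using N unfolding subcfg_def by blast
      then show ?thesis using False by (intro exI[of _ "{#}"]) simp
    qed
  qed
  then obtain N' where N': "\<And>a. (a \<in> {1..n} \<longrightarrow> N' a \<subseteq># M a) \<and> (a \<notin> {1..n} \<longrightarrow> N' a = {#})
            \<and> N a = image_mset (G a) (N' a)"
    by (rule choice[THEN exE]) blast
  have eq: "N = (\<lambda>a. image_mset (G a) (N' a))" using N' by (intro ext) blast
  have sub: "subcfg n N' M" using N' unfolding subcfg_def by blast
  show "tau_val n lam' N d' \<le> F (tau n M d lam)"
    unfolding eq val[OF sub] by (rule monoD[OF F tau_ge[OF sub]])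
next
  obtain N where N: "subcfg n N M" "tau n M d lam = tau_val n lam N d" using tau_attained by blast
  have "subcfg n (\<lambda>a. image_mset (G a) (N a)) (\<lambda>a. image_mset (G a) (M a))"
    using N(1) by (auto simp: subcfg_def intro: image_mset_subseteq_mono)
  then show "\<exists>N. subcfg n N (\<lambda>a. image_mset (G a) (M a)) \<and> F (tau n M d lam) \<le> tau_val n lam' N d'"
    unfolding N(2) val[OF N(1), symmetric] by blast
qed

lemma tau_scale: "tau n (scale t M) d (image_mset ((*) t) lam) = int t * tau n M d lam"
  unfolding scale_def
proof (rule tau_map_rows)
  show "mono ((*) (int t))" by (intro monoI mult_left_mono) simp_all
qed (rule tau_val_scale[unfolded scale_def])

lemma tq_scale: "tq n (scale t M) d (image_mset ((*) t) lam) = int t * tq n M d lam"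
  unfolding tq_def tau_scale by (simp add: right_diff_distrib sum_mset_distrib_left[symmetric])

text \<open>One more box in a row of \<open>lam\<close> changes its coupling to level 1 by at most
  the number of chosen rows there, a number that scaling does not affect.\<close>

lemma tau_increase_row:
  assumes "1 \<le> n"
  shows "tau n M d (add_mset b lam) \<le> tau n M d (add_mset (Suc b) lam)"
    and "tau n M d (add_mset (Suc b) lam) \<le> tau n M d (add_mset b lam) + int (size (M 1))"
proof -
  have d: "tau_val n (add_mset c lam) N d = tau_val n lam N d + int (\<Sum>y\<in>#image_mset fst (N 1). min c y)" for c N
    by (simp add: tau_val_def mmin_def)
  have m: "(\<Sum>y\<in>#B. min b y) \<le> (\<Sum>y\<in>#B. min (Suc b) y)" "(\<Sum>y\<in>#B. min (Suc b) y) \<le> (\<Sum>y\<in>#B. min b y) + size B" for B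
    by (induction B) auto
  show "tau n M d (add_mset b lam) \<le> tau n M d (add_mset (Suc b) lam)"
  proof -
    obtain N where N: "subcfg n N M" "tau n M d (add_mset b lam) = tau_val n (add_mset b lam) N d"
      using tau_attained by blast
    note N(2)
    also have "\<dots> \<le> tau_val n (add_mset (Suc b) lam) N d" unfolding d
      by (intro add_left_mono, subst of_nat_le_iff, rule m(1))
    also have "\<dots> \<le> tau n M d (add_mset (Suc b) lam)" using tau_ge N(1) by blast
    finally show ?thesis .
  qed
  obtain N where N: "subcfg n N M" "tau n M d (add_mset (Suc b) lam) = tau_val n (add_mset (Suc b) lam) N d"
    using tau_attained by blast
  note N(2)
  also have "\<dots> \<le> tau_val n (add_mset b lam) N d + int (size (N 1))"
  proof -
    have "int (\<Sum>y\<in>#image_mset fst (N 1). min (Suc b) y) \<le> int (\<Sum>y\<in>#image_mset fst (N 1). min b y) + int (size (N 1))"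
      using m(2)[of "image_mset fst (N 1)"] unfolding size_image_mset by linarith
    then show ?thesis unfolding d by linarith
  qed
  also have "\<dots> \<le> tau n M d (add_mset b lam) + int (size (M 1))"
    using tau_ge[OF N(1)] N(1) assms size_mset_mono[of "N 1" "M 1"] by (intro add_mono) (auto simp: subcfg_def)
  finally show "tau n M d (add_mset (Suc b) lam) \<le> tau n M d (add_mset b lam) + int (size (M 1))" .
qed

lemma tau_incr_le: "e \<le> n + 1 \<Longrightarrow> tau_incr n M lam a e = tq n M e (add_mset a lam) - tq n M e lam"
  by (simp add: tau_incr_def)

lemma tau_gap_le: "1 \<le> e \<Longrightarrow> e \<le> n + 1 \<Longrightarrow> tau_gap n M lam a b e
    = tq n M e (add_mset a (add_mset b lam)) - tq n M e (add_mset a lam)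
      - tq n M (e - 1) (add_mset a lam) + tq n M (e - 1) lam"
  using diff_le_self[of e 1, THEN le_trans, of "n + 1"] by (simp add: tau_gap_def tau_incr_def add_mset_commute)

text \<open>For equal rows the recursion \<open>tau_incr_diff_max\<close> is void; we scale all lengths and riggings
  by \<open>t\<close>, lengthen one of the two rows by 1, and lose only a bounded amount.\<close>

lemma tau_gap_equal_rows:
  assumes wf: "wf_cfg n M" and a: "1 \<le> a"
  shows "\<exists>e\<in>{1..n+1}. int a \<le> tau_gap n M lam a a e"
proof -
  \<comment> \<open>Lengthening a row loses at most \<open>size (M 1) < t\<close>; after division by
    \<open>t\<close> the loss is below 1, and integrality removes it.\<close>
  define t where "t = size (M 1) + 1"
  define M' where "M' = scale t M"
  define L where "L = image_mset ((*) t) lam"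
  have n: "1 \<le> n" using wf by (simp add: wf_cfg_def)
  have "0 < t" by (simp add: t_def)
  then have wf': "wf_cfg n M'" using wf by (fastforce simp: wf_cfg_def M'_def scale_def Suc_le_eq)
  have t: "tq n M' d L = int t * tq n M d lam" "tq n M' d (add_mset (t * a) L) = int t * tq n M d (add_mset a lam)"
    "tq n M' d (add_mset (t * a) (add_mset (t * a) L)) = int t * tq n M d (add_mset a (add_mset a lam))" for d
    using tq_scale[of n t M d lam] tq_scale[of n t M d "add_mset a lam"] tq_scale[of n t M d "add_mset a (add_mset a lam)"]
    by (simp_all add: M'_def L_def)
  define f where "f e = tau_incr n M' L (Suc (t * a)) e - tau_incr n M' L (t * a) e" for e
  have ta: "1 \<le> t * a" using a by (simp add: t_def)
  have "\<exists>e\<in>{0+1..0+(n+1)}. tau_gap n M' L (t * a) (Suc (t * a)) e - int (t * a) = f (0 + (n + 1))"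
  proof (rule conjunct2[OF running_max])
    show "f e = max (f (e - 1)) (tau_gap n M' L (t * a) (Suc (t * a)) e - int (t * a))" if "e \<in> {0+1..0+(n+1)}" for e
      unfolding f_def using tau_incr_diff_max(1)[OF wf' ta, of "Suc (t * a)" e L] that by auto
    show "f 0 < f (0 + (n + 1))"
      using tau_incr_periodic[of 0 n M' L "Suc (t * a)"] tau_incr_periodic[of 0 n M' L "t * a"] by (simp add: f_def)
  qed
  then obtain e where e: "e \<in> {1..n+1}" "tau_gap n M' L (t * a) (Suc (t * a)) e - int (t * a) = f (n + 1)" by auto
  have "0 \<le> f (n + 1)"
    using tau_increase_row(1)[OF n, of M' "n + 1" "t * a" L] by (simp add: f_def tau_incr_le tq_def)
  then have 1: "int (t * a) \<le> tau_gap n M' L (t * a) (Suc (t * a)) e" using e by simp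
  have "size (M' 1) = size (M 1)" by (simp add: M'_def scale_def)
  then have "tq n M' e (add_mset (t * a) (add_mset (Suc (t * a)) L))
      \<le> tq n M' e (add_mset (t * a) (add_mset (t * a) L)) + int (size (M 1))"
    using tau_increase_row(2)[OF n, of M' e "t * a" "add_mset (t * a) L"] e(1)
    by (simp add: tq_def add_mset_commute)
  then have "tau_gap n M' L (t * a) (Suc (t * a)) e \<le> int t * tau_gap n M lam a a e + int (size (M 1))"
    using e(1) by (simp add: tau_gap_le t right_diff_distrib distrib_left)
  then have "int t * (int a - tau_gap n M lam a a e) < int t * 1" using 1 by (simp add: algebra_simps) (simp add: t_def)
  then have "int a - tau_gap n M lam a a e < 1" by (rule mult_left_less_imp_less) simp
  then show ?thesis using e(1) by (intro bexI[of _ e]) auto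
qed

text \<open>Over one period the difference of the two increments changes by \<open>b - a\<close>.
  The recursion therefore runs upwards for \<open>a < b\<close> and downwards for
  \<open>b < a\<close>; for \<open>a = b\<close> the upper bound is the shifted submodular
  inequality, and attainment is \<open>tau_gap_equal_rows\<close>.\<close>

lemma tau_gap_max:
  assumes wf: "wf_cfg n M" and ab: "1 \<le> a" "1 \<le> b" and d: "d \<le> n + 1"
  shows "(\<forall>e\<in>{d+1..d+(n+1)}. tau_gap n M lam a b e \<le> tau_incr n M lam b d - tau_incr n M lam a d + int b)
       \<and> (\<exists>e\<in>{d+1..d+(n+1)}. tau_gap n M lam a b e = tau_incr n M lam b d - tau_incr n M lam a d + int b)"
proof -
  have shift: ?thesis if "(\<forall>e\<in>{d+1..d+(n+1)}. tau_gap n M lam a b e - c \<le> v) \<and> (\<exists>e\<in>{d+1..d+(n+1)}. tau_gap n M lam a b e - c = v)"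
    "v + c = tau_incr n M lam b d - tau_incr n M lam a d + int b" for c v
    unfolding that(2)[symmetric] using that(1) by (metis diff_add_cancel diff_le_eq)
  define f where "f e = tau_incr n M lam b e - tau_incr n M lam a e" for e
  have per: "f (d + (n + 1)) = f d + int b - int a" using tau_incr_periodic[OF d] by (simp add: f_def)
  consider "a < b" | "b < a" | "a = b" by linarith
  then show ?thesis
  proof cases
    case 1
    have "(\<forall>e\<in>{d+1..d+(n+1)}. tau_gap n M lam a b e - int a \<le> f (d + (n + 1)))
        \<and> (\<exists>e\<in>{d+1..d+(n+1)}. tau_gap n M lam a b e - int a = f (d + (n + 1)))"
    proof (rule running_max)
      show "f e = max (f (e - 1)) (tau_gap n M lam a b e - int a)" if "e \<in> {d+1..d+(n+1)}" for e
        unfolding f_def using tau_incr_diff_max(1)[OF wf ab(1) 1, of e lam] that d by auto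
      show "f d < f (d + (n + 1))" using per 1 by simp
    qed
    then show ?thesis by (rule shift) (simp only: per, simp add: f_def)
  next
    case 2
    have "(\<forall>e\<in>{d+1..d+(n+1)}. tau_gap n M lam a b e - int b \<le> f d)
        \<and> (\<exists>e\<in>{d+1..d+(n+1)}. tau_gap n M lam a b e - int b = f d)"
    proof (rule running_max_down)
      show "f (e - 1) = max (f e) (tau_gap n M lam a b e - int b)" if "e \<in> {d+1..d+(n+1)}" for e
        unfolding f_def using tau_incr_diff_max(2)[OF wf ab(2) 2, of e lam] that d by auto
      show "f (d + (n + 1)) < f d" using per 2 by simp
    qed
    then show ?thesis by (rule shift) (simp add: f_def)
  next
    case 3
    have le: "tau_gap n M lam a a e \<le> int a" if "1 \<le> e" "e \<le> n + 1" for e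
      using tq_shifted_meet_join[OF wf that order_refl, of a lam] that by (simp add: tau_gap_le)
    have all: "tau_gap n M lam a a e \<le> int a" if "e \<in> {d+1..d+(n+1)}" for e
    proof (cases "e \<le> n + 1")
      case False
      then show ?thesis using tau_gap_periodic[of "e - (n + 1)" n M lam a a] le[of "e - (n + 1)"] that d by simp
    qed (use le that in auto)
    obtain e where e: "e \<in> {1..n+1}" "int a \<le> tau_gap n M lam a a e" using tau_gap_equal_rows[OF wf ab(1)] by blast
    have "\<exists>e'\<in>{d+1..d+(n+1)}. int a \<le> tau_gap n M lam a a e'"
    proof (cases "e \<le> d")
      case True
      then show ?thesis using e d tau_gap_periodic[of e n M lam a a] by (intro bexI[of _ "e + (n + 1)"]) auto
    next
      case False
      then show ?thesis using e by (intro bexI[of _ e]) auto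
    qed
    then obtain e' where e': "e' \<in> {d+1..d+(n+1)}" "int a \<le> tau_gap n M lam a a e'" ..
    have "tau_gap n M lam a b e' = tau_incr n M lam b d - tau_incr n M lam a d + int b"
      using all[OF e'(1)] e'(2) 3 by simp
    moreover have "\<forall>e\<in>{d+1..d+(n+1)}. tau_gap n M lam a b e \<le> tau_incr n M lam b d - tau_incr n M lam a d + int b"
      using all unfolding 3[symmetric] by simp
    ultimately show ?thesis using e'(1) by blast
  qed
qed

text \<open>After telescoping, the \<open>k\<close>-th candidate in \<open>Qf\<close> is the claimed
  value plus the amount by which the gap at \<open>d + k\<close> stays below its maximum over the
  period; so the minimum is the claimed value.\<close>

lemma Qf_tau_factor:
  assumes wf: "wf_cfg n M" and ab: "1 \<le> a" "1 \<le> b" and d: "d \<le> n + 1"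
  shows "int (Qf n (tau_factor n M lam a) (tau_factor n M (add_mset a lam) b) (int d))
       = tau_incr n M (add_mset a lam) b d - tau_incr n M lam b d"
proof -
  define q where "q = tau_incr n M (add_mset a lam) b d - tau_incr n M lam b d"
  define T where "T k = (\<Sum>j\<in>{1..<k}. comp n (tau_factor n M lam a) (int d + int j))
      + (\<Sum>j\<in>{k<..n+1}. comp n (tau_factor n M (add_mset a lam) b) (int d + int j))" for k
  have T: "int (T k) = q + (tau_incr n M lam b d - tau_incr n M lam a d + int b - tau_gap n M lam a b (d + k))" if "k \<in> {1..n+1}" for k
  proof -
    have "tau_incr n M (add_mset a lam) b (d + n + 1) = tau_incr n M (add_mset a lam) b d + int b"
      using tau_incr_periodic[OF d] by (simp add: add.assoc)
    then show ?thesis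
      using sum_comp_low[OF wf d, of k lam a] sum_comp_high[OF wf d, of k "add_mset a lam" b] that
      by (simp add: T_def q_def tau_gap_def)
  qed
  have ge: "q \<le> int (T k)" if "k \<in> {1..n+1}" for k
    using T[OF that] tau_gap_max[OF wf ab d, of lam] that by auto
  obtain e where e: "e \<in> {d+1..d+(n+1)}" "tau_gap n M lam a b e = tau_incr n M lam b d - tau_incr n M lam a d + int b"
    using tau_gap_max[OF wf ab d, of lam] by blast
  define k where "k = e - d"
  have k: "k \<in> {1..n+1}" "e = d + k" using e(1) by (auto simp: k_def)
  have eq: "int (T k) = q" using T[OF k(1)] e(2) k(2) by simp
  have "Qf n (tau_factor n M lam a) (tau_factor n M (add_mset a lam) b) (int d) = Min (T ` {1..n+1})"
    by (simp add: Qf_def T_def)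
  also have "\<dots> = T k"
  proof (rule Min_eqI)
    show "T k \<le> y" if "y \<in> T ` {1..n+1}" for y using that ge eq by force
  qed (use k in auto)
  finally show ?thesis using eq q_def by simp
qed

lemma Rmap_tau_factor:
  assumes wf: "wf_cfg n M" and ab: "1 \<le> a" "1 \<le> b"
  shows "Rmap n (tau_factor n M lam a) (tau_factor n M (add_mset a lam) b) = (tau_factor n M lam b, tau_factor n M (add_mset b lam) a)"
proof -
  let ?x = "tau_factor n M lam a" and ?y = "tau_factor n M (add_mset a lam) b"
  have Q: "int (Qf n ?x ?y (int d)) = tau_incr n M (add_mset a lam) b d - tau_incr n M lam b d" if "d \<le> n + 1" for d
    using Qf_tau_factor[OF wf ab that] .
  have up: "[1..int n + 1] = map (\<lambda>d. int d) [1..<n+2]"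
    by (rule nth_equalityI) (auto simp: nth_upto simp del: upt_Suc)
  have nt: "nat (int (comp n ?y (int d)) + int (Qf n ?x ?y (int d - 1)) - int (Qf n ?x ?y (int d)))
      = nat (tau_letter n M lam b d)" if "d \<in> set [1..<n+2]" for d
  proof -
    have d: "1 \<le> d" "d \<le> n + 1" "int d - 1 = int (d - 1)" using that by auto
    show ?thesis unfolding d(3)
      using comp_tau_factor[OF wf d(1), of "add_mset a lam" b] Q[of d] Q[of "d - 1"] d(1,2) tau_incr_le[of "d - 1" n M]
      by (simp add: tau_incr_le tau_letter_def)
  qed
  have nt2: "nat (int (comp n ?x (int d)) + int (Qf n ?x ?y (int d)) - int (Qf n ?x ?y (int d - 1)))
      = nat (tau_letter n M (add_mset b lam) a d)" if "d \<in> set [1..<n+2]" for d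
  proof -
    have d: "1 \<le> d" "d \<le> n + 1" "int d - 1 = int (d - 1)" using that by auto
    show ?thesis unfolding d(3)
      using comp_tau_factor[OF wf d(1), of lam a] Q[of d] Q[of "d - 1"] d(1,2) tau_incr_le[of "d - 1" n M]
      by (simp add: tau_incr_le tau_letter_def add_mset_commute)
  qed
  show ?thesis unfolding Rmap_def up map_map tau_factor_def[of n M lam b] tau_factor_def[of n M "add_mset b lam" a]
    prod.inject map_eq_conv o_apply
    using nt nt2 by blast
qed

section \<open>Box-ball evolution and energy\<close>

definition shift :: "nat \<Rightarrow> rc \<Rightarrow> rc" where
  "shift t M = (\<lambda>a. image_mset (\<lambda>x. (fst x, snd x + (if a = 1 then int (t * fst x) else 0))) (M a))"

lemma shift_0 [simp]: "shift 0 M = M"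
  by (rule ext) (simp add: shift_def cong: if_cong)

lemma shift_Suc: "shift (Suc t) M = shift 1 (shift t M)"
  by (auto simp: shift_def multiset.map_comp o_def intro!: ext image_mset_cong)

lemma wf_shift: "wf_cfg n M \<Longrightarrow> wf_cfg n (shift t M)"
  by (auto simp: wf_cfg_def shift_def)

lemma rig_shift:
  assumes "1 \<le> n"
  shows "rig n (shift t N) = rig n N + int t * int (sum_mset (image_mset fst (N 1)))"
proof -
  have "(\<Sum>x\<in>#shift t N a. snd x) = (\<Sum>x\<in>#N a. snd x) + (if a = 1 then int t * int (sum_mset (image_mset fst (N 1))) else 0)" for a
  proof -
    have "(\<Sum>x\<in>#A. snd x + int (t * fst x)) = (\<Sum>x\<in>#A. snd x) + int t * int (sum_mset (image_mset fst A))"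
      for A :: "(nat \<times> int) multiset"
      by (induction A) (auto simp: distrib_left)
    then show ?thesis by (simp add: shift_def multiset.map_comp o_def)
  qed
  then show ?thesis using assms unfolding rig_def by (simp add: sum.distrib del: One_nat_def)
qed

lemma tau_val_rig:
  "tau_val n lam N d = tau_val n lam (\<lambda>a. image_mset (\<lambda>x. (fst x, 0)) (N a)) d - rig n N"
  by (simp add: tau_val_def rig_def multiset.map_comp o_def)

lemma tau_val_shift:
  assumes "1 \<le> n"
  shows "tau_val n lam (shift t N) d = tau_val n lam N d - int t * int (sum_mset (image_mset fst (N 1)))"
proof -
  have "image_mset (\<lambda>x. (fst x, 0::int)) (shift t N a) = image_mset (\<lambda>x. (fst x, 0)) (N a)" for a
    by (simp add: shift_def multiset.map_comp o_def)
  then show ?thesis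
    using tau_val_rig[of n lam "shift t N" d] tau_val_rig[of n lam N d] rig_shift[OF assms, of t N] by simp
qed

text \<open>For \<open>d = 1\<close> the value contains the penalty given by the total length chosen
  in level 1; \<open>shift 1\<close> charges the same amount through the riggings.\<close>

lemma tau_shift_last:
  assumes "1 \<le> n"
  shows "tau n (shift 1 M) (n + 1) lam = tau n M 1 lam"
  unfolding shift_def
proof (rule tau_map_rows[where F = id, simplified id_apply])
  fix N
  show "tau_val n lam (\<lambda>a. image_mset (\<lambda>x. (fst x, snd x + (if a = 1 then int (1 * fst x) else 0))) (N a)) (n + 1)
      = tau_val n lam N 1"
    using tau_val_shift[OF assms, of lam 1 N "n + 1"] assms
    unfolding shift_def by (simp add: tau_val_def)
qed (simp add: mono_def)

text \<open>A row at least as long as all rows of level 1 couples to a choice with exactly its total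
  length there, which cancels the extra riggings.\<close>

lemma tau_shift_big_row:
  assumes "1 \<le> n" "\<forall>x\<in>#M 1. fst x \<le> K"
  shows "tau n (shift 1 M) d (add_mset K lam) = tau n M d lam"
  unfolding shift_def
proof (rule tau_map_rows[where F = id, simplified id_apply])
  fix N assume N: "subcfg n N M"
  have "\<forall>x\<in>#N 1. fst x \<le> K" using N assms unfolding subcfg_def by (meson atLeastAtMost_iff mset_subset_eqD order_refl)
  then have "(\<Sum>y\<in>#image_mset fst (N 1). min K y) = sum_mset (image_mset fst (N 1))"
    by (induction "N 1" arbitrary: N rule: multiset_induct) (auto simp: multiset.map_comp o_def intro!: arg_cong[where f=sum_mset] image_mset_cong)
  then show "tau_val n (add_mset K lam) (\<lambda>a. image_mset (\<lambda>x. (fst x, snd x + (if a = 1 then int (1 * fst x) else 0))) (N a)) d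
      = tau_val n lam N d"
    using tau_val_shift[OF assms(1), of "add_mset K lam" 1 N d]
    unfolding shift_def tau_val_def mmin_add by simp
qed (simp add: mono_def)

definition pos_cfg :: "nat \<Rightarrow> rc \<Rightarrow> bool" where
  "pos_cfg n M \<longleftrightarrow> wf_cfg n M \<and> (\<forall>a\<in>{1..n}. \<forall>x\<in>#M a. 0 \<le> snd x)"

lemma pos_shift: "pos_cfg n M \<Longrightarrow> pos_cfg n (shift t M)"
  unfolding pos_cfg_def
proof (intro conjI ballI; elim conjE)
  fix a x assume M: "\<forall>a\<in>{1..n}. \<forall>x\<in>#M a. 0 \<le> snd x" and x: "a \<in> {1..n}" "x \<in># shift t M a"
  obtain y where "y \<in># M a" "x = (fst y, snd y + (if a = 1 then int (t * fst y) else 0))"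
    using x(2) unfolding shift_def by auto
  moreover from this have "0 \<le> snd y" using M x(1) by blast
  ultimately show "0 \<le> snd x" by simp
qed (rule wf_shift)

text \<open>Of the sum of squares in \<open>qform_squares\<close> only the first is kept.\<close>

lemma qform_lower:
  assumes "1 \<le> n" "h (n + 1) = 0" "0 \<le> h 0" "0 \<le> h 1" "h 0 \<le> c"
  shows "0 \<le> qform n h + c * h 1"
proof -
  have "(h 0 - h (0 + 1)) ^ 2 \<le> (\<Sum>a\<in>{0..n}. (h a - h (a + 1)) ^ 2)"
    by (rule member_le_sum) auto
  then have 1: "(h 0 - h 1) ^ 2 - (h 0) ^ 2 + 2 * (c * h 1) \<le> 2 * (qform n h + c * h 1)"
    unfolding qform_squares[of h n, OF assms(2)] by simp
  have "(h 0 - h 1) ^ 2 - (h 0) ^ 2 + 2 * (c * h 1) = (h 1) ^ 2 + 2 * ((c - h 0) * h 1)"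
    by (simp add: power2_eq_square algebra_simps)
  also have "\<dots> \<ge> 0" using assms by (intro add_nonneg_nonneg mult_nonneg_nonneg) auto
  finally have "0 \<le> 2 * (qform n h + c * h 1)" using 1 by (rule order_trans)
  then show ?thesis by simp
qed

lemma sum_mset_ge_zero:
  fixes f :: "'a \<Rightarrow> int"
  shows "(\<And>x. x \<in># A \<Longrightarrow> 0 \<le> f x) \<Longrightarrow> 0 \<le> (\<Sum>x\<in>#A. f x)"
  by (induction A) auto

lemma ge_le_size: "ge A l \<le> int (size A)"
  by (simp add: ge_def)

text \<open>After \<open>t\<close> shifts each row of level 1 costs at least \<open>t\<close> times
  its length, which outweighs the coupling to at most \<open>t\<close> rows of \<open>lam\<close>;
  for \<open>d = 1\<close> the linear term acts as one more shift. So the empty choice is optimal.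
  This makes the sum in \<open>rho\<close> finite, and with \<open>t = 0\<close> it gives the
  initial values of \<open>tau\<close>.\<close>

lemma tau_shift_zero:
  assumes "pos_cfg n M" "1 \<le> d" "d \<le> n + 1" "size lam \<le> t + of_bool (d = 1)"
  shows "tau n (shift t M) d lam = 0"
proof -
  have wf: "wf_cfg n M" and n: "1 \<le> n" using assms by (auto simp: pos_cfg_def wf_cfg_def)
  have tm: "tau n (shift t M) d lam \<le> 0"
  proof -
    obtain N' where N': "subcfg n N' (shift t M)" "tau n (shift t M) d lam = tau_val n lam N' d"
      using tau_attained by blast
    obtain K where K: "bounded n K (shift t M)" "\<forall>x\<in>#lam. x \<le> K"
      using ex_bound[OF wf_shift[OF wf], of t lam 0] by blast
    have N'b: "bounded n K N'" "N' (n + 1) = {#}" using bounded_sub[OF K(1) N'(1)] N'(1) by (auto simp: subcfg_def)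
    have h0: "hgt lam N' 0 l = ge lam l" for l by (simp add: lens_def)
    have rg: "int t * (\<Sum>l\<in>{1..K}. hgt lam N' 1 l) \<le> rig n N'"
    proof -
      have 1: "int t * int (fst x) \<le> snd x" if "x \<in># N' 1" for x
      proof -
        have "x \<in># shift t M 1" using that N'(1) n unfolding subcfg_def
          by (meson atLeastAtMost_iff mset_subset_eqD order_refl)
        then obtain y where "y \<in># M 1" "x = (fst y, snd y + int (t * fst y))"
          unfolding shift_def by auto
        moreover from this have "0 \<le> snd y" using assms(1) n unfolding pos_cfg_def by force
        ultimately show ?thesis by simp
      qed
      have 0: "0 \<le> snd x" if "x \<in># N' a" "a \<in> {1..n}" for a x
        using that N'(1) pos_shift[OF assms(1), of t] unfolding subcfg_def pos_cfg_def
        by (meson mset_subset_eqD)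
      have "int t * (\<Sum>l\<in>{1..K}. hgt lam N' 1 l) = int t * int (sum_mset (image_mset fst (N' 1)))"
        using N'b n by (subst sum_ge) (auto simp: lens_def bounded_def)
      also have "\<dots> = (\<Sum>x\<in>#N' 1. int t * int (fst x))"
        by (simp add: sum_mset_distrib_left multiset.map_comp o_def)
      also have "\<dots> \<le> (\<Sum>x\<in>#N' 1. snd x)" using 1 by (rule sum_mset_mono)
      also have "\<dots> \<le> rig n N'" unfolding rig_def
        using n 0 by (intro member_le_sum) (auto intro!: sum_mset_ge_zero)
      finally show ?thesis .
    qed
    have "0 \<le> qform n (\<lambda>a. hgt lam N' a l) + (int t + of_bool (d = 1)) * hgt lam N' 1 l" for l
      using assms(4) ge_le_size[of lam l] N'b(2) n
      by (intro qform_lower) (auto simp: lens_def)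
    then have "0 \<le> (\<Sum>l\<in>{1..K}. qform n (\<lambda>a. hgt lam N' a l) + (int t + of_bool (d = 1)) * hgt lam N' 1 l)"
      by (intro sum_nonneg)
    also have "\<dots> = (\<Sum>l\<in>{1..K}. qform n (\<lambda>a. hgt lam N' a l)) + int t * (\<Sum>l\<in>{1..K}. hgt lam N' 1 l)
        + of_bool (d = 1) * (\<Sum>l\<in>{1..K}. hgt lam N' 1 l)"
      by (simp add: sum.distrib distrib_right sum_distrib_left del: One_nat_def)
    also have "of_bool (d = 1) * (\<Sum>l\<in>{1..K}. hgt lam N' 1 l) \<le> (\<Sum>l\<in>{1..K}. hgt lam N' d l)"
      by (cases "d = 1") (auto intro: sum_nonneg)
    finally have "tau_hgt_val n K d lam N' \<le> 0" using rg unfolding tau_hgt_val_def sum.distrib by linarith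
    then show ?thesis using N'(2) tau_val_tau_hgt_val[OF n assms(2,3) N'b K(2)] by simp
  qed
  moreover have "0 \<le> tau n (shift t M) d lam"
  proof -
    have "tau_val n lam (\<lambda>_. {#}) d = 0" by (simp add: tau_val_def mmin_def)
    then show ?thesis using tau_ge[of n "\<lambda>_. {#}" "shift t M" lam d] by (simp add: subcfg_def)
  qed
  ultimately show ?thesis by simp
qed

lemma tq_empty: "pos_cfg n M \<Longrightarrow> d \<le> n + 1 \<Longrightarrow> tq n M d {#} = 0"
  using tau_shift_zero[of n M "n + 1" "{#}" 0] tau_shift_zero[of n M d "{#}" 0]
  by (cases "d = 0") (auto simp: tq_def)

lemma tau_1_single: "pos_cfg n M \<Longrightarrow> tau n M 1 {#b#} = 0"
  using tau_shift_zero[of n M 1 "{#b#}" 0] by simp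

section \<open>Sequences of factors and their time evolution\<close>

fun tau_path :: "nat \<Rightarrow> rc \<Rightarrow> nat multiset \<Rightarrow> nat list \<Rightarrow> nat list list" where
  "tau_path n M lam [] = []"
| "tau_path n M lam (a # as) = tau_factor n M lam a # tau_path n M (add_mset a lam) as"

lemma tau_path_length [simp]: "length (tau_path n M lam as) = length as"
  by (induction as arbitrary: lam) auto

lemma tau_path_take: "take j (tau_path n M lam as) = tau_path n M lam (take j as)"
  by (induction as arbitrary: lam j) (auto simp: take_Cons split: nat.split)

lemma tau_path_drop: "drop j (tau_path n M lam as) = tau_path n M (lam + mset (take j as)) (drop j as)"
  by (induction as arbitrary: lam j) (auto simp: drop_Cons split: nat.split)

lemma tau_path_nth: "j < length as \<Longrightarrow> tau_path n M lam as ! j = tau_factor n M (lam + mset (take j as)) (as ! j)"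
  by (induction as arbitrary: lam j) (auto simp: nth_Cons split: nat.split)

lemma tau_path_append: "tau_path n M lam (as @ bs) = tau_path n M lam as @ tau_path n M (lam + mset as) bs"
  by (induction as arbitrary: lam) auto

text \<open>The carrier is the factor of a row \<open>N\<close> standing in front of all others;
  each R moves this row one place to the right.\<close>

lemma Tl_aux_tau_path:
  assumes "wf_cfg n M" "1 \<le> N" "\<forall>a\<in>set as. 1 \<le> a"
  shows "Tl_aux n (tau_factor n M lam N) (tau_path n M (add_mset N lam) as) = tau_path n M lam as"
  using assms(3)
proof (induction as arbitrary: lam)
  case (Cons a as)
  have "Rmap n (tau_factor n M lam N) (tau_factor n M (add_mset N lam) a) = (tau_factor n M lam a, tau_factor n M (add_mset a lam) N)"
    using assms Cons by (intro Rmap_tau_factor) auto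
  moreover have "Tl_aux n (tau_factor n M (add_mset a lam) N) (tau_path n M (add_mset N (add_mset a lam)) as) = tau_path n M (add_mset a lam) as"
    using Cons by simp
  ultimately show ?case by (simp add: add_mset_commute)
qed simp

lemma tq_shift_big_row:
  assumes "1 \<le> n" "\<forall>x\<in>#M 1. fst x \<le> K"
  shows "tq n (shift 1 M) d (add_mset K lam) = tq n M d lam - (if d = 0 then int K else 0)"
  unfolding tq_def tau_shift_big_row[of n M K, OF assms] by simp

lemma tau_factor_shift_big_row:
  assumes "1 \<le> n" "\<forall>x\<in>#M 1. fst x \<le> K"
  shows "tau_factor n (shift 1 M) (add_mset K lam) a = tau_factor n M lam a"
proof -
  have "tau_letter n (shift 1 M) (add_mset K lam) a d = tau_letter n M lam a d" for d
    unfolding tau_letter_def add_mset_commute[of a K] tq_shift_big_row[of n M K, OF assms] by simp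
  then show ?thesis by (simp add: tau_factor_def)
qed

lemma tau_path_shift_big_row:
  assumes "1 \<le> n" "\<forall>x\<in>#M 1. fst x \<le> K"
  shows "tau_path n (shift 1 M) (add_mset K lam) as = tau_path n M lam as"
proof (induction as arbitrary: lam)
  case (Cons a as)
  show ?case using Cons[of "add_mset a lam"] tau_factor_shift_big_row[of n M K, OF assms]
    by (simp add: add_mset_commute)
qed simp

text \<open>All relevant values of \<open>tq\<close> are 0 except at \<open>d = 0\<close>, where the
  continuation subtracts the total length \<open>K\<close>; hence only the letter 1 occurs.\<close>

lemma tau_factor_shift_uvec:
  assumes "pos_cfg n M" "\<forall>x\<in>#M 1. fst x \<le> K"
  shows "tau_factor n (shift 1 M) {#} K = uvec n K"
proof -
  have n: "1 \<le> n" using assms by (simp add: pos_cfg_def wf_cfg_def)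
  have "tau_letter n (shift 1 M) {#} K d = (if d = 1 then int K else 0)" if "1 \<le> d" "d \<le> n + 1" for d
    unfolding tau_letter_def tq_shift_big_row[of n M K, OF n assms(2)]
    using that tq_empty[OF assms(1), of d] tq_empty[OF assms(1), of "d - 1"]
      tq_empty[OF pos_shift[OF assms(1)], of d 1] tq_empty[OF pos_shift[OF assms(1)], of "d - 1" 1]
    by (cases "d = 1") simp_all
  then have "tau_factor n (shift 1 M) {#} K ! j = uvec n K ! j" if "j < n + 1" for j
    using that unfolding tau_factor_def by (subst nth_map) (auto simp: uvec_def nth_Cons split: nat.split simp del: upt_Suc)
  then show ?thesis by (intro nth_equalityI) (simp_all add: uvec_def)
qed

lemma Tinf_tau_path:
  assumes "pos_cfg n M" "\<forall>a\<in>set as. 1 \<le> a"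
  shows "Tinf n (tau_path n M {#} as) = tau_path n (shift 1 M) {#} as"
proof -
  have wf: "wf_cfg n M" and n: "1 \<le> n" using assms by (auto simp: pos_cfg_def wf_cfg_def)
  obtain K where K: "bounded n K M" using ex_bound[OF wf] by blast
  \<comment> \<open>With a long row \<open>N\<close> in front, the shifted configuration gives the
    carrier \<open>u_N\<close> followed by the factors of \<open>M\<close>; with the carrier moved
    past them, the factors of \<open>shift 1 M\<close> remain. The 1 in \<open>K + 1\<close> keeps
    the row \<open>N\<close> positive.\<close>
  have "Tl n N (tau_path n M {#} as) = tau_path n (shift 1 M) {#} as" if "K + 1 \<le> N" for N
  proof -
    have N: "\<forall>x\<in>#M 1. fst x \<le> N"
    proof
      fix x assume x: "x \<in># M 1"
      have "1 \<in> {1..n}" using n by simp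
      from K[unfolded bounded_def, rule_format, OF this x] show "fst x \<le> N" using that by simp
    qed
    have "1 \<le> N" using that by simp
    from Tl_aux_tau_path[OF wf_shift[OF wf] this assms(2), of 1 "{#}"] show ?thesis
      unfolding tau_factor_shift_uvec[OF assms(1) N] tau_path_shift_big_row[of n M N, OF n N] Tl_def .
  qed
  then have ev: "\<forall>\<^sub>F N in sequentially. Tl n N (tau_path n M {#} as) = tau_path n (shift 1 M) {#} as"
    unfolding eventually_sequentially by blast
  show ?thesis unfolding Tinf_def
  proof (rule the_equality[where a = "tau_path n (shift 1 M) {#} as"])
    fix q assume "\<forall>\<^sub>F l in sequentially. Tl n l (tau_path n M {#} as) = q"
    from eventually_happens[OF eventually_conj[OF this ev]]
    obtain N where "Tl n N (tau_path n M {#} as) = q \<and> Tl n N (tau_path n M {#} as) = tau_path n (shift 1 M) {#} as"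
      by auto
    then show "q = tau_path n (shift 1 M) {#} as" by (elim conjE) (erule trans[OF sym])
  qed (rule ev)
qed

lemma Tinf_pow_tau_path:
  assumes "pos_cfg n M" "\<forall>a\<in>set as. 1 \<le> a"
  shows "(Tinf n ^^ t) (tau_path n M {#} as) = tau_path n (shift t M) {#} as"
proof (induction t)
  case (Suc t)
  then show ?case using Tinf_tau_path[OF pos_shift[OF assms(1)] assms(2), of t]
    unfolding shift_Suc[of t] by simp
qed simp

lemma sum_tau_factor:
  assumes "wf_cfg n M" "1 \<le> d" "d \<le> n + 1"
  shows "int (\<Sum>c\<in>{1..<d}. tau_factor n M lam a ! c) = (tq n M d (add_mset a lam) - tq n M 1 (add_mset a lam))
     - (tq n M d lam - tq n M 1 lam)"
  using assms(2,3)
proof (induction d rule: dec_induct)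
  case (step d)
  then show ?case using tau_factor_nth[OF assms(1), of d lam a]
    by (simp add: sum.atLeastLessThan_Suc tau_letter_def)
qed simp

lemma sum_tau_path:
  assumes "pos_cfg n M" "1 \<le> d" "d \<le> n + 1" "k \<le> length as"
  shows "int (\<Sum>j<k. \<Sum>c\<in>{1..<d}. tau_path n M {#} as ! j ! c)
      = tau n M d (mset (take k as)) - tau n M 1 (mset (take k as))"
  using assms(4)
proof (induction k)
  case 0
  then show ?case using tq_empty[OF assms(1), of d] tq_empty[OF assms(1), of 1] assms by (simp add: tq_def)
next
  case (Suc k)
  have "mset (take (Suc k) as) = add_mset (as ! k) (mset (take k as))"
    using Suc.prems by (simp add: take_Suc_conv_app_nth)
  then show ?case
    using Suc sum_tau_factor[OF _ assms(2,3), of M "mset (take k as)" "as ! k"] assms tau_path_nth[of k as n M "{#}"]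
    by (simp add: pos_cfg_def tq_def)
qed

text \<open>At time \<open>t\<close> the count \<open>rho_t\<close> is \<open>tau\<close> at
  \<open>n + 1\<close> minus \<open>tau\<close> at 1, and the latter is \<open>tau\<close> at
  \<open>n + 1\<close> at time \<open>t + 1\<close>. The sum over time telescopes to
  \<open>tau\<close> at 1, to which the time 0 part adds \<open>tau\<close> at \<open>d\<close>
  minus \<open>tau\<close> at 1.\<close>

lemma rho_tau_path:
  assumes "pos_cfg n M" "\<forall>a\<in>set as. 1 \<le> a" "1 \<le> d" "d \<le> n + 1" "k \<le> length as"
  shows "int (rho n k d (tau_path n M {#} as)) = tau n M d (mset (take k as))"
proof -
  let ?p = "tau_path n M {#} as" and ?lam = "mset (take k as)"
  have n: "1 \<le> n" using assms by (simp add: pos_cfg_def wf_cfg_def)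
  define S where "S t = tau n (shift t M) (n + 1) ?lam" for t
  have r: "int (rho_t n k ?p t) = S t - S (Suc t)" for t
  proof -
    have "{1..n} = {1..<n + 1}" by auto
    then show ?thesis
      using sum_tau_path[OF pos_shift[OF assms(1)], of "n + 1" k as t] assms n
        tau_shift_last[OF n, of "shift t M" ?lam]
      unfolding rho_t_def Tinf_pow_tau_path[OF assms(1,2)] S_def shift_Suc by simp
  qed
  have S0: "S t = 0" if "k \<le> t" for t
    unfolding S_def using tau_shift_zero[OF assms(1), of "n + 1" ?lam t] that assms(5) by simp
  have z: "rho_t n k ?p t = 0" if "k \<le> t" for t using r[of t] S0[of t] S0[of "Suc t"] that by simp
  have "{t. 1 \<le> t \<and> rho_t n k ?p t \<noteq> 0} \<subseteq> {1..<k + 1}"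
  proof
    fix t assume "t \<in> {t. 1 \<le> t \<and> rho_t n k ?p t \<noteq> 0}"
    then show "t \<in> {1..<k + 1}" using z[of t] by (cases "k \<le> t") auto
  qed
  then have "(\<Sum>t\<in>{t. 1 \<le> t \<and> rho_t n k ?p t \<noteq> 0}. rho_t n k ?p t) = (\<Sum>t\<in>{1..<k+1}. rho_t n k ?p t)"
    by (intro sum.mono_neutral_left) auto
  also have "int \<dots> = (\<Sum>t\<in>{1..<k+1}. S t - S (Suc t))" by (simp add: r)
  also have "\<dots> = S 1 - S (k + 1)" using sum_Suc_diff'[of 1 "k + 1" "\<lambda>t. - S t"] by simp
  also have "\<dots> = tau n M 1 ?lam" using S0[of "k + 1"] tau_shift_last[OF n, of M ?lam] by (simp add: S_def)
  finally show ?thesis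
    using sum_tau_path[OF assms(1,3-5)] unfolding rho_def by simp
qed

section \<open>The energy\<close>

lemma carry_tau_path:
  assumes "wf_cfg n M" "\<forall>a\<in>set as. 1 \<le> a" "1 \<le> b"
  shows "carry n (tau_path n M lam as) (tau_factor n M (lam + mset as) b) = tau_factor n M lam b"
  using assms(2)
proof (induction as arbitrary: lam)
  case (Cons a as)
  have "carry n (tau_path n M (add_mset a lam) as) (tau_factor n M (lam + mset (a # as)) b) = tau_factor n M (add_mset a lam) b"
    using Cons.IH[of "add_mset a lam"] Cons.prems by simp
  then show ?case using Rmap_tau_factor[OF assms(1) _ assms(3), of a lam] Cons.prems by (simp add: carry_def)
qed (simp add: carry_def)

lemma sum_list_tau_factor:
  assumes "wf_cfg n M"
  shows "sum_list (tau_factor n M lam a) = a"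
proof -
  have 0: "int (tau_factor n M lam a ! 0) = tau_letter n M lam a 1" using tau_factor_nth[OF assms, of 0 lam a] by simp
  have "sum_list (tau_factor n M lam a) = (\<Sum>c\<in>{0..<n+1}. tau_factor n M lam a ! c)"
    by (simp add: sum_list_sum_nth)
  also have "{0..<n+1} = insert 0 {1..<n+1}" by auto
  also have "int (\<Sum>c\<in>insert 0 {1..<n+1}. tau_factor n M lam a ! c) = tau_letter n M lam a 1 + int (\<Sum>c\<in>{1..<n+1}. tau_factor n M lam a ! c)"
    using 0 by simp
  also have "\<dots> = int a"
    using sum_tau_factor[OF assms, of "n + 1" lam a] tq_quasi_periodic[of n M lam] tq_quasi_periodic[of n M "add_mset a lam"]
    by (simp add: tau_letter_def)
  finally show ?thesis by simp
qed

lemma comp_uvec: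
  assumes "1 \<le> e" "e \<le> n + 2"
  shows "comp n (uvec n N) (int e) = (if e = 1 \<or> e = n + 2 then N else 0)"
proof (cases "e = n + 2")
  case True
  have "(int e - 1) mod int (n + 1) = 0" unfolding True by simp
  then show ?thesis using True by (simp add: comp_def uvec_def)
next
  case False
  then have "(int e - 1) mod int (n + 1) = int (e - 1)" using assms by (subst mod_pos_pos_trivial) auto
  then have "comp n (uvec n N) (int e) = uvec n N ! (e - 1)" unfolding comp_def by (simp only: nat_int)
  then show ?thesis using False assms by (auto simp: uvec_def nth_Cons split: nat.split)
qed

lemma Qf_uvec:
  assumes pos: "pos_cfg n M" and i: "1 \<le> i" "i \<le> n + 1" and b: "b \<le> N"
  shows "int (Qf n (uvec n N) (tau_factor n M {#} b) (int i)) = tau n M i {#b#}"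
proof -
  have wf: "wf_cfg n M" using pos by (simp add: pos_cfg_def)
  define y where "y = tau_factor n M {#} b"
  define U where "U k = (\<Sum>j\<in>{k<..n+1}. comp n y (int i + int j))" for k
  define L where "L k = (\<Sum>j\<in>{1..<k}. comp n (uvec n N) (int i + int j))" for k
  \<comment> \<open>The minimum is attained where \<open>i + k\<close> is 1 modulo
    \<open>n + 1\<close>: up to there only zeros of \<open>u_N\<close> are summed, and any later
    candidate contains the letter count \<open>N \<ge> b\<close>.\<close>
  define k where "k = n + 2 - i"
  have k: "k \<in> {1..n+1}" "i + k = n + 2" using i by (auto simp: k_def)
  have f: "tau_incr n M {#} b i = tau n M i {#b#}"
    using i tq_empty[OF pos, of i] by (simp add: tau_incr_def tq_def)
  have f1: "tau_incr n M {#} b 1 = 0"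
    using i tq_empty[OF pos, of 1] tau_1_single[OF pos, of b] by (simp add: tau_incr_def tq_def)
  have hi: "int (U k') = tau n M i {#b#} + int b - tau_incr n M {#} b (i + k')" if "k' \<le> n + 1" for k'
    using sum_comp_high[OF wf i(2) that, of "{#}" b] tau_incr_periodic[OF i(2), of M "{#}" b] f
    by (simp add: U_def y_def add.assoc)
  have Uk: "int (U k) = tau n M i {#b#}"
    using hi[of k] k tau_incr_periodic[of 1 n M "{#}" b] f1 by simp
  have Umono: "U k'' \<le> U k'" if "k' \<le> k''" for k' k''
    unfolding U_def using that by (intro sum_mono2) auto
  have Ub: "int (U 0) = int b" using hi[of 0] f by simp
  have Lk: "L k = 0" unfolding L_def
  proof (rule sum.neutral, intro ballI)
    fix j assume "j \<in> {1..<k}"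
    then show "comp n (uvec n N) (int i + int j) = 0" using comp_uvec[of "i + j" n N] i k by auto
  qed
  have "Qf n (uvec n N) y (int i) = Min ((\<lambda>k. L k + U k) ` {1..n+1})"
    by (simp add: Qf_def L_def U_def)
  also have "\<dots> = U k"
  proof (rule Min_eqI)
    show "U k \<in> (\<lambda>k. L k + U k) ` {1..n+1}" using k Lk by force
    fix v assume "v \<in> (\<lambda>k. L k + U k) ` {1..n+1}"
    then obtain k' where k': "k' \<in> {1..n+1}" "v = L k' + U k'" by blast
    show "U k \<le> v"
    proof (cases "k' \<le> k")
      case True
      then show ?thesis using Umono[of k' k] k'(2) by simp
    next
      case False
      have "comp n (uvec n N) (int i + int k) \<le> L k'" unfolding L_def
        using False k by (intro member_le_sum) auto
      moreover have "int i + int k = int (n + 2)" using k(2) by linarith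
      ultimately have "N \<le> L k'" using comp_uvec[of "n + 2" n N] by (simp only:) simp
      moreover have "U k \<le> b" using Umono[of 0 k] Ub by simp
      ultimately show ?thesis using b k'(2) by simp
    qed
  qed simp
  finally show ?thesis using Uk by (simp add: y_def)
qed

text \<open>Each \<open>Q\<close> is the change in the increment due to row \<open>m\<close> when
  row \<open>j\<close> is added to the preceding rows. Summing over \<open>j\<close> telescopes down
  to the increment over the empty multiset, which the contribution of \<open>u_N\<close> supplies;
  summing over \<open>m\<close> telescopes again.\<close>

lemma Energy_tau_path:
  assumes pos: "pos_cfg n M" and as: "\<forall>a\<in>set as. 1 \<le> a" "as \<noteq> []" and i: "1 \<le> i" "i \<le> n + 1"
  shows "int (Energy n (int i) (tau_path n M {#} as)) = tau n M i (mset as)"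
proof -
  have wf: "wf_cfg n M" using pos by (simp add: pos_cfg_def)
  let ?p = "tau_path n M {#} as" and ?k = "length as"
  define N where "N = Max (set (map sum_list ?p))"
  define lam where "lam m = mset (take m as)" for m
  have lamS: "lam (Suc m) = add_mset (as ! m) (lam m)" if "m < ?k" for m
    using that by (simp add: lam_def take_Suc_conv_app_nth)
  have pn: "?p ! m = tau_factor n M (lam m) (as ! m)" if "m < ?k" for m
    using that by (simp add: tau_path_nth lam_def)
  have bN: "as ! m \<le> N" if "m < ?k" for m
  proof -
    have "sum_list (?p ! m) \<in> set (map sum_list ?p)" using that by simp
    then have "sum_list (?p ! m) \<le> N" unfolding N_def by (intro Max_ge) auto
    then show ?thesis using pn[OF that] sum_list_tau_factor[OF wf] by simp
  qed
  have a1: "1 \<le> as ! m" if "m < ?k" for m using as that by simp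
  have car: "carry n (take (m - j) (drop j ?p)) (?p ! m) = tau_factor n M (lam j) (as ! m)" if "j \<le> m" "m < ?k" for j m
  proof -
    have "take (m - j) (drop j ?p) = tau_path n M (lam j) (take (m - j) (drop j as))"
      by (simp add: tau_path_take tau_path_drop lam_def)
    moreover have "lam m = lam j + mset (take (m - j) (drop j as))"
      using take_add[of j "m - j" as] that unfolding lam_def by simp
    moreover have "\<forall>a\<in>set (take (m - j) (drop j as)). 1 \<le> a"
      using as(1) by (meson in_set_takeD in_set_dropD)
    ultimately show ?thesis
      using carry_tau_path[OF wf, of "take (m - j) (drop j as)" "as ! m" "lam j"] a1[OF that(2)] pn[OF that(2)]
      by (simp only:)
  qed
  define A where "A m = Qf n (uvec n N) (carry n (take m ?p) (?p ! m)) (int i)" for m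
  define B where "B m = (\<Sum>j<m. Qf n (?p ! j) (carry n (take (m - Suc j) (drop (Suc j) ?p)) (?p ! m)) (int i))" for m
  have inner: "int (B m) = tau n M i (lam (Suc m)) - tau n M i (lam m) - tau n M i {#as ! m#}" if m: "m < ?k" for m
  proof -
    define b where "b = as ! m"
    have "int (\<Sum>j<m'. Qf n (?p ! j) (carry n (take (m - Suc j) (drop (Suc j) ?p)) (?p ! m)) (int i))
      = tau_incr n M (lam m') b i - tau_incr n M {#} b i" if "m' \<le> m" for m'
      using that
    proof (induction m')
      case (Suc j)
      have "int (Qf n (?p ! j) (carry n (take (m - Suc j) (drop (Suc j) ?p)) (?p ! m)) (int i))
          = tau_incr n M (lam (Suc j)) b i - tau_incr n M (lam j) b i"
        using Suc.prems m car[of "Suc j" m] pn[of j] lamS[of j] Qf_tau_factor[OF wf a1[of j] a1[of m] i(2), of "lam j"]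
        by (simp add: b_def)
      then show ?case using Suc by simp
    qed (simp add: lam_def)
    from this[of m] show ?thesis
      unfolding B_def using i lamS[OF m] tq_empty[OF pos, of i] by (simp add: tau_incr_def tq_def b_def)
  qed
  have u: "int (A m) = tau n M i {#as ! m#}" if m: "m < ?k" for m
    using Qf_uvec[OF pos i bN[OF m]] car[of 0 m] m unfolding A_def by (simp add: lam_def)
  let ?P = "uvec n N # ?p"
  have "Energy n (int i) ?p
      = (\<Sum>m<?k. \<Sum>j<Suc m. Qf n (?P ! j) (carry n (take (Suc m - j - 1) (drop (j + 1) ?P)) (?P ! Suc m)) (int i))"
    unfolding Energy_def N_def[symmetric] Evee_def length_Cons tau_path_length sum.lessThan_Suc_shift[of _ ?k] by simp
  also have "\<dots> = (\<Sum>m<?k. A m + B m)"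
    unfolding A_def B_def by (intro sum.cong refl) (simp only: sum.lessThan_Suc_shift, simp)
  also have "int \<dots> = (\<Sum>m<?k. int (A m) + int (B m))" by simp
  also have "\<dots> = (\<Sum>m<?k. tau n M i (lam (Suc m)) - tau n M i (lam m))"
    by (intro sum.cong refl) (simp add: inner u)
  also have "\<dots> = tau n M i (lam ?k) - tau n M i (lam 0)" by (rule sum_lessThan_telescope)
  finally show ?thesis using tq_empty[OF pos, of i] i by (simp add: lam_def tq_def)
qed

section \<open>Optimality of the full configuration and exchange in one level\<close>

abbreviation rows_ge :: "(nat \<times> int) multiset \<Rightarrow> nat \<Rightarrow> int" where
  "rows_ge A l \<equiv> ge (image_mset fst A) l"

text \<open>The part of the value that depends on the choice \<open>A\<close> in one level when all
  other levels are fixed; \<open>z\<close> is the sum of the columns of the two adjacent levels,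
  less 1 in the level \<open>d\<close>.\<close>

definition level_val :: "nat \<Rightarrow> (nat \<Rightarrow> int) \<Rightarrow> (nat \<times> int) multiset \<Rightarrow> int" where
  "level_val K z A = (\<Sum>l\<in>{1..K}. z l * rows_ge A l - (rows_ge A l) ^ 2) - (\<Sum>x\<in>#A. snd x)"

lemma sum_ind_mult:
  assumes "j \<le> K"
  shows "(\<Sum>l\<in>{1..K}. ind j l * f l) = (\<Sum>l\<in>{1..j}. f l)"
proof -
  have "{1..K} = {1..j} \<union> {j<..K}" using assms by auto
  then have "(\<Sum>l\<in>{1..K}. ind j l * f l) = (\<Sum>l\<in>{1..j}. ind j l * f l) + (\<Sum>l\<in>{j<..K}. ind j l * f l)"
    by (subst sum.union_disjoint[symmetric]) auto
  moreover have "(\<Sum>l\<in>{j<..K}. ind j l * f l) = 0" by (intro sum.neutral) (auto simp: ind_def)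
  moreover have "(\<Sum>l\<in>{1..j}. ind j l * f l) = (\<Sum>l\<in>{1..j}. f l)" by (intro sum.cong) (auto simp: ind_def)
  ultimately show ?thesis by simp
qed

lemma level_val_add:
  assumes "j \<le> K"
  shows "level_val K z (add_mset (j, r) A) = level_val K z A + (\<Sum>l\<in>{1..j}. z l - 2 * rows_ge A l - 1) - r"
proof -
  have "(\<Sum>l\<in>{1..K}. z l * rows_ge (add_mset (j, r) A) l - (rows_ge (add_mset (j, r) A) l) ^ 2)
      = (\<Sum>l\<in>{1..K}. (z l * rows_ge A l - (rows_ge A l) ^ 2) + ind j l * (z l - 2 * rows_ge A l - 1))"
    by (intro sum.cong) (auto simp: ge_add ind_def power2_eq_square algebra_simps)
  then show ?thesis using sum_ind_mult[OF assms] unfolding level_val_def by (simp add: sum.distrib del: One_nat_def)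
qed

lemma gl_diff: "B \<subseteq># A \<Longrightarrow> rows_ge (A - B) l = rows_ge A l - rows_ge B l"
  by (metis add_diff_cancel_left' ge_plus image_mset_union subset_mset.add_diff_inverse)

lemma sum_split_at:
  fixes f :: "nat \<Rightarrow> int"
  assumes "i \<le> j" shows "(\<Sum>l\<in>{1..j}. f l) = (\<Sum>l\<in>{1..i}. f l) + (\<Sum>l\<in>{i<..j}. f l)"
proof -
  have "{1..j} = {1..i} \<union> {i<..j}" using assms by auto
  then show ?thesis by (subst sum.union_disjoint[symmetric]) auto
qed

lemma subset_add: "A \<subseteq># R \<Longrightarrow> A \<subseteq># add_mset x R"
  by (metis add_mset_add_single mset_subset_eq_add_left subset_mset.order_trans)

lemma add_mset_subset:
  assumes "x \<in># R - C" "C \<subseteq># R" shows "add_mset x C \<subseteq># R"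
proof -
  obtain D where D: "R - C = add_mset x D" using assms(1) by (metis insert_DiffM)
  have "R = C + (R - C)" using assms(2) by simp
  then have "R = add_mset x (C + D)" unfolding D by simp
  then show ?thesis by simp
qed

lemma subset_add_cases:
  assumes "A \<subseteq># add_mset x R"
  obtains "A \<subseteq># R" | B where "A = add_mset x B" "B \<subseteq># R"
proof (cases "A \<subseteq># R")
  case False
  then have "x \<in># A" using assms by (metis diff_single_trivial subset_eq_diff_conv add_mset_add_single)
  then obtain B where "A = add_mset x B" by (metis insert_DiffM)
  then show ?thesis using that(2)[of B] assms by simp
qed (rule that(1))

text \<open>The row \<open>(m, s)\<close> exceeds its vacancy number \<open>P m\<close> by 1 because the level below has already been
  shortened.  A choice containing it keeps its value up to \<open>2 * b m - w m\<close> when the row is shortened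
  (\<open>b\<close> counts the unchosen rows); if this has the wrong sign, the row is traded for an unchosen one.\<close>

lemma one_level:
  assumes R: "\<forall>x\<in>#R. 1 \<le> fst x \<and> fst x \<le> K" and m: "1 \<le> m" "m \<le> K"
    and w0: "\<And>l. 0 \<le> w l" and wm: "\<And>l l'. 1 \<le> l \<Longrightarrow> l \<le> l' \<Longrightarrow> w l' \<le> w l"
    and z: "\<And>l. z l = Z l - w l"
    and P: "\<And>j. P j = (\<Sum>l\<in>{1..j}. Z l - 2 * rows_ge (add_mset (m, s) R) l)"
    and s: "s = P m + 1" and s': "s' = P (m - 1)"
    and Rr: "\<And>x. x \<in># R \<Longrightarrow> snd x \<le> P (fst x) + 1"
            "\<And>x. x \<in># R \<Longrightarrow> fst x < m \<Longrightarrow> snd x \<le> P (fst x)"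
  shows "A \<subseteq># add_mset (m, s) R \<Longrightarrow> \<exists>B. B \<subseteq># add_mset (m - 1, s') R \<and> level_val K z A \<le> level_val K z B"
    and "A \<subseteq># add_mset (m - 1, s') R \<Longrightarrow> \<exists>B. B \<subseteq># add_mset (m, s) R \<and> level_val K z A \<le> level_val K z B"
proof -
  define p where "p l = Z l - 2 * rows_ge R l" for l
  have P_low: "P j = (\<Sum>l\<in>{1..j}. p l - 2)" if "j \<le> m" for j
    unfolding P p_def using that by (intro sum.cong) (auto simp: ge_add ind_def)
  have P_high: "P j = P m + (\<Sum>l\<in>{m<..j}. p l)" if "m \<le> j" for j
    unfolding P sum_split_at[OF that] p_def by (intro arg_cong2[where f="(+)"] sum.cong) (auto simp: ge_add ind_def)
  have P_m: "P m - P (m - 1) = p m - 2"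
    using P_low[of m] P_low[of "m - 1"] m sum_split_at[of "m - 1" m "\<lambda>l. p l - 2"]
    by (cases m) (simp_all del: One_nat_def)
  define b where "b A l = rows_ge R l - rows_ge A l" for A l
  have b_gl: "b A l = rows_ge (R - A) l" if "A \<subseteq># R" for A l using gl_diff[OF that] by (simp add: b_def)
  have e: "z l - 2 * rows_ge A l - 1 = p l - w l + 2 * b A l - 1" for A l by (simp add: z p_def b_def)
  have F: "level_val K z (add_mset (j, r) A) = level_val K z A + (\<Sum>l\<in>{1..j}. p l - w l + 2 * b A l - 1) - r"
    if "j \<le> K" for j r A
    using level_val_add[OF that, of z r A] unfolding e .
  have Fm: "level_val K z (add_mset (m, s) A) - level_val K z (add_mset (m - 1, s') A) = 2 * b A m - w m" for A
  proof -
    have "{1..m} = insert m {1..m-1}" using m by auto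
    then have "(\<Sum>l\<in>{1..m}. p l - w l + 2 * b A l - 1) = (\<Sum>l\<in>{1..m-1}. p l - w l + 2 * b A l - 1) + (p m - w m + 2 * b A m - 1)"
      using m by simp
    then show ?thesis using F[of m s A] F[of "m - 1" s' A] m P_m s s' by simp
  qed
  show "\<exists>B. B \<subseteq># add_mset (m - 1, s') R \<and> level_val K z A \<le> level_val K z B" if A: "A \<subseteq># add_mset (m, s) R"
    using A
  proof (cases rule: subset_add_cases)
    case 1
    then show ?thesis by (intro exI[of _ A]) (simp add: subset_add)
  next
    case (2 C)
    show ?thesis
    proof (cases "2 * b C m \<le> w m")
      case True
      then show ?thesis using 2 Fm[of C] by (intro exI[of _ "add_mset (m - 1, s') C"]) auto
    next
      case False
      then have bm: "w m \<le> 2 * b C m - 1" by simp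
      \<comment> \<open>Unchosen rows of length at least \<open>m\<close> exist because
        \<open>b C m\<close> is positive. The shortest is taken so that \<open>b\<close> stays
        constant from \<open>m\<close> up to its length.\<close>
      define T where "T = {x \<in> set_mset (R - C). m \<le> fst x}"
      have "T \<noteq> {}"
      proof
        assume "T = {}"
        then have "rows_ge (R - C) m = 0" by (intro ge_beyond) (force simp: T_def not_le)
        then show False using bm w0[of m] b_gl[OF 2(2)] by simp
      qed
      then have "Min (fst ` T) \<in> fst ` T" by (intro Min_in) (auto simp: T_def)
      then obtain x where x: "x \<in> T" "fst x = Min (fst ` T)" by force
      have xmin: "fst x \<le> fst y" if "y \<in> T" for y unfolding x(2) using that by (intro Min_le) (auto simp: T_def)
      have xR: "x \<in># R - C" "m \<le> fst x" "x \<in># R" using x(1) by (auto simp: T_def dest: in_diffD)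
      have bl: "b C l = b C m" if "l \<in> {m<..fst x}" for l
      proof -
        have "{#y \<in># image_mset fst (R - C). l \<le> y#} = {#y \<in># image_mset fst (R - C). m \<le> y#}"
          using that xmin by (intro filter_mset_cong refl) (force simp: T_def)
        then show ?thesis unfolding b_gl[OF 2(2)] ge_def by simp
      qed
      have "add_mset x C \<subseteq># R" using add_mset_subset[OF xR(1) 2(2)] .
      moreover have "level_val K z (add_mset (m, s) C) \<le> level_val K z (add_mset (fst x, snd x) C)"
      proof -
        have "0 \<le> (\<Sum>l\<in>{m<..fst x}. (p l - w l + 2 * b C l - 1) - p l)"
        proof (rule sum_nonneg)
          fix l assume l: "l \<in> {m<..fst x}"
          then show "0 \<le> (p l - w l + 2 * b C l - 1) - p l"
            using bl[OF l] bm wm[of m l] m by simp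
        qed
        then have "(\<Sum>l\<in>{m<..fst x}. p l) \<le> (\<Sum>l\<in>{m<..fst x}. p l - w l + 2 * b C l - 1)"
          unfolding sum_subtractf by simp
        moreover have "snd x \<le> P m + (\<Sum>l\<in>{m<..fst x}. p l) + 1" using Rr(1)[OF xR(3)] P_high[OF xR(2)] by simp
        moreover have "fst x \<le> K" using R xR(3) by simp
        ultimately show ?thesis
          using F[of m s C] F[of "fst x" "snd x" C] m(2) s sum_split_at[OF xR(2), of "\<lambda>l. p l - w l + 2 * b C l - 1"]
          by linarith
      qed
      ultimately show ?thesis using 2(1) by (intro exI[of _ "add_mset x C"]) (simp_all add: subset_add)
    qed
  qed
  show "\<exists>B. B \<subseteq># add_mset (m, s) R \<and> level_val K z A \<le> level_val K z B" if A: "A \<subseteq># add_mset (m - 1, s') R"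
    using A
  proof (cases rule: subset_add_cases)
    case 1
    then show ?thesis by (intro exI[of _ A]) (simp_all add: subset_add)
  next
    case (2 C)
    show ?thesis
    proof (cases "w m \<le> 2 * b C m")
      case True
      then show ?thesis using 2 Fm[of C] by (intro exI[of _ "add_mset (m, s) C"]) auto
    next
      case wb: False
      have rest: "0 \<le> (\<Sum>l\<in>{i<..m-1}. (p l - 2) - (p l - w l + 2 * b C l - 1))"
        if "\<And>l. i < l \<Longrightarrow> l < m \<Longrightarrow> 2 * b C l < w l" for i
        using that by (intro sum_nonneg) fastforce
      \<comment> \<open>Beyond the largest such \<open>l\<close>, each column term of the row is at
        most the increment \<open>p l - 2\<close> of \<open>P\<close>, so extending a row from there
        to \<open>m - 1\<close> does not pay. If there is none, the row is simply dropped.\<close>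
      define S where "S = {l. 1 \<le> l \<and> l < m \<and> w l \<le> 2 * b C l}"
      show ?thesis
      proof (cases "S = {}")
        case True
        have "0 \<le> (\<Sum>l\<in>{0<..m-1}. (p l - 2) - (p l - w l + 2 * b C l - 1))"
          using True by (intro rest) (auto simp: S_def not_le)
        moreover have "{0<..m-1} = {1..m-1}" by auto
        ultimately have "(\<Sum>l\<in>{1..m-1}. p l - w l + 2 * b C l - 1) \<le> P (m - 1)"
          using P_low[of "m - 1"] unfolding sum_subtractf by simp
        then have "level_val K z A \<le> level_val K z C" using F[of "m - 1" s' C] m s' 2(1) by simp
        then show ?thesis using 2(2) by (intro exI[of _ C]) (simp_all add: subset_add)
      next
        case False
        have finS: "finite S" by (rule finite_subset[of _ "{..<m}"]) (auto simp: S_def)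
        define i where "i = Max S"
        have "i \<in> S" using Max_in[OF finS False] by (simp add: i_def)
        then have i: "1 \<le> i" "i < m" "w i \<le> 2 * b C i" by (auto simp: S_def)
        have imax: "2 * b C l < w l" if "i < l" "l < m" for l
        proof (rule ccontr)
          assume "\<not> 2 * b C l < w l"
          then have "l \<in> S" using that by (simp add: S_def)
          from Max_ge[OF finS this] show False using that(1) by (simp add: i_def)
        qed
        have "2 * b C (i + 1) < w (i + 1)" using imax[of "i + 1"] wb i by (cases "i + 1 = m") auto
        \<comment> \<open>As \<open>w\<close> is antitone, \<open>b\<close> drops between
          \<open>i\<close> and \<open>i + 1\<close>, which exhibits an unchosen row of length
          exactly \<open>i\<close> to trade for.\<close>
        then have "b C (i + 1) < b C i" using i(3) wm[of i "i + 1"] i(1) by simp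
        then have "0 < size {#x \<in># R - C. fst x = i#}"
          using image_filter_ge_diff[of "R - C" i] unfolding b_gl[OF 2(2)] by linarith
        then obtain x where "x \<in># {#x \<in># R - C. fst x = i#}" by (metis multiset_nonemptyE nonempty_has_size)
        then have x: "x \<in># R - C" "fst x = i" by (simp_all only: set_mset_filter mem_Collect_eq)
        have xR: "x \<in># R" using x(1) by (auto dest: in_diffD)
        have "add_mset x C \<subseteq># R" using add_mset_subset[OF x(1) 2(2)] .
        moreover have "level_val K z (add_mset (m - 1, s') C) \<le> level_val K z (add_mset (i, snd x) C)"
        proof -
          have im: "i \<le> m - 1" using i by simp
          have "(\<Sum>l\<in>{i<..m-1}. p l - w l + 2 * b C l - 1) \<le> (\<Sum>l\<in>{i<..m-1}. p l - 2)"
            using rest[of i, OF imax] unfolding sum_subtractf by linarith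
          moreover have "snd x \<le> P i" using Rr(2)[OF xR] x(2) i by simp
          moreover have "P (m - 1) = P i + (\<Sum>l\<in>{i<..m-1}. p l - 2)"
            using P_low[of "m - 1"] P_low[of i] i sum_split_at[OF im, of "\<lambda>l. p l - 2"] by simp
          ultimately show ?thesis
            using F[of "m - 1" s' C] F[of i "snd x" C] i m s' sum_split_at[OF im, of "\<lambda>l. p l - w l + 2 * b C l - 1"]
            by linarith
        qed
        ultimately show ?thesis using 2(1) x(2)[symmetric] by (intro exI[of _ "add_mset x C"]) (simp_all add: subset_add)
      qed
    qed
  qed
qed


section \<open>Vacancy numbers in columns and optimality of the full choice\<close>

lemma Ecf_sum:
  assumes "M (n + 1) = {#}" "a \<le> n + 1"
  shows "Ecf n mu0 M a j = (\<Sum>l\<in>{1..j}. ge (lens (mset mu0) M a) l)"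
proof -
  have m: "int (\<Sum>y\<in>#B. min j y) = (\<Sum>l\<in>{1..j}. ge B l)" for B
    unfolding sum_ind_ge[OF order_refl, symmetric] by (simp add: sum_ind_mult del: One_nat_def)
  have 0: "(\<Sum>k<length mu0. min j (mu0 ! k)) = (\<Sum>y\<in>#mset mu0. min j y)"
  proof -
    have "(\<Sum>y\<in>#mset mu0. min j y) = sum_list (map (min j) mu0)"
      by (simp add: sum_mset_sum_list[symmetric])
    then show ?thesis by (simp add: sum_list_sum_nth lessThan_atLeast0)
  qed
  show ?thesis
  proof (cases "a = 0")
    case True
    then show ?thesis using m[of "mset mu0"] 0 by (simp add: Ecf_def lens_def)
  next
    case False
    show ?thesis
    proof (cases "a = n + 1")
      case True
      then show ?thesis using assms(1) by (simp add: Ecf_def lens_def)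
    next
      case False
      then show ?thesis using \<open>a \<noteq> 0\<close> assms(2) m[of "image_mset fst (M a)"]
        by (simp add: Ecf_def lens_def multiset.map_comp o_def)
    qed
  qed
qed

text \<open>In columns, vacancy numbers are partial sums of a discrete Laplacian across the levels,
  the same coefficients that appear in the linear part of \<open>qform_polar\<close>.\<close>

lemma vac_sum:
  assumes "M (n + 1) = {#}" "1 \<le> a" "a \<le> n"
  shows "vac n mu0 M a j = (\<Sum>l\<in>{1..j}. hgt (mset mu0) M (a - 1) l - 2 * hgt (mset mu0) M a l + hgt (mset mu0) M (a + 1) l)"
proof -
  have "a - 1 \<le> n + 1" "a \<le> n + 1" "a + 1 \<le> n + 1" using assms by auto
  then show ?thesis unfolding vac_def
    by (simp only: Ecf_sum[of M n, OF assms(1)] sum.distrib sum_subtractf sum_distrib_left)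
qed

lemma qform_polar:
  assumes "b 0 = 0" "h (n + 1) = 0"
  shows "qform n (\<lambda>a. h a - b a) = qform n h
     + (\<Sum>a\<in>{1..n}. (h (a - 1) - 2 * h a + h (a + 1)) * b a) + qform n b"
proof -
  have "qform m (\<lambda>a. h a - b a) = qform m h
     + (\<Sum>a\<in>{1..m}. (h (a - 1) - 2 * h a + h (a + 1)) * b a) + qform m b - h (m + 1) * b m" for m
    by (induction m) (simp_all add: qform_def assms(1) power2_eq_square algebra_simps)
  from this[of n] show ?thesis using assms(2) by simp
qed

text \<open>An integer is at most its square in absolute value. The sequence goes from 0 up to
  \<open>b d\<close> and back to 0, so its squared differences sum to at least
  \<open>2 * b d\<close>.\<close>

lemma qform_ge_component:
  fixes b :: "nat \<Rightarrow> int"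
  assumes "b 0 = 0" "b (n + 1) = 0" "d \<le> n + 1"
  shows "b d \<le> qform n b"
proof -
  have sq: "x \<le> x ^ 2" for x :: int by (cases "x \<le> 0") (auto simp: power2_eq_square intro: order_trans[of _ 0])
  have sq': "- x \<le> x ^ 2" for x :: int using sq[of "- x"] by simp
  have G: "(\<Sum>a\<in>{0..<m}. (b a - b (a + 1)) ^ 2) \<ge> (if m \<le> d then b m - b 0 else b d - b 0 + (b d - b m))" for m
  proof (induction m)
    case (Suc m)
    then show ?case using sq[of "b m - b (Suc m)"] sq'[of "b m - b (Suc m)"]
      by (cases "Suc m \<le> d"; cases "m = d") (auto simp: not_le le_Suc_eq)
  qed simp
  have "2 * b d \<le> (\<Sum>a\<in>{0..<n+1}. (b a - b (a + 1)) ^ 2)"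
    using G[of "n + 1"] assms by (auto split: if_splits)
  moreover have eq: "{0..<n+1} = {0..n}" by auto
  ultimately have "2 * b d \<le> (\<Sum>a\<in>{0..n}. (b a - b (a + 1)) ^ 2)" by (simp only: eq)
  then show ?thesis using qform_squares[of b n] assms by simp
qed

lemma sum_mset_partial:
  assumes "\<forall>x\<in>#A. fst x \<le> K"
  shows "(\<Sum>x\<in>#A. \<Sum>l\<in>{1..fst x}. v l) = (\<Sum>l\<in>{1..K}. v l * rows_ge A l)"
  using assms
proof (induction A)
  case (add x A)
  then show ?case using sum_ind_mult[of "fst x" K v]
    by (simp add: ge_add distrib_left sum.distrib mult.commute del: One_nat_def)
qed simp

text \<open>Leaving out rows with columns \<open>b\<close> saves their riggings, at most their
  vacancy numbers, which is exactly the linear part of the change in \<open>qform\<close>. What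
  remains is \<open>qform n b\<close> against the saved penalty \<open>b d\<close>.\<close>

lemma full_cfg_optimal:
  assumes rc: "is_RC n mu0 M" and n: "1 \<le> n" and d: "1 \<le> d" "d \<le> n + 1"
  shows "tau n M d (mset mu0) = tau_val n (mset mu0) M d"
proof (rule tau_eqI)
  have M0: "M a = {#}" if "a \<notin> {1..n}" for a using rc that by (simp add: is_RC_def)
  have wf: "wf_cfg n M" using rc n by (simp add: is_RC_def wf_cfg_def)
  obtain K where K: "bounded n K M" "\<forall>x\<in>#mset mu0. x \<le> K" using ex_bound[OF wf] by blast
  have Mn: "M (n + 1) = {#}" using M0 by simp
  have self: "subcfg n M M" using M0 unfolding subcfg_def by simp
  then show "\<exists>N. subcfg n N M \<and> tau_val n (mset mu0) M d \<le> tau_val n (mset mu0) N d" by blast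
  fix N assume N: "subcfg n N M"
  have Nb: "bounded n K N" "N (n + 1) = {#}" using bounded_sub[OF K(1) N] N by (auto simp: subcfg_def)
  define h where "h l a = hgt (mset mu0) M a l" for l a
  define b where "b l a = (if a = 0 then 0 else rows_ge (M a - N a) l)" for l a
  have sub: "N a \<subseteq># M a" for a using N M0[of a] unfolding subcfg_def by (cases "a \<in> {1..n}") auto
  have hN: "hgt (mset mu0) N a l = h l a - b l a" for l a
    using gl_diff[OF sub[of a], of l] by (simp add: h_def b_def lens_def)
  have hn: "h l (n + 1) = 0" "b l (n + 1) = 0" "b l 0 = 0" for l
    using Mn Nb(2) by (simp_all add: h_def b_def lens_def)
  have "rig n M - rig n N = (\<Sum>a\<in>{1..n}. \<Sum>x\<in>#M a - N a. snd x)"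
  proof -
    have "(\<Sum>x\<in>#M a. snd x) = (\<Sum>x\<in>#N a. snd x) + (\<Sum>x\<in>#M a - N a. snd x)" for a
      using arg_cong[OF subset_mset.add_diff_inverse[OF sub[of a]], of "\<lambda>A. \<Sum>x\<in>#A. snd x"] by simp
    then show ?thesis unfolding rig_def by (simp add: sum.distrib)
  qed
  also have "\<dots> \<le> (\<Sum>a\<in>{1..n}. \<Sum>x\<in>#M a - N a. vac n mu0 M a (fst x))"
    using rc unfolding is_RC_def by (intro sum_mono sum_mset_mono) (auto dest!: in_diffD)
  also have "\<dots> = (\<Sum>a\<in>{1..n}. \<Sum>l\<in>{1..K}. (h l (a - 1) - 2 * h l a + h l (a + 1)) * b l a)"
  proof (intro sum.cong refl)
    fix a assume a: "a \<in> {1..n}"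
    have "(\<Sum>x\<in>#M a - N a. vac n mu0 M a (fst x))
       = (\<Sum>x\<in>#M a - N a. \<Sum>l\<in>{1..fst x}. h l (a - 1) - 2 * h l a + h l (a + 1))"
      using a unfolding h_def by (simp only: vac_sum[of M n, OF Mn] atLeastAtMost_iff)
    also have "\<dots> = (\<Sum>l\<in>{1..K}. (h l (a - 1) - 2 * h l a + h l (a + 1)) * rows_ge (M a - N a) l)"
      using K(1) a unfolding bounded_def by (intro sum_mset_partial) (auto dest!: in_diffD)
    finally show "(\<Sum>x\<in>#M a - N a. vac n mu0 M a (fst x))
       = (\<Sum>l\<in>{1..K}. (h l (a - 1) - 2 * h l a + h l (a + 1)) * b l a)" using a by (simp add: b_def)
  qed
  also have "\<dots> = (\<Sum>l\<in>{1..K}. \<Sum>a\<in>{1..n}. (h l (a - 1) - 2 * h l a + h l (a + 1)) * b l a)"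
    by (rule sum.swap)
  finally have r: "rig n M - rig n N \<le> (\<Sum>l\<in>{1..K}. \<Sum>a\<in>{1..n}. (h l (a - 1) - 2 * h l a + h l (a + 1)) * b l a)" .
  have "(\<Sum>l\<in>{1..K}. qform n (h l) + h l d + (\<Sum>a\<in>{1..n}. (h l (a - 1) - 2 * h l a + h l (a + 1)) * b l a))
     \<le> (\<Sum>l\<in>{1..K}. qform n (\<lambda>a. h l a - b l a) + (h l d - b l d))"
  proof (rule sum_mono)
    fix l
    show "qform n (h l) + h l d + (\<Sum>a\<in>{1..n}. (h l (a - 1) - 2 * h l a + h l (a + 1)) * b l a)
      \<le> qform n (\<lambda>a. h l a - b l a) + (h l d - b l d)"
      using qform_polar[of "b l" "h l" n, OF hn(3) hn(1)] qform_ge_component[of "b l" n d, OF hn(3) hn(2) d(2)]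
      by linarith
  qed
  then have "(\<Sum>l\<in>{1..K}. qform n (h l) + h l d) + (rig n M - rig n N)
     \<le> (\<Sum>l\<in>{1..K}. qform n (\<lambda>a. h l a - b l a) + (h l d - b l d))"
    using r unfolding sum.distrib by linarith
  then have "tau_hgt_val n K d (mset mu0) N \<le> tau_hgt_val n K d (mset mu0) M"
    unfolding tau_hgt_val_def hN h_def by linarith
  then show "tau_val n (mset mu0) N d \<le> tau_val n (mset mu0) M d"
    using tau_val_tau_hgt_val[OF n d Nb K(2)] tau_val_tau_hgt_val[OF n d K(1) Mn K(2)] by simp
qed

section \<open>One step of the KKR map\<close>

text \<open>\<open>c\<close> is the first level without a chosen row, hence the output letter when
  starting at level 1; \<open>L a\<close> is the chosen length, with \<open>L (i - 1)\<close> the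
  incoming bound. The last clause is minimality of \<open>L a\<close> and, for \<open>a = c\<close>,
  the absence of a candidate.\<close>

lemma choose_rows_spec:
  assumes "1 \<le> i"
  shows "\<exists>c L. i \<le> c \<and> c \<le> i + f \<and> L (i - 1) = lp
     \<and> choose_rows f n mu0 M i lp = map (\<lambda>a. (a, (L a, vac n mu0 M a (L a)))) [i..<c]
     \<and> (\<forall>a\<in>{i..<c}. L (a - 1) \<le> L a \<and> (L a, vac n mu0 M a (L a)) \<in># M a)
     \<and> (\<forall>a\<in>{i..c}. a < i + f \<longrightarrow> (\<forall>x\<in>#M a. L (a - 1) \<le> fst x \<longrightarrow> a = c \<or> fst x < L a
            \<longrightarrow> snd x \<noteq> vac n mu0 M a (fst x)))"
  using assms
proof (induction f arbitrary: i lp)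
  case 0
  then show ?case by (intro exI[of _ i] exI[of _ "\<lambda>_. lp"]) auto
next
  case (Suc f)
  define S where "S = {x \<in> set_mset (M i). lp \<le> fst x \<and> snd x = vac n mu0 M i (fst x)}"
  show ?case
  proof (cases "S = {}")
    case True
    then have "choose_rows (Suc f) n mu0 M i lp = []" by (simp add: S_def)
    then show ?thesis using True
      by (intro exI[of _ i] exI[of _ "\<lambda>_. lp"]) (auto simp: S_def)
  next
    case False
    define l where "l = Min (fst ` S)"
    have fin: "finite (fst ` S)" by (simp add: S_def)
    have "l \<in> fst ` S" using False fin unfolding l_def by (intro Min_in) auto
    then have l: "lp \<le> l" "(l, vac n mu0 M i l) \<in># M i" by (auto simp: S_def)
    have lmin: "l \<le> fst x" if "x \<in> S" for x unfolding l_def using fin that by (intro Min_le) auto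
    have ch: "choose_rows (Suc f) n mu0 M i lp = (i, (l, vac n mu0 M i l)) # choose_rows f n mu0 M (i + 1) l"
      using False by (simp add: S_def l_def Let_def)
    obtain c L where cL: "i + 1 \<le> c" "c \<le> i + 1 + f" "L i = l"
      "choose_rows f n mu0 M (i + 1) l = map (\<lambda>a. (a, (L a, vac n mu0 M a (L a)))) [i + 1..<c]"
      "\<forall>a\<in>{i+1..<c}. L (a - 1) \<le> L a \<and> (L a, vac n mu0 M a (L a)) \<in># M a"
      "\<forall>a\<in>{i+1..c}. a < i + 1 + f \<longrightarrow> (\<forall>x\<in>#M a. L (a - 1) \<le> fst x \<longrightarrow> a = c \<or> fst x < L a
            \<longrightarrow> snd x \<noteq> vac n mu0 M a (fst x))"
      using Suc.IH[of "i + 1" l] by auto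
    define L' where "L' = L(i - 1 := lp)"
    have L': "L' a = L a" if "i \<le> a" for a
    proof -
      have "a \<noteq> i - 1" using that Suc.prems by linarith
      then show ?thesis by (simp add: L'_def)
    qed
    have L'i: "L' (i - 1) = lp" by (simp add: L'_def)
    have up: "[i..<c] = i # [i + 1..<c]" using cL(1) by (simp add: upt_conv_Cons)
    have 1: "choose_rows (Suc f) n mu0 M i lp = map (\<lambda>a. (a, (L' a, vac n mu0 M a (L' a)))) [i..<c]"
      unfolding ch cL(4) up using cL(3) L' by simp
    have 2: "L' (a - 1) \<le> L' a \<and> (L' a, vac n mu0 M a (L' a)) \<in># M a" if a: "a \<in> {i..<c}" for a
    proof (cases "a = i")
      case True
      then show ?thesis using L'i L'[of i] cL(3) l by simp
    next
      case False
      then have "i \<le> a - 1" using a by (cases a) auto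
      then show ?thesis using False a L'[of "a - 1"] L'[of a] cL(5) by simp
    qed
    have 3: "snd x \<noteq> vac n mu0 M a (fst x)"
      if a: "a \<in> {i..c}" "a < i + Suc f" "x \<in># M a" "L' (a - 1) \<le> fst x" "a = c \<or> fst x < L' a" for a x
    proof (cases "a = i")
      case True
      then have "fst x < l" using a(5) cL(1,3) L'[of i] by simp
      then have "x \<notin> S" using lmin[of x] by auto
      then show ?thesis using a(3,4) True L'i by (simp add: S_def)
    next
      case False
      then have i: "i \<le> a - 1" "a \<in> {i+1..c}" using a by auto
      show ?thesis using a L'[OF i(1)] L'[of a] i cL(6)[rule_format, OF i(2), of x] by auto
    qed
    show ?thesis
      using cL(1,2) L'i 1 2 3 by (intro exI[of _ c] exI[of _ L']) simp
  qed
qed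

definition step_mu :: "nat list \<Rightarrow> nat list" where
  "step_mu mu0 = butlast mu0 @ (if last mu0 - 1 = 0 then [] else [last mu0 - 1])"

text \<open>The new riggings \<open>r\<close> are a parameter: vacancy numbers depend on lengths
  alone, so they are computed for \<open>r = 0\<close> and then inserted.\<close>

definition step_cfg :: "nat \<Rightarrow> nat list \<Rightarrow> rc \<Rightarrow> nat \<Rightarrow> (nat \<Rightarrow> nat) \<Rightarrow> (nat \<Rightarrow> int) \<Rightarrow> rc" where
  "step_cfg n mu0 M c L r = (\<lambda>a. if a \<in> {1..<c}
     then M a - {#(L a, vac n mu0 M a (L a))#} + (if 1 < L a then {#(L a - 1, r a)#} else {#}) else M a)"

lemma kstep_eq:
  assumes "choose_rows n n mu0 M 1 (last mu0) = map (\<lambda>a. (a, (L a, vac n mu0 M a (L a)))) [1..<c]" "1 \<le> c"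
  shows "kstep n mu0 M = (c, step_mu mu0, step_cfg n mu0 M c L
     (\<lambda>a. vac n (step_mu mu0) (step_cfg n mu0 M c L (\<lambda>_. 0)) a (L a - 1)))"
proof -
  let ?ch = "map (\<lambda>a. (a, (L a, vac n mu0 M a (L a)))) [1..<c]"
  have m: "map_of ?ch a = (if a \<in> {1..<c} then Some (L a, vac n mu0 M a (L a)) else None)" for a
    by (simp add: map_of_map_restrict restrict_map_def)
  have rm: "removed M ?ch a = (if a \<in> {1..<c} then M a - {#(L a, vac n mu0 M a (L a))#} else M a)" for a
    unfolding removed_def m by simp
  have sh: "shortened ?ch a = (if a \<in> {1..<c} \<and> 1 < L a then {#(L a - 1, 0)#} else {#})" for a
    unfolding shortened_def m by simp
  have Msh: "(\<lambda>i. removed M ?ch i + shortened ?ch i) = step_cfg n mu0 M c L (\<lambda>_. 0)"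
    unfolding rm sh step_cfg_def by (rule ext) simp
  have M': "(\<lambda>i. removed M ?ch i + image_mset (\<lambda>x. (fst x, vac n (step_mu mu0) (step_cfg n mu0 M c L (\<lambda>_. 0)) i (fst x))) (shortened ?ch i))
     = step_cfg n mu0 M c L (\<lambda>a. vac n (step_mu mu0) (step_cfg n mu0 M c L (\<lambda>_. 0)) a (L a - 1))"
    unfolding rm sh step_cfg_def[of n mu0 M c L "\<lambda>a. vac n (step_mu mu0) (step_cfg n mu0 M c L (\<lambda>_. 0)) a (L a - 1)"]
    by (rule ext) simp
  have l: "length ?ch + 1 = c" using assms(2) by simp
  show ?thesis
    unfolding kstep_def Let_def assms(1) step_mu_def[symmetric] Msh M' l by (rule refl)
qed

lemma qform_replace:
  assumes "1 \<le> a" "a \<le> n" "h (n + 1) = 0"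
  shows "qform n (h(a := x)) = qform n (h(a := 0)) + x ^ 2 - x * (h (a - 1) + h (a + 1))"
proof -
  have "qform m (h(a := x)) = qform m (h(a := 0)) + of_bool (a \<le> m) * (x ^ 2 - x * h (a - 1))
      - of_bool (a < m) * (x * h (a + 1))" for m
  proof (induction m)
    case (Suc m)
    consider "Suc m < a" | "Suc m = a" | "m = a" | "a < m" by linarith
    then show ?case using Suc assms(1)
      by cases (auto simp: qform_def algebra_simps)
  qed (use assms in \<open>simp add: qform_def\<close>)
  from this[of n] show ?thesis using assms by (cases "a = n") (simp_all add: algebra_simps)
qed

lemma tau_val_replace:
  assumes n: "1 \<le> n" and d: "1 \<le> d" "d \<le> n + 1" and a: "a \<in> {1..n}"
    and N: "bounded n K (N(a := A))" "bounded n K (N(a := B))" "N (n + 1) = {#}" and lam: "\<forall>x\<in>#lam. x \<le> K"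
    and z: "\<And>l. z l = hgt lam N (a - 1) l + hgt lam N (a + 1) l - of_bool (d = a)"
  shows "tau_val n lam (N(a := A)) d - tau_val n lam (N(a := B)) d = level_val K z A - level_val K z B"
proof -
  define h where "h l b = hgt lam N b l" for l b
  have hC: "(\<lambda>b. hgt lam (N(a := C)) b l) = (h l)(a := rows_ge C l)" for C l
    using a by (auto simp: h_def lens_def)
  have hn: "h l (n + 1) = 0" for l using N(3) by (simp add: h_def lens_def)
  define Q where "Q = (\<Sum>l\<in>{1..K}. qform n ((h l)(a := 0)) + (if d = a then 0 else h l d))"
  have q: "(\<Sum>l\<in>{1..K}. qform n (\<lambda>b. hgt lam (N(a := C)) b l) + hgt lam (N(a := C)) d l)
      = Q - (\<Sum>l\<in>{1..K}. z l * rows_ge C l - (rows_ge C l) ^ 2)" for C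
  proof -
    have "qform n (\<lambda>b. hgt lam (N(a := C)) b l) + hgt lam (N(a := C)) d l
       = (qform n ((h l)(a := 0)) + (if d = a then 0 else h l d)) - (z l * rows_ge C l - (rows_ge C l) ^ 2)" for l
    proof -
      have "hgt lam (N(a := C)) d l = (if d = a then rows_ge C l else h l d)" using fun_cong[OF hC[of C l], of d] by simp
      moreover have "qform n ((h l)(a := rows_ge C l)) = qform n ((h l)(a := 0)) + (rows_ge C l) ^ 2 - rows_ge C l * (h l (a - 1) + h l (a + 1))"
        using a hn by (intro qform_replace) auto
      ultimately show ?thesis unfolding hC z h_def by (simp add: algebra_simps)
    qed
    then show ?thesis by (simp add: Q_def sum_subtractf)
  qed
  define G where "G = (\<Sum>b\<in>{1..n} - {a}. \<Sum>x\<in>#N b. snd x)"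
  have r: "rig n (N(a := C)) = G + (\<Sum>x\<in>#C. snd x)" for C
  proof -
    have "rig n (N(a := C)) = (\<Sum>x\<in>#C. snd x) + (\<Sum>b\<in>{1..n} - {a}. \<Sum>x\<in>#(N(a := C)) b. snd x)"
      unfolding rig_def using a by (subst sum.remove[of _ a]) auto
    also have "(\<Sum>b\<in>{1..n} - {a}. \<Sum>x\<in>#(N(a := C)) b. snd x) = G"
      unfolding G_def by (intro sum.cong) auto
    finally show ?thesis by (simp only: add.commute)
  qed
  have e: "(N(a := C)) (n + 1) = {#}" for C using N(3) a by simp
  show ?thesis
    using tau_val_tau_hgt_val[OF n d N(1) e lam] tau_val_tau_hgt_val[OF n d N(2) e lam]
    unfolding tau_hgt_val_def q r level_val_def by linarith
qed

lemma tau_replace_le: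
  assumes n: "1 \<le> n" and d: "1 \<le> d" "d \<le> n + 1" and a: "a \<in> {1..n}"
    and H: "bounded n K H" "bounded n K H'" "\<And>b. b \<noteq> a \<Longrightarrow> H' b = H b" and lam: "\<forall>x\<in>#lam. x \<le> K"
    and ex: "\<And>N. subcfg n N H \<Longrightarrow> \<exists>B. B \<subseteq># H' a
       \<and> level_val K (\<lambda>l. hgt lam N (a - 1) l + hgt lam N (a + 1) l - of_bool (d = a)) (N a)
       \<le> level_val K (\<lambda>l. hgt lam N (a - 1) l + hgt lam N (a + 1) l - of_bool (d = a)) B"
  shows "tau n H d lam \<le> tau n H' d lam"
proof -
  obtain N where N: "subcfg n N H" "tau n H d lam = tau_val n lam N d" using tau_attained by blast
  obtain B where B: "B \<subseteq># H' a"
    "level_val K (\<lambda>l. hgt lam N (a - 1) l + hgt lam N (a + 1) l - of_bool (d = a)) (N a)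
       \<le> level_val K (\<lambda>l. hgt lam N (a - 1) l + hgt lam N (a + 1) l - of_bool (d = a)) B"
    using ex[OF N(1)] by blast
  have sub: "subcfg n (N(a := B)) H'" using N(1) B(1) H(3) a unfolding subcfg_def by simp
  have b: "bounded n K (N(a := N a))" "bounded n K (N(a := B))" "N (n + 1) = {#}"
    using bounded_sub[OF H(1) N(1)] bounded_sub[OF H(2) sub] N(1) by (simp_all add: subcfg_def)
  have "tau_val n lam (N(a := N a)) d \<le> tau_val n lam (N(a := B)) d"
    using tau_val_replace[OF n d a b lam refl] B(2) by linarith
  also have "\<dots> \<le> tau n H' d lam" by (rule tau_ge[OF sub])
  finally show ?thesis using N(2) by simp
qed

section \<open>The configuration after one elementary step\<close>

context
  fixes n :: nat and mu0 :: "nat list" and M :: rc and c :: nat and L :: "nat \<Rightarrow> nat"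
  assumes n: "1 \<le> n" and rc: "is_RC n mu0 M" and ne: "mu0 \<noteq> []" and c: "1 \<le> c" "c \<le> n + 1"
    and L0: "L 0 = last mu0"
    and Lmono: "\<And>a. a \<in> {1..<c} \<Longrightarrow> L (a - 1) \<le> L a"
    and Lin: "\<And>a. a \<in> {1..<c} \<Longrightarrow> (L a, vac n mu0 M a (L a)) \<in># M a"
    and Lmin: "\<And>a x. a \<in> {1..c} \<Longrightarrow> a \<le> n \<Longrightarrow> x \<in># M a \<Longrightarrow> L (a - 1) \<le> fst x \<Longrightarrow> a = c \<or> fst x < L a
         \<Longrightarrow> snd x \<noteq> vac n mu0 M a (fst x)"
begin

lemma M_outside: "a \<notin> {1..n} \<Longrightarrow> M a = {#}"
  using rc by (simp add: is_RC_def)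

lemma row_facts: "a \<in> {1..n} \<Longrightarrow> x \<in># M a \<Longrightarrow> 1 \<le> fst x \<and> 0 \<le> snd x \<and> snd x \<le> vac n mu0 M a (fst x)"
  using rc by (simp add: is_RC_def)

lemma L_pos: "a < c \<Longrightarrow> 1 \<le> L a"
proof (cases "a = 0")
  case True
  have "last mu0 \<in> set mu0" using ne by simp
  then have "0 < last mu0" using rc by (simp add: is_RC_def)
  then show ?thesis using True L0 by simp
next
  case False
  assume "a < c"
  then show ?thesis using Lin[of a] row_facts[of a "(L a, vac n mu0 M a (L a))"] False c by simp
qed

abbreviation "start_hgt a l \<equiv> hgt (mset mu0) M a l"

lemma hgt_step:
  assumes "1 \<le> l"
  shows "hgt (mset (step_mu mu0)) (step_cfg n mu0 M c L r) a l = start_hgt a l - of_bool (a < c \<and> l = L a)"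
proof -
  have i: "ind m l = ind (m - 1) l + of_bool (l = m)" for m
    using assms by (auto simp: ind_def)
  show ?thesis
  proof (cases "a = 0")
    case True
    have "mset mu0 = mset (butlast mu0 @ [last mu0])" using ne by simp
    then have 1: "mset mu0 = add_mset (L 0) (mset (butlast mu0))" by (simp add: L0)
    have "ge (mset (step_mu mu0)) l = ge (mset (butlast mu0)) l + ind (L 0 - 1) l"
      using assms by (auto simp: step_mu_def L0 ge_plus ge_add ind_def)
    then show ?thesis unfolding lens_def using True 1 c i[of "L 0"] by (simp add: ge_add)
  next
    case False
    show ?thesis
    proof (cases "a < c")
      case True
      then have "M a = add_mset (L a, vac n mu0 M a (L a)) (M a - {#(L a, vac n mu0 M a (L a))#})"
        using Lin[of a] False by simp
      then have 1: "rows_ge (M a) l = rows_ge (M a - {#(L a, vac n mu0 M a (L a))#}) l + ind (L a) l"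
        by (metis fst_conv ge_add image_mset_add_mset)
      have "rows_ge (step_cfg n mu0 M c L r a) l = rows_ge (M a - {#(L a, vac n mu0 M a (L a))#}) l + ind (L a - 1) l"
        using True False assms by (auto simp: step_cfg_def ge_add ind_def)
      then show ?thesis using 1 i[of "L a"] True False by (simp add: lens_def)
    next
      case False
      then show ?thesis using \<open>a \<noteq> 0\<close> by (simp add: step_cfg_def lens_def)
    qed
  qed
qed

text \<open>The amount by which the step lowers \<open>E^(a)_j\<close>.\<close>

definition "drop_at a j = (of_bool (a < c \<and> L a \<le> j) :: int)"

lemma sum_drop: "(\<Sum>l\<in>{1..j}. of_bool (a < c \<and> l = L a)) = drop_at a j"
proof (cases "a < c")
  case True
  then show ?thesis using L_pos[OF True] by (simp add: drop_at_def of_bool_def sum.delta)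
qed (simp add: drop_at_def)

lemma step_cfg_outside: "step_cfg n mu0 M c L r (n + 1) = {#}"
  using M_outside[of "n + 1"] c by (simp add: step_cfg_def)

lemma vac_step:
  assumes "1 \<le> a" "a \<le> n"
  shows "vac n (step_mu mu0) (step_cfg n mu0 M c L r) a j
     = vac n mu0 M a j - drop_at (a - 1) j + 2 * drop_at a j - drop_at (a + 1) j"
proof -
  have Mn: "M (n + 1) = {#}" using M_outside by simp
  have "vac n (step_mu mu0) (step_cfg n mu0 M c L r) a j
     = (\<Sum>l\<in>{1..j}. (start_hgt (a - 1) l - 2 * start_hgt a l + start_hgt (a + 1) l)
         - of_bool (a - 1 < c \<and> l = L (a - 1)) + 2 * of_bool (a < c \<and> l = L a) - of_bool (a + 1 < c \<and> l = L (a + 1)))"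
    unfolding vac_sum[of "step_cfg n mu0 M c L r" n a, OF step_cfg_outside assms]
    by (intro sum.cong refl) (simp only: hgt_step atLeastAtMost_iff, simp)
  also have "\<dots> = (\<Sum>l\<in>{1..j}. start_hgt (a - 1) l - 2 * start_hgt a l + start_hgt (a + 1) l) - drop_at (a - 1) j + 2 * drop_at a j - drop_at (a + 1) j"
    unfolding sum_drop[symmetric] by (simp only: sum.distrib sum_subtractf sum_distrib_left)
  finally show ?thesis unfolding vac_sum[of M n, OF Mn assms] .
qed

lemma vac_Suc:
  assumes "1 \<le> a" "a \<le> n"
  shows "vac n mu0 M a (Suc j) = vac n mu0 M a j + (start_hgt (a - 1) (Suc j) - 2 * start_hgt a (Suc j) + start_hgt (a + 1) (Suc j))"
  using vac_sum[of M n a, OF _ assms] M_outside by simp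

lemma vac_0: "vac n mu0 M a 0 = 0"
  by (simp add: vac_def Ecf_def)

lemma hh_antimono: "start_hgt a (Suc l) \<le> start_hgt a l"
  by (rule ge_antimono) simp

lemma no_row:
  assumes "a \<in> {1..n}" "\<And>x. x \<in># M a \<Longrightarrow> fst x \<noteq> l"
  shows "start_hgt a (Suc l) = start_hgt a l"
proof -
  have e: "{#x \<in># M a. fst x = l#} = {#}" using assms(2) by auto
  show ?thesis using image_filter_ge_diff[of "M a" l, unfolded e] assms(1) by (simp add: lens_def)
qed

text \<open>The definition of a rigged configuration speaks only of lengths that occur. Where the
  vacancy number is negative no row can occur, so there it is concave: from its first negative value
  on it would decrease forever, but its slope is nonnegative beyond all rows of the level.\<close>

lemma vac_nonneg:
  assumes a: "a \<in> {1..n}"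
  shows "0 \<le> vac n mu0 M a j"
proof (rule ccontr)
  assume "\<not> 0 \<le> vac n mu0 M a j"
  then have ex: "\<exists>j. vac n mu0 M a j < 0" by (auto simp: not_le)
  define j0 where "j0 = (LEAST j. vac n mu0 M a j < 0)"
  have j0: "vac n mu0 M a j0 < 0" unfolding j0_def by (rule LeastI_ex[OF ex])
  have jmin: "0 \<le> vac n mu0 M a i" if "i < j0" for i
    using not_less_Least[of i "\<lambda>j. vac n mu0 M a j < 0"] that by (simp add: j0_def not_less)
  obtain j1 where j1: "j0 = Suc j1" using j0 vac_0 by (cases j0) auto
  have a': "1 \<le> a" "a \<le> n" using a by auto
  define v where "v l = start_hgt (a - 1) l - 2 * start_hgt a l + start_hgt (a + 1) l" for l
  have down: "vac n mu0 M a i < 0 \<and> v i < 0" if "j0 \<le> i" for i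
    using that
  proof (induction i rule: dec_induct)
    case base
    show ?case using j0 jmin[of j1] vac_Suc[OF a', of j1] by (simp add: j1 v_def)
  next
    case (step i)
    have "fst x \<noteq> i" if "x \<in># M a" for x using row_facts[OF a that] step by auto
    then have "start_hgt a (Suc i) = start_hgt a i" by (rule no_row[OF a])
    then have "v (Suc i) \<le> v i" using hh_antimono[of "a - 1" i] hh_antimono[of "a + 1" i] by (simp add: v_def)
    then show ?case using step vac_Suc[OF a', of i] by (simp add: v_def)
  qed
  define K where "K = j0 + Max (insert 0 (fst ` set_mset (M a))) + 1"
  have "start_hgt a K = 0"
  proof -
    have "fst x < K" if "x \<in># M a" for x
    proof -
      have "fst x \<le> Max (insert 0 (fst ` set_mset (M a)))" using that by (intro Max_ge) auto
      then show ?thesis by (simp add: K_def)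
    qed
    then show ?thesis using a by (intro ge_beyond) (auto simp: lens_def)
  qed
  then have "0 \<le> v K" by (simp add: v_def)
  then show False using down[of K] by (simp add: K_def)
qed

text \<open>Needed because the new rigging is this number minus 1. If it were 0, then by minimality
  of \<open>L a\<close> no row of the level has a length from \<open>L (a - 1)\<close> to
  \<open>L a - 1\<close>; the vacancy number vanishes on this whole range, and column
  \<open>L (a - 1)\<close> of the level below does not shrink, although a row of just that length
  was chosen there.\<close>

lemma vac_before_L:
  assumes a: "a \<in> {1..<c}" and L: "L (a - 1) < L a"
  shows "1 \<le> vac n mu0 M a (L a - 1)"
proof (rule ccontr)
  assume neg: "\<not> 1 \<le> vac n mu0 M a (L a - 1)"
  have an: "a \<in> {1..n}" "1 \<le> a" "a \<le> n" using a c by auto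
  then have 0: "vac n mu0 M a (L a - 1) = 0" using vac_nonneg[OF an(1), of "L a - 1"] neg by simp
  have L1: "1 \<le> L (a - 1)" using a by (intro L_pos) (auto simp: less_imp_diff_less)
  \<comment> \<open>A row of length \<open>j\<close> would have rigging 0 and be singular. Without
    one, the slope cannot increase at \<open>j\<close>, while the neighbouring values are
    nonnegative; so both slopes are 0 and all inequalities are equalities.\<close>
  have down: "vac n mu0 M a (j - 1) = 0 \<and> start_hgt (a - 1) (Suc j) = start_hgt (a - 1) j"
    if j: "L (a - 1) \<le> j" "j < L a" and z: "vac n mu0 M a j = 0" for j
  proof -
    obtain i where i: "j = Suc i" using j(1) L1 by (cases j) auto
    have "fst x \<noteq> j" if x: "x \<in># M a" for x
    proof
      assume "fst x = j"
      then show False using Lmin[of a x] a an x j z row_facts[OF an(1) x] by auto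
    qed
    then have "start_hgt a (Suc j) = start_hgt a j" by (rule no_row[OF an(1)])
    then show ?thesis
      using vac_Suc[OF an(2,3), of j] vac_Suc[OF an(2,3), of i] z vac_nonneg[OF an(1), of i] vac_nonneg[OF an(1), of "Suc j"]
        hh_antimono[of "a - 1" j] hh_antimono[of "a + 1" j] unfolding i by simp
  qed
  have "vac n mu0 M a j = 0" if "L (a - 1) \<le> j" "j \<le> L a - 1" for j
    using that(2,1)
  proof (induction j rule: inc_induct)
    case base then show ?case using 0 by simp
  next
    case (step j)
    then show ?case using down[of "Suc j"] by simp
  qed
  then have "vac n mu0 M a (L (a - 1)) = 0" using L by simp
  then have eq: "start_hgt (a - 1) (Suc (L (a - 1))) = start_hgt (a - 1) (L (a - 1))" using down[of "L (a - 1)"] L by simp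
  show False
  proof (cases "a = 1")
    case True
    have "last mu0 \<in># mset mu0" using ne by simp
    then obtain B where B: "mset mu0 = add_mset (last mu0) B" by (metis insert_DiffM)
    show False using eq ge_antimono[of "last mu0" "Suc (last mu0)" B] True unfolding lens_def
      by (simp add: B L0 ge_add ind_def)
  next
    case False
    then have "a - 1 \<in> {1..<c}" using a by (cases a) auto
    then have "(L (a - 1), vac n mu0 M (a - 1) (L (a - 1))) \<in># {#x \<in># M (a - 1). fst x = L (a - 1)#}"
      using Lin[of "a - 1"] by simp
    then have "0 < size {#x \<in># M (a - 1). fst x = L (a - 1)#}" by (metis nonempty_has_size empty_not_add_mset insert_DiffM)
    then show False using image_filter_ge_diff[of "M (a - 1)" "L (a - 1)"] eq False a by (simp add: lens_def)
  qed
qed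

definition "step_rig a = vac n (step_mu mu0) (step_cfg n mu0 M c L (\<lambda>_. 0)) a (L a - 1)"

abbreviation "stepped_cfg \<equiv> step_cfg n mu0 M c L step_rig"

lemma L_mono_next: "a + 1 < c \<Longrightarrow> L a \<le> L (a + 1)"
  using Lmono[of "a + 1"] by simp

lemma step_rig_eq:
  assumes "a \<in> {1..<c}"
  shows "step_rig a = vac n mu0 M a (L a - 1) - of_bool (L (a - 1) < L a)"
proof -
  have a: "1 \<le> a" "a \<le> n" "a < c" "a - 1 < c" using assms c by auto
  have "\<not> L a \<le> L a - 1" using L_pos[OF a(3)] by linarith
  then have "drop_at a (L a - 1) = 0" by (simp add: drop_at_def)
  moreover have "drop_at (a + 1) (L a - 1) = 0"
    using L_pos[OF a(3)] L_mono_next[of a] by (auto simp: drop_at_def)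
  moreover have "drop_at (a - 1) (L a - 1) = of_bool (L (a - 1) < L a)"
    using L_pos[OF a(3)] a(4) by (auto simp: drop_at_def)
  ultimately show ?thesis unfolding step_rig_def vac_step[OF a(1,2)] by simp
qed

text \<open>A vacancy number falls, by 1, only at lengths from \<open>L (a - 1)\<close> on and below
  \<open>L a\<close> (without upper limit if \<open>a = c\<close>). The rows there are not singular,
  by the choice of \<open>L a\<close>, so their riggings have room.\<close>

lemma kept_row:
  assumes "a \<in> {1..n}" "x \<in># M a"
  shows "snd x \<le> vac n mu0 M a (fst x) - drop_at (a - 1) (fst x) + 2 * drop_at a (fst x) - drop_at (a + 1) (fst x)"
    and "a \<le> c \<Longrightarrow> fst x < L a \<or> a = c \<Longrightarrow> snd x \<le> vac n mu0 M a (fst x) - drop_at (a - 1) (fst x)"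
    and "snd x \<le> vac n mu0 M a (fst x)"
proof -
  show s: "snd x \<le> vac n mu0 M a (fst x)" using row_facts[OF assms] by simp
  show 2: "snd x \<le> vac n mu0 M a (fst x) - drop_at (a - 1) (fst x)" if "a \<le> c" "fst x < L a \<or> a = c"
  proof (cases "L (a - 1) \<le> fst x")
    case True
    then have "snd x \<noteq> vac n mu0 M a (fst x)" using Lmin[of a x] assms that by auto
    then show ?thesis using s by (simp add: drop_at_def)
  next
    case False then show ?thesis using s by (simp add: drop_at_def)
  qed
  show "snd x \<le> vac n mu0 M a (fst x) - drop_at (a - 1) (fst x) + 2 * drop_at a (fst x) - drop_at (a + 1) (fst x)"
  proof (cases "a < c \<and> L a \<le> fst x")
    case True
    then show ?thesis using s by (simp add: drop_at_def)
  next
    case False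
    then have "drop_at (a + 1) (fst x) = 0" "drop_at a (fst x) = 0"
      using L_mono_next[of a] by (auto simp: drop_at_def)
    moreover have "snd x \<le> vac n mu0 M a (fst x) - drop_at (a - 1) (fst x)"
    proof (cases "a \<le> c")
      case True
      then show ?thesis using 2 False by force
    next
      case gt: False
      then have "\<not> a - 1 < c" by linarith
      then show ?thesis using s by (simp add: drop_at_def)
    qed
    ultimately show ?thesis by simp
  qed
qed

lemma step_rows:
  assumes "x \<in># step_cfg n mu0 M c L r a"
  shows "x \<in># M a \<or> a \<in> {1..<c} \<and> 1 < L a \<and> x = (L a - 1, r a)"
  using assms by (auto simp: step_cfg_def split: if_splits dest: in_diffD)

lemma step_is_RC: "is_RC n (step_mu mu0) stepped_cfg"
proof -
  have mu: "0 < l" if "l \<in> set (step_mu mu0)" for l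
    using that rc by (auto simp: step_mu_def is_RC_def split: if_splits dest: in_set_butlastD)
  have rows: "1 \<le> fst x \<and> 0 \<le> snd x \<and> snd x \<le> vac n (step_mu mu0) stepped_cfg a (fst x)"
    if a: "a \<in> {1..n}" and x: "x \<in># stepped_cfg a" for a x
    using step_rows[OF x]
  proof (elim disjE conjE)
    assume M: "x \<in># M a"
    have an: "1 \<le> a" "a \<le> n" using a by auto
    show ?thesis unfolding vac_step[OF an] using row_facts[OF a M] kept_row(1)[OF a M] by simp
  next
    assume ac: "a \<in> {1..<c}" and L1: "1 < L a" and xx: "x = (L a - 1, step_rig a)"
    have an: "1 \<le> a" "a \<le> n" using a by auto
    have "0 \<le> step_rig a"
      using step_rig_eq[OF ac] vac_before_L[OF ac] vac_nonneg[OF a, of "L a - 1"] by (cases "L (a - 1) < L a") auto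
    moreover have "vac n (step_mu mu0) stepped_cfg a (L a - 1) = step_rig a"
      unfolding step_rig_def vac_step[OF an] by (rule refl)
    ultimately show ?thesis using L1 xx by simp
  qed
  have out: "stepped_cfg a = {#}" if "a \<notin> {1..n}" for a
    using M_outside[OF that] that c by (auto simp: step_cfg_def)
  show ?thesis unfolding is_RC_def using mu rows out by blast
qed

section \<open>Invariance of tau, one level at a time\<close>

definition "mixed k = (\<lambda>a. if a \<le> k then stepped_cfg a else M a)"

text \<open>An instance of \<open>one_level\<close> in which the level below is already shortened
  and the level above is not. In this state the vacancy numbers of level \<open>a\<close> are those
  of \<open>M\<close> minus \<open>drop_at (a - 1)\<close>, so the chosen singular row exceeds its
  bound by exactly 1.\<close>

lemma tau_mixed:
  assumes a: "a \<in> {1..<c}" and d: "1 \<le> d" "d \<le> n + 1" and lam: "lam \<subseteq># mset (step_mu mu0)"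
  shows "tau n (mixed a) d lam = tau n (mixed (a - 1)) d lam"
proof -
  have an: "a \<in> {1..n}" "1 \<le> a" "a \<le> n" "a < c" "a - 1 < c" using a c by auto
  define R where "R = M a - {#(L a, vac n mu0 M a (L a))#}"
  have MR: "M a = add_mset (L a, vac n mu0 M a (L a)) R" using Lin[OF a] by (simp add: R_def)
  have NR: "stepped_cfg a = R + (if 1 < L a then {#(L a - 1, step_rig a)#} else {#})" using a by (simp add: step_cfg_def R_def)
  have wf: "wf_cfg n M" using rc n by (simp add: is_RC_def wf_cfg_def)
  obtain K where K: "bounded n K M" "\<forall>x\<in>#mset mu0. x \<le> K" using ex_bound[OF wf] by blast
  have Kb: "1 \<le> fst x \<and> fst x \<le> K" if "x \<in># M b" "b \<in> {1..n}" for x b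
    using K(1)[unfolded bounded_def] that by simp
  have Kn: "bounded n K stepped_cfg" unfolding bounded_def
  proof (intro ballI)
    fix b x assume b: "b \<in> {1..n}" and x: "x \<in># stepped_cfg b"
    show "1 \<le> fst x \<and> fst x \<le> K" using step_rows[OF x]
    proof (elim disjE conjE)
      assume "x \<in># M b" then show ?thesis using Kb b by blast
    next
      assume "b \<in> {1..<c}" "1 < L b" "x = (L b - 1, step_rig b)"
      then show ?thesis using Kb[OF Lin[of b] b] by (cases "L b") auto
    qed
  qed
  have Kmix: "bounded n K (mixed k)" for k
    using K(1) Kn by (simp add: bounded_def mixed_def)
  have "l \<le> K" if "l \<in> set (step_mu mu0)" for l
    using that K(2) ne by (auto simp: step_mu_def split: if_splits dest: in_set_butlastD intro: le_trans[OF diff_le_self])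
  then have lamK: "\<forall>x\<in>#lam. x \<le> K" using mset_subset_eqD[OF lam] by simp
  let ?m = "mset (step_mu mu0)"
  define A1 where "A1 = lens ?m stepped_cfg (a - 1)"
  define A2 where "A2 = lens ?m M (a + 1)"
  define Z where "Z l = ge A1 l + ge A2 l" for l
  define P where "P j = (\<Sum>l\<in>{1..j}. Z l - 2 * rows_ge (add_mset (L a, vac n mu0 M a (L a)) R) l)" for j
  have P: "P j = vac n mu0 M a j - drop_at (a - 1) j" for j
  proof -
    have "Z l - 2 * rows_ge (M a) l = (start_hgt (a - 1) l - 2 * start_hgt a l + start_hgt (a + 1) l) - of_bool (a - 1 < c \<and> l = L (a - 1))"
      if "l \<in> {1..j}" for l
      using hgt_step[of l step_rig "a - 1"] that an(2) unfolding Z_def A1_def A2_def by (simp add: lens_def)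
    then have "P j = (\<Sum>l\<in>{1..j}. (start_hgt (a - 1) l - 2 * start_hgt a l + start_hgt (a + 1) l) - of_bool (a - 1 < c \<and> l = L (a - 1)))"
      unfolding P_def MR[symmetric] by (rule sum.cong[OF refl])
    then show ?thesis
      unfolding sum_subtractf[of _ "\<lambda>l. of_bool (a - 1 < c \<and> l = L (a - 1))"] sum_drop
      using vac_sum[of M n a, OF _ an(2,3)] M_outside by simp
  qed
  have Pm: "vac n mu0 M a (L a) = P (L a) + 1"
    using P[of "L a"] Lmono[OF a] an(5) by (simp add: drop_at_def)
  have Pm1: "step_rig a = P (L a - 1)"
    unfolding step_rig_eq[OF a] P drop_at_def using an(5) L_pos[OF an(4)] by auto
  have RM: "x \<in># M a" if "x \<in># R" for x using that MR by simp
  have R1: "\<forall>x\<in>#R. 1 \<le> fst x \<and> fst x \<le> K" using Kb[OF RM an(1)] by blast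
  have Lm: "1 \<le> L a" "L a \<le> K" using Kb[OF Lin[OF a] an(1)] by auto
  have R2: "snd x \<le> P (fst x) + 1" if "x \<in># R" for x
    using kept_row(3)[OF an(1) RM[OF that]] unfolding P drop_at_def by auto
  have R3: "snd x \<le> P (fst x)" if "x \<in># R" "fst x < L a" for x
    using kept_row(2)[OF an(1) RM[OF that(1)]] that(2) an(4) unfolding P by simp
  define zN where "zN N = (\<lambda>l. hgt lam N (a - 1) l + hgt lam N (a + 1) l - of_bool (d = a))" for N
  have level: "A \<subseteq># M a \<Longrightarrow> \<exists>B. B \<subseteq># stepped_cfg a \<and> level_val K (zN N) A \<le> level_val K (zN N) B"
     "A \<subseteq># stepped_cfg a \<Longrightarrow> \<exists>B. B \<subseteq># M a \<and> level_val K (zN N) A \<le> level_val K (zN N) B"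
    if N: "\<And>b. b \<in> {1..n} \<Longrightarrow> b \<noteq> a \<Longrightarrow> N b \<subseteq># mixed a b" "N (n + 1) = {#}" for N A
  proof -
    have B1: "lens lam N (a - 1) \<subseteq># A1"
    proof (cases "a = 1")
      case True then show ?thesis using lam by (simp add: A1_def lens_def)
    next
      case False
      then have "a - 1 \<in> {1..n}" "a - 1 \<noteq> a" "a - 1 \<le> a" using an by auto
      then show ?thesis using N(1)[of "a - 1"] False
        by (auto simp: A1_def lens_def mixed_def intro!: image_mset_subseteq_mono)
    qed
    have B2: "lens lam N (a + 1) \<subseteq># A2"
    proof (cases "a = n")
      case True then show ?thesis using N(2) by (simp add: A2_def lens_def)
    next
      case False
      then have "a + 1 \<in> {1..n}" using an by auto
      then show ?thesis using N(1)[of "a + 1"]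
        by (auto simp: A2_def lens_def mixed_def intro!: image_mset_subseteq_mono)
    qed
    \<comment> \<open>Columns of the adjacent rows that are left out, plus the linear term for
      \<open>d = a\<close>; as column lengths they are antitone in \<open>l\<close>.\<close>
    define w where "w l = ge (A1 - lens lam N (a - 1)) l + ge (A2 - lens lam N (a + 1)) l + of_bool (d = a)" for l
    have ged: "ge (A - B) l = ge A l - ge B l" if "B \<subseteq># A" for A B l
      using arg_cong[OF subset_mset.add_diff_inverse[OF that], of "\<lambda>A. ge A l"] by (simp add: ge_plus)
    have zw: "zN N l = Z l - w l" for l
      unfolding zN_def Z_def w_def ged[OF B1] ged[OF B2] by simp
    have w0: "0 \<le> w l" for l by (simp add: w_def)
    have wm: "w l' \<le> w l" if "1 \<le> l" "l \<le> l'" for l l'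
      using ge_antimono[OF that(2), of "A1 - lens lam N (a - 1)"] ge_antimono[OF that(2), of "A2 - lens lam N (a + 1)"]
      by (simp add: w_def)
    note ol = one_level[OF R1 Lm w0 wm zw P_def Pm Pm1 R2 R3]
    show "\<exists>B. B \<subseteq># stepped_cfg a \<and> level_val K (zN N) A \<le> level_val K (zN N) B" if A: "A \<subseteq># M a"
    proof -
      obtain B where B: "B \<subseteq># add_mset (L a - 1, step_rig a) R" "level_val K (zN N) A \<le> level_val K (zN N) B"
        using ol(1)[of A] A MR by auto
      show ?thesis
      proof (cases "1 < L a")
        case True
        then show ?thesis using B NR by auto
      next
        \<comment> \<open>A row of length 1 disappears in the step; \<open>one_level\<close> keeps
          it as a row of length 0 and rigging 0, which contributes nothing.\<close>
        case False
        then have 1: "L a - 1 = 0" "step_rig a = 0" using Lm Pm1 by (simp_all add: P_def)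
        show ?thesis using B(1)
        proof (cases rule: subset_add_cases)
          case 1
          then show ?thesis using B(2) NR False by auto
        next
          case (2 C)
          then have "level_val K (zN N) B = level_val K (zN N) C" using level_val_add[of 0 K "zN N" 0 C] 1 by simp
          then show ?thesis using B(2) NR False 2(2) by auto
        qed
      qed
    qed
    show "\<exists>B. B \<subseteq># M a \<and> level_val K (zN N) A \<le> level_val K (zN N) B" if A: "A \<subseteq># stepped_cfg a"
    proof -
      have "A \<subseteq># add_mset (L a - 1, step_rig a) R"
        using A NR by (cases "1 < L a") (simp_all add: subset_add)
      then show ?thesis using ol(2)[of A] unfolding MR[symmetric] by blast
    qed
  qed
  have eqs: "mixed (a - 1) b = mixed a b" if "b \<noteq> a" for b using that an by (auto simp: mixed_def)
  have at: "mixed a a = stepped_cfg a" "mixed (a - 1) a = M a" using an by (auto simp: mixed_def)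
  show ?thesis
  proof (rule order.antisym)
    show "tau n (mixed a) d lam \<le> tau n (mixed (a - 1)) d lam"
    proof (rule tau_replace_le[OF n d an(1) Kmix Kmix _ lamK])
      show "mixed (a - 1) b = mixed a b" if "b \<noteq> a" for b by (rule eqs[OF that])
      fix N assume N: "subcfg n N (mixed a)"
      have "N a \<subseteq># stepped_cfg a" using N an(1) at unfolding subcfg_def by metis
      then show "\<exists>B. B \<subseteq># mixed (a - 1) a \<and> level_val K (\<lambda>l. hgt lam N (a - 1) l + hgt lam N (a + 1) l - of_bool (d = a)) (N a)
        \<le> level_val K (\<lambda>l. hgt lam N (a - 1) l + hgt lam N (a + 1) l - of_bool (d = a)) B"
        unfolding at zN_def[symmetric] using N by (intro level(2)) (auto simp: subcfg_def)
    qed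
    show "tau n (mixed (a - 1)) d lam \<le> tau n (mixed a) d lam"
    proof (rule tau_replace_le[OF n d an(1) Kmix Kmix _ lamK])
      show "mixed a b = mixed (a - 1) b" if "b \<noteq> a" for b by (rule eqs[OF that, symmetric])
      fix N assume N: "subcfg n N (mixed (a - 1))"
      have "N a \<subseteq># M a" using N an(1) at unfolding subcfg_def by metis
      moreover have "N b \<subseteq># mixed a b" if "b \<in> {1..n}" "b \<noteq> a" for b
        using N that(1) unfolding subcfg_def eqs[OF that(2), symmetric] by blast
      moreover have "N (n + 1) = {#}" using N by (simp add: subcfg_def)
      ultimately show "\<exists>B. B \<subseteq># mixed a a \<and> level_val K (\<lambda>l. hgt lam N (a - 1) l + hgt lam N (a + 1) l - of_bool (d = a)) (N a)
        \<le> level_val K (\<lambda>l. hgt lam N (a - 1) l + hgt lam N (a + 1) l - of_bool (d = a)) B"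
        unfolding at zN_def[symmetric] by (intro level(1))
    qed
  qed
qed

lemma tau_step:
  assumes d: "1 \<le> d" "d \<le> n + 1" and lam: "lam \<subseteq># mset (step_mu mu0)"
  shows "tau n stepped_cfg d lam = tau n M d lam"
proof -
  have "tau n (mixed k) d lam = tau n M d lam" if "k < c" for k
    using that
  proof (induction k)
    case 0
    have "stepped_cfg 0 = M 0" by (simp add: step_cfg_def)
    then have "mixed 0 = M" by (auto simp: mixed_def)
    then show ?case by simp
  next
    case (Suc k)
    then show ?case using tau_mixed[of "Suc k", OF _ d lam] by simp
  qed
  from this[of "c - 1"] have "tau n (mixed (c - 1)) d lam = tau n M d lam" using c by simp
  moreover have "mixed (c - 1) = stepped_cfg"
    by (rule ext) (use c in \<open>auto simp: mixed_def step_cfg_def\<close>)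
  ultimately show ?thesis by simp
qed

lemma step_weight:
  "sum_mset (image_mset fst (M a)) = sum_mset (image_mset fst (stepped_cfg a)) + of_bool (a \<in> {1..<c})"
proof (cases "a \<in> {1..<c}")
  case True
  then have "M a = add_mset (L a, vac n mu0 M a (L a)) (M a - {#(L a, vac n mu0 M a (L a))#})"
    using Lin[OF True] by simp
  then have "sum_mset (image_mset fst (M a)) = L a + sum_mset (image_mset fst (M a - {#(L a, vac n mu0 M a (L a))#}))"
    by (metis fst_conv image_mset_add_mset sum_mset.add_mset)
  then show ?thesis using True L_pos[of a] by (auto simp: step_cfg_def)
qed (auto simp: step_cfg_def)

end

section \<open>The image of the KKR map\<close>

definition cfg_weight :: "rc \<Rightarrow> nat \<Rightarrow> nat" where
  "cfg_weight M a = sum_mset (image_mset fst (M a))"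

lemma kstep_spec:
  assumes n: "1 \<le> n" and rc: "is_RC n mu0 M" and ne: "mu0 \<noteq> []"
  shows "\<exists>c M'. kstep n mu0 M = (c, step_mu mu0, M') \<and> c \<in> {1..n+1} \<and> is_RC n (step_mu mu0) M'
    \<and> (\<forall>d lam. 1 \<le> d \<longrightarrow> d \<le> n + 1 \<longrightarrow> lam \<subseteq># mset (step_mu mu0) \<longrightarrow> tau n M' d lam = tau n M d lam)
    \<and> (\<forall>a. cfg_weight M a = cfg_weight M' a + of_bool (1 \<le> a \<and> a < c))"
proof -
  obtain c L where cL: "1 \<le> c" "c \<le> 1 + n" "L (1 - 1) = last mu0"
    "choose_rows n n mu0 M 1 (last mu0) = map (\<lambda>a. (a, (L a, vac n mu0 M a (L a)))) [1..<c]"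
    "\<forall>a\<in>{1..<c}. L (a - 1) \<le> L a \<and> (L a, vac n mu0 M a (L a)) \<in># M a"
    "\<forall>a\<in>{1..c}. a < 1 + n \<longrightarrow> (\<forall>x\<in>#M a. L (a - 1) \<le> fst x \<longrightarrow> a = c \<or> fst x < L a
            \<longrightarrow> snd x \<noteq> vac n mu0 M a (fst x))"
    using choose_rows_spec[of 1 n "last mu0" n mu0 M] by blast
  have c: "c \<le> n + 1" using cL(2) by simp
  have L0: "L 0 = last mu0" using cL(3) by simp
  have 1: "L (a - 1) \<le> L a" "(L a, vac n mu0 M a (L a)) \<in># M a" if "a \<in> {1..<c}" for a
    using cL(5) that by auto
  have 2: "snd x \<noteq> vac n mu0 M a (fst x)"
    if "a \<in> {1..c}" "a \<le> n" "x \<in># M a" "L (a - 1) \<le> fst x" "a = c \<or> fst x < L a" for a x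
    using cL(6)[rule_format, OF that(1) _ that(3-5)] that(2) by simp
  note ctx = n rc ne cL(1) c L0 1 2
  have r: "step_rig n mu0 M c L = (\<lambda>a. vac n (step_mu mu0) (step_cfg n mu0 M c L (\<lambda>_. 0)) a (L a - 1))"
    by (rule ext) (rule step_rig_def[of n mu0 M c L, OF ctx])
  have k: "kstep n mu0 M = (c, step_mu mu0, stepped_cfg n mu0 M c L)"
    using kstep_eq[OF cL(4,1)] unfolding r .
  have w: "cfg_weight M a = cfg_weight (stepped_cfg n mu0 M c L) a + of_bool (1 \<le> a \<and> a < c)" for a
    using step_weight[of n mu0 M c L, OF ctx, of a] by (simp add: cfg_weight_def)
  show ?thesis
    using k step_is_RC[of n mu0 M c L, OF ctx] tau_step[of n mu0 M c L, OF ctx] w cL(1) c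
    by (intro exI[of _ c] exI[of _ "stepped_cfg n mu0 M c L"]) simp
qed

text \<open>\<open>f\<close> is the number of boxes left in the processed row; the conditional
  reflects that the row is removed once it is empty.\<close>

lemma ksteps_spec:
  assumes n: "1 \<le> n"
  shows "is_RC n (B @ (if f = 0 then [] else [f])) M \<Longrightarrow>
    \<exists>cs M'. ksteps f n (B @ (if f = 0 then [] else [f])) M = (cs, B, M') \<and> is_RC n B M'
     \<and> length cs = f \<and> set cs \<subseteq> {1..n+1}
     \<and> (\<forall>d lam. 1 \<le> d \<longrightarrow> d \<le> n + 1 \<longrightarrow> lam \<subseteq># mset B \<longrightarrow> tau n M' d lam = tau n M d lam)
     \<and> (\<forall>a. 1 \<le> a \<longrightarrow> cfg_weight M a = cfg_weight M' a + length (filter (\<lambda>c. a < c) cs))"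
proof (induction f arbitrary: M)
  case (Suc f)
  let ?m = "B @ (if f = 0 then [] else [f])"
  have sm: "step_mu (B @ [Suc f]) = ?m" by (simp add: step_mu_def)
  obtain c M1 where 1: "kstep n (B @ [Suc f]) M = (c, ?m, M1)" "c \<in> {1..n+1}" "is_RC n ?m M1"
    "\<And>d lam. 1 \<le> d \<Longrightarrow> d \<le> n + 1 \<Longrightarrow> lam \<subseteq># mset ?m \<Longrightarrow> tau n M1 d lam = tau n M d lam"
    "\<And>a. cfg_weight M a = cfg_weight M1 a + of_bool (1 \<le> a \<and> a < c)"
    using kstep_spec[OF n, of "B @ [Suc f]" M, unfolded sm] Suc.prems by auto
  obtain cs M' where 2: "ksteps f n ?m M1 = (cs, B, M')" "is_RC n B M'" "length cs = f" "set cs \<subseteq> {1..n+1}"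
    "\<And>d lam. 1 \<le> d \<Longrightarrow> d \<le> n + 1 \<Longrightarrow> lam \<subseteq># mset B \<Longrightarrow> tau n M' d lam = tau n M1 d lam"
    "\<And>a. 1 \<le> a \<Longrightarrow> cfg_weight M1 a = cfg_weight M' a + length (filter (\<lambda>c. a < c) cs)"
    using Suc.IH[OF 1(3)] by auto
  have "ksteps (Suc f) n (B @ [Suc f]) M = (c # cs, B, M')" using 1(1) 2(1) by simp
  moreover have "tau n M' d lam = tau n M d lam" if "1 \<le> d" "d \<le> n + 1" "lam \<subseteq># mset B" for d lam
  proof -
    have "mset B \<subseteq># mset ?m" by simp
    then have "lam \<subseteq># mset ?m" using that(3) by (rule subset_mset.order_trans[rotated])
    then show ?thesis using 2(5)[OF that] 1(4)[OF that(1,2)] by simp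
  qed
  moreover have "cfg_weight M a = cfg_weight M' a + length (filter (\<lambda>c. a < c) (c # cs))" if "1 \<le> a" for a
    using 1(5)[of a] 2(6)[OF that] that by simp
  ultimately show ?case using 1(2) 2(2-4) by (intro exI[of _ "c # cs"] exI[of _ M']) simp
qed auto

lemma count_filter_less:
  "1 \<le> (d::nat) \<Longrightarrow> count (mset cs) d + length (filter (\<lambda>c. d < c) cs) = length (filter (\<lambda>c. d - 1 < c) cs)"
proof -
  assume "1 \<le> d"
  then obtain e where e: "d = Suc e" by (cases d) auto
  have "count (mset cs) (Suc e) + length (filter (\<lambda>c. Suc e < c) cs) = length (filter (\<lambda>c. e < c) cs)"
    by (induction cs) auto
  then show ?thesis by (simp add: e)
qed

lemma sum_letter_counts:
  assumes "set cs \<subseteq> {1..n+1}"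
  shows "sum_list (letter_counts n cs) = length cs"
proof -
  have "sum_list (letter_counts n cs) = (\<Sum>d\<in>{1..<n+2}. count (mset cs) d)"
    by (simp add: letter_counts_def sum_list_distinct_conv_sum_set del: upt_Suc)
  also have "\<dots> = length cs"
    unfolding count_mset using assms by (intro sum_count_set) auto
  finally show ?thesis .
qed

lemma tau_full_diff:
  assumes "is_RC n mu0 M" "1 \<le> n" "2 \<le> d" "d \<le> n + 1"
  shows "tau n M d (mset mu0) - tau n M (d - 1) (mset mu0) = int (cfg_weight M (d - 1)) - int (cfg_weight M d)"
proof -
  have "M (n + 1) = {#}" using assms(1) by (simp add: is_RC_def)
  then show ?thesis
    using full_cfg_optimal[OF assms(1,2), of d] full_cfg_optimal[OF assms(1,2), of "d - 1"] assms(3,4)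
    by (auto simp: tau_val_def cfg_weight_def)
qed

text \<open>A step with output \<open>c\<close> removes a box from exactly the levels below
  \<open>c\<close>. So the number of letters \<open>d \<ge> 2\<close> is the loss of level
  \<open>d - 1\<close> minus that of level \<open>d\<close>; optimality of the full choice, applied
  before and after the row is processed, expresses both through \<open>tau\<close>.\<close>

lemma letter_counts_tau_factor:
  assumes n: "1 \<le> n" and rc: "is_RC n (B @ [l]) M"
    and ks: "is_RC n B M'" "length cs = l" "set cs \<subseteq> {1..n+1}"
    "\<And>d lam. 1 \<le> d \<Longrightarrow> d \<le> n + 1 \<Longrightarrow> lam \<subseteq># mset B \<Longrightarrow> tau n M' d lam = tau n M d lam"
    "\<And>a. 1 \<le> a \<Longrightarrow> cfg_weight M a = cfg_weight M' a + length (filter (\<lambda>c. a < c) cs)"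
  shows "letter_counts n cs = tau_factor n M (mset B) l"
proof -
  have wf: "wf_cfg n M" using rc n by (simp add: is_RC_def wf_cfg_def)
  have eq: "int (count (mset cs) d) = tau_letter n M (mset B) l d" if d: "2 \<le> d" "d \<le> n + 1" for d
  proof -
    have d1: "1 \<le> d - 1" "d - 1 \<le> n + 1" "1 \<le> d" using d by auto
    have "tau n M d (mset B) - tau n M (d - 1) (mset B) = int (cfg_weight M' (d - 1)) - int (cfg_weight M' d)"
      using tau_full_diff[OF ks(1) n d] ks(4)[OF d1(3) d(2), of "mset B"] ks(4)[OF d1(1,2), of "mset B"] by simp
    moreover have "tau n M d (add_mset l (mset B)) - tau n M (d - 1) (add_mset l (mset B)) = int (cfg_weight M (d - 1)) - int (cfg_weight M d)"
      using tau_full_diff[OF rc n d] by simp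
    ultimately have "tau_letter n M (mset B) l d = (int (cfg_weight M (d - 1)) - int (cfg_weight M' (d - 1))) - (int (cfg_weight M d) - int (cfg_weight M' d))"
      using d by (simp add: tau_letter_def tq_def)
    also have "\<dots> = int (length (filter (\<lambda>c. d - 1 < c) cs)) - int (length (filter (\<lambda>c. d < c) cs))"
      using ks(5)[OF d1(1)] ks(5)[OF d1(3)] by simp
    also have "\<dots> = int (count (mset cs) d)" using count_filter_less[OF d1(3), of cs] by linarith
    finally show ?thesis by simp
  qed
  have up: "[1..<n+2] = 1 # [2..<n+2]" using n by (simp add: upt_conv_Cons numeral_2_eq_2)
  have tl: "map (\<lambda>j. count (mset cs) j) [2..<n+2] = map (\<lambda>d. nat (tau_letter n M (mset B) l d)) [2..<n+2]"
  proof (rule map_cong[OF refl])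
    fix d assume "d \<in> set [2..<n+2]"
    then have "2 \<le> d" "d \<le> n + 1" by auto
    then show "count (mset cs) d = nat (tau_letter n M (mset B) l d)" using eq[of d] by linarith
  qed
  \<comment> \<open>The letter 1 is not seen by these differences; it follows from the common total
    \<open>l\<close>.\<close>
  have "sum_list (letter_counts n cs) = sum_list (tau_factor n M (mset B) l)"
    using sum_letter_counts[OF ks(3)] sum_list_tau_factor[OF wf, of "mset B" l] ks(2) by simp
  then show ?thesis unfolding letter_counts_def tau_factor_def up list.map(2) tl by simp
qed

lemma tau_path_cong:
  assumes "\<And>d lam'. 1 \<le> d \<Longrightarrow> d \<le> n + 1 \<Longrightarrow> lam' \<subseteq># lam + mset as \<Longrightarrow> tau n M' d lam' = tau n M d lam'"
  shows "tau_path n M' lam as = tau_path n M lam as"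
  using assms
proof (induction as arbitrary: lam)
  case (Cons a as)
  have tq: "tq n M' d lam' = tq n M d lam'" if "lam' \<subseteq># lam + mset (a # as)" "d \<le> n + 1" for d lam'
    using Cons.prems[of d lam'] Cons.prems[of "n + 1" lam'] that by (cases "d = 0") (auto simp: tq_def)
  have "add_mset a lam \<subseteq># lam + mset (a # as)" "lam \<subseteq># lam + mset (a # as)" by simp_all
  note t = tq[OF this(1)] tq[OF this(2)]
  have "tau_letter n M' lam a d = tau_letter n M lam a d" if "d \<le> n + 1" for d
    using t[of d] t[of "d - 1"] that by (simp add: tau_letter_def)
  then have "tau_factor n M' lam a = tau_factor n M lam a" unfolding tau_factor_def by (intro map_cong refl) (auto simp del: upt_Suc)
  moreover have "tau_path n M' (add_mset a lam) as = tau_path n M (add_mset a lam) as"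
    using Cons.prems by (intro Cons.IH) simp
  ultimately show ?case by simp
qed simp

text \<open>The rows are consumed from the right. The remaining factors come from \<open>M'\<close>,
  but they involve \<open>tau\<close> only on sub-multisets of \<open>B\<close>, where
  \<open>M'\<close> and \<open>M\<close> agree.\<close>

lemma KKR_tau_path:
  assumes n: "1 \<le> n"
  shows "is_RC n mu0 M \<Longrightarrow> KKR n mu0 M = tau_path n M {#} mu0"
  unfolding KKR_def
proof (induction mu0 arbitrary: M rule: rev_induct)
  case (snoc l B)
  have l: "0 < l" using snoc.prems by (simp add: is_RC_def)
  then have "(if l = 0 then [] else [l]) = [l]" by simp
  then obtain cs M' where ks: "ksteps l n (B @ [l]) M = (cs, B, M')" "is_RC n B M'" "length cs = l" "set cs \<subseteq> {1..n+1}"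
    "\<And>d lam. 1 \<le> d \<Longrightarrow> d \<le> n + 1 \<Longrightarrow> lam \<subseteq># mset B \<Longrightarrow> tau n M' d lam = tau n M d lam"
    "\<And>a. 1 \<le> a \<Longrightarrow> cfg_weight M a = cfg_weight M' a + length (filter (\<lambda>c. a < c) cs)"
    using ksteps_spec[OF n, of B l M] snoc.prems by auto
  have "kkr_aux (length (B @ [l])) n (B @ [l]) M = kkr_aux (length B) n B M' @ [letter_counts n cs]"
    using ks(1) by simp
  also have "kkr_aux (length B) n B M' = tau_path n M' {#} B" by (rule snoc.IH[OF ks(2)])
  also have "tau_path n M' {#} B = tau_path n M {#} B" using ks(5) by (intro tau_path_cong) simp
  also have "letter_counts n cs = tau_factor n M (mset B) l" by (rule letter_counts_tau_factor[OF n snoc.prems ks(2-6)])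
  finally show ?case by (simp add: tau_path_append)
qed simp

theorem theorem6p12:
  fixes n :: nat and mu0 :: "nat list" and M :: rc and p :: "nat list list"
  assumes "1 \<le> n"
    and "is_RC n mu0 M"
    and "p = KKR n mu0 M"
  shows "\<forall>i\<in>{1..n+1}. \<forall>k\<in>{1..length mu0}.
           tau_kd n mu0 M k i = int (rho n k i p)
         \<and> rho n k i p = Energy n (int i) (take k p)"
proof (intro ballI)
  fix i k assume i: "i \<in> {1..n+1}" and k: "k \<in> {1..length mu0}"
  have pos: "pos_cfg n M" using assms(1,2) by (simp add: pos_cfg_def wf_cfg_def is_RC_def)
  have p: "p = tau_path n M {#} mu0" using KKR_tau_path[OF assms(1,2)] assms(3) by simp
  have mu: "\<forall>a\<in>set mu0. 1 \<le> a" using assms(2) by (simp add: is_RC_def Suc_le_eq)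
  have 1: "int (rho n k i p) = tau n M i (mset (take k mu0))"
    unfolding p using i k by (intro rho_tau_path[OF pos mu]) auto
  have 2: "int (Energy n (int i) (take k p)) = tau n M i (mset (take k mu0))"
    unfolding p tau_path_take using i k mu by (intro Energy_tau_path[OF pos]) (auto dest: in_set_takeD)
  show "tau_kd n mu0 M k i = int (rho n k i p) \<and> rho n k i p = Energy n (int i) (take k p)"
    unfolding tau_kd_def using 1 2 by linarith
qed

end
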